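(* Let $W_0:\mathbb{R}^d\times\mathcal{P}_2(\mathbb{R}^d)\to\mathbb{R}^d$ and $F,G:\mathbb{R}^d\times\mathcal{P}_2(\mathbb{R}^d)\times\mathbb{R}^d\to\mathbb{R}^d$ be continuous. Assume: (1) there is a constant $C_1$ with $|W_0(x,\mu)|+|F(x,\mu,u)|+|G(x,\mu,u)|\le C_1(1+|x|+|u|+\sqrt{E_2(\mu)})$ for all $(x,\mu,u)$; (2) there exists $\alpha>0$ such that for all $X,Y,U,V\in\mathcal{H}$: $\langle\tilde W_0(X)-\tilde W_0(Y),X-Y\rangle\ge0$; $\langle\tilde G(X,U)-\tilde G(Y,V),X-Y\rangle+\langle\tilde F(X,U)-\tilde F(Y,V),U-V\rangle\ge\alpha\|U-V\|^2$; (3) there exist $\gamma\in(0,1]$, a constant $C_2$ and a modulus of continuity $\omega$ such that for all $X,Y,U,V\in\mathcal{H}$: $\langle\tilde G(X,U)-\tilde G(Y,V),U-V\rangle\le C_2(\|X-Y\|_\gamma^2+\|U-V\|_\gamma^2)$; $\langle\tilde F(X,U)-\tilde F(Y,V),X-Y\rangle\ge-C_2(\|X-Y\|^2+\|U-V\|_\gamma^2)$; $\|\tilde W_0(X)-\tilde W_0(Y)\|\le C_2\|X-Y\|_\gamma$; and for all $x,u\in\mathbb{R}^d$, $\mu,\nu\in\mathcal{P}_2(\mathbb{R}^d)$: $|F(x,\mu,u)-F(x,\nu,u)|+|G(x,\mu,u)-G(x,\nu,u)|+|W_0(x,\mu)-W_0(x,\nu)|\le\omega(\mathcal{W}_2(\mu,\nu))$.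 Then there exists a constant $C$ such that, whenever $(X,W^x,Z^x)$ and $(Y,W^y,Z^y)$ are strong solutions on $[0,T]$ of $$X_t=X_0-\int_0^t\tilde F(X_s,W_s)ds+\sigma_xB_t,\qquad W_t=\tilde W_0(X_T)+\int_t^T\tilde G(X_s,W_s)ds-\int_t^TZ_sdB_s$$ with initial data $X_0\in\mathcal{H}$ and $Y_0\in\mathcal{H}$ respectively, for all $t\le T$, $$\|W^x_t-W^y_t\|\le C\|X_0-Y_0\|_{\frac{\gamma^2}{2-\gamma^2}},\qquad\|X_t-Y_t\|\le C\|X_0-Y_0\|_{\frac{\gamma}{2-\gamma^2}}.$$
   Context: Fix $d\ge1$, $T>0$, $\sigma_x\ge0$ and a sufficiently rich probability space. $\mathcal{H}=L^2(\Omega,\mathbb{R}^d)$ with $\langle X,Y\rangle=\mathbb{E}[X\cdot Y]$, norm $\|\cdot\|$; for an exponent $\eta\in(0,1]$, $\|X-Y\|_\eta=\max(\|X-Y\|,\|X-Y\|^\eta)$; $\mathcal{L}(X)$ is the law of $X$; $\mathcal{P}_2(\mathbb{R}^d)$ carries $\mathcal{W}_2$; $E_2(\mu)=\int|y|^2\mu(dy)$. A modulus of continuity is a continuous increasing $\omega:\mathbb{R}^+\to\mathbb{R}^+$ with $\omega(0)=0$. Lifts: $\tilde W_0(X)=W_0(X,\mathcal{L}(X))$, $\tilde F(X,U)=F(X,\mathcal{L}(X),U)$, $\tilde G(X,U)=G(X,\mathcal{L}(X),U)$. $B$ is a $d$-dimensional Brownian motion (the same for both solutions) with respect to a filtration for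 which $X_0,Y_0$ are measurable at time $0$. A strong solution is a triple of adapted, square integrable processes (with $X_t,W_t\in\mathcal{H}$ and $Z$ square integrable with respect to $dt\otimes\mathbb{P}$) satisfying the system. The constant $C$ depends only on the data ($F,G,W_0,T$), not on the solutions. *)

theory Defs
  imports "HOL-Probability.Probability"
begin

section \<open>The space of square integrable random variables\<close>

text \<open>
  Random variables are represented by functions, not by classes modulo almost sure equality;
  accordingly \<open>L2_norm\<close> is only a seminorm.
\<close>

definition L2_space :: "'a measure \<Rightarrow> ('a \<Rightarrow> 'v::euclidean_space) set" where
  "L2_space M = {X \<in> borel_measurable M. integrable M (\<lambda>\<omega>. (norm (X \<omega>))\<^sup>2)}"

definition L2_inner :: "'a measure \<Rightarrow> ('a \<Rightarrow> 'v::euclidean_space) \<Rightarrow> ('a \<Rightarrow> 'v) \<Rightarrow> real" where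
  "L2_inner M X Y = (\<integral>\<omega>. X \<omega> \<bullet> Y \<omega> \<partial>M)"

definition L2_norm :: "'a measure \<Rightarrow> ('a \<Rightarrow> 'v::euclidean_space) \<Rightarrow> real" where
  "L2_norm M X = sqrt (L2_inner M X X)"

definition L2_dist :: "'a measure \<Rightarrow> ('a \<Rightarrow> 'v::euclidean_space) \<Rightarrow> ('a \<Rightarrow> 'v) \<Rightarrow> real" where
  "L2_dist M X Y = L2_norm M (\<lambda>\<omega>. X \<omega> - Y \<omega>)"

definition L2_dist_exp ::
    "'a measure \<Rightarrow> real \<Rightarrow> ('a \<Rightarrow> 'v::euclidean_space) \<Rightarrow> ('a \<Rightarrow> 'v) \<Rightarrow> real" where
  "L2_dist_exp M \<eta> X Y = max (L2_dist M X Y) (L2_dist M X Y powr \<eta>)"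

text \<open>
  A probability space is sufficiently rich if it carries a uniform random variable on the unit
  interval (equivalently, if it is atomless). Such a space carries random variables with any
  prescribed law on a Euclidean space, and also a Brownian motion with an independent
  initial condition.
\<close>

definition rich_prob_space :: "'a measure \<Rightarrow> bool" where
  "rich_prob_space M \<longleftrightarrow> prob_space M \<and>
     (\<exists>U \<in> borel_measurable M. distr M borel U = uniform_measure lborel {0..1::real})"

section \<open>Measures with finite second moment and the Wasserstein distance\<close>

definition second_moment :: "('v::euclidean_space) measure \<Rightarrow> real" where
  "second_moment \<mu> = (\<integral>y. (norm y)\<^sup>2 \<partial>\<mu>)"

definition P2 :: "('v::euclidean_space) measure set" where
  "P2 = {\<mu>. prob_space \<mu> \<and> sets \<mu> = sets borel \<and> integrable \<mu> (\<lambda>y. (norm y)\<^sup>2)}"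

definition couplings ::
    "('v::euclidean_space) measure \<Rightarrow> 'v measure \<Rightarrow> ('v \<times> 'v) measure set" where
  "couplings \<mu> \<nu> = {\<pi>. sets \<pi> = sets (borel \<Otimes>\<^sub>M borel) \<and>
     distr \<pi> borel fst = \<mu> \<and> distr \<pi> borel snd = \<nu>}"

definition wasserstein2 :: "('v::euclidean_space) measure \<Rightarrow> 'v measure \<Rightarrow> real" where
  "wasserstein2 \<mu> \<nu> =
     sqrt (enn2real (INF \<pi> \<in> couplings \<mu> \<nu>. \<integral>\<^sup>+ (x, y). ennreal ((dist x y)\<^sup>2) \<partial>\<pi>))"

definition modulus_of_continuity :: "(real \<Rightarrow> real) \<Rightarrow> bool" where
  "modulus_of_continuity w \<longleftrightarrow>
     continuous_on {0..} w \<and> mono_on {0..} w \<and> w 0 = 0 \<and> w ` {0..} \<subseteq> {0..}"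

text \<open>
  Functions of a measure are defined on the whole type of measures, but only their values on
  \<open>P2\<close> matter: continuity is joint continuity on the product of the Euclidean
  factors with \<open>P2\<close>, the latter metrised by \<open>wasserstein2\<close>.
\<close>

definition continuous_state_law :: "('v::euclidean_space \<Rightarrow> 'v measure \<Rightarrow> 'w::metric_space) \<Rightarrow> bool" where
  "continuous_state_law f \<longleftrightarrow>
     (\<forall>x. \<forall>\<mu>\<in>P2. \<forall>\<epsilon>>0. \<exists>\<delta>>0. \<forall>x'. \<forall>\<mu>'\<in>P2.
        dist x' x < \<delta> \<and> wasserstein2 \<mu>' \<mu> < \<delta> \<longrightarrow> dist (f x' \<mu>') (f x \<mu>) < \<epsilon>)"

definition continuous_state_law_control ::
    "('v::euclidean_space \<Rightarrow> 'v measure \<Rightarrow> 'v \<Rightarrow> 'w::metric_space) \<Rightarrow> bool" where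
  "continuous_state_law_control f \<longleftrightarrow>
     (\<forall>x. \<forall>\<mu>\<in>P2. \<forall>u. \<forall>\<epsilon>>0. \<exists>\<delta>>0. \<forall>x'. \<forall>\<mu>'\<in>P2. \<forall>u'.
        dist x' x < \<delta> \<and> wasserstein2 \<mu>' \<mu> < \<delta> \<and> dist u' u < \<delta>
          \<longrightarrow> dist (f x' \<mu>' u') (f x \<mu> u) < \<epsilon>)"

section \<open>Lifts to random variables\<close>

definition law :: "'a measure \<Rightarrow> ('a \<Rightarrow> 'v::euclidean_space) \<Rightarrow> 'v measure" where
  "law M X = distr M borel X"

definition lift_state ::
    "'a measure \<Rightarrow> ('v::euclidean_space \<Rightarrow> 'v measure \<Rightarrow> 'v) \<Rightarrow> ('a \<Rightarrow> 'v) \<Rightarrow> 'a \<Rightarrow> 'v" where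
  "lift_state M f X = (\<lambda>\<omega>. f (X \<omega>) (law M X))"

definition lift_state_control ::
    "'a measure \<Rightarrow> ('v::euclidean_space \<Rightarrow> 'v measure \<Rightarrow> 'v \<Rightarrow> 'v)
      \<Rightarrow> ('a \<Rightarrow> 'v) \<Rightarrow> ('a \<Rightarrow> 'v) \<Rightarrow> 'a \<Rightarrow> 'v" where
  "lift_state_control M f X U = (\<lambda>\<omega>. f (X \<omega>) (law M X) (U \<omega>))"

section \<open>Brownian motion and stochastic integration on \<open>[0, T]\<close>\<close>

definition filtration_upto :: "'a measure \<Rightarrow> real \<Rightarrow> (real \<Rightarrow> 'a measure) \<Rightarrow> bool" where
  "filtration_upto M T \<F> \<longleftrightarrow>
     (\<forall>t\<in>{0..T}. subalgebra M (\<F> t)) \<and>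
     (\<forall>s\<in>{0..T}. \<forall>t\<in>{0..T}. s \<le> t \<longrightarrow> sets (\<F> s) \<subseteq> sets (\<F> t))"

definition adapted_upto ::
    "real \<Rightarrow> (real \<Rightarrow> 'a measure) \<Rightarrow> (real \<Rightarrow> 'a \<Rightarrow> 'v::euclidean_space) \<Rightarrow> bool" where
  "adapted_upto T \<F> X \<longleftrightarrow> (\<forall>t\<in>{0..T}. X t \<in> borel_measurable (\<F> t))"

definition brownian_motion ::
    "'a measure \<Rightarrow> real \<Rightarrow> (real \<Rightarrow> 'a measure) \<Rightarrow> (real \<Rightarrow> 'a \<Rightarrow> real^'d) \<Rightarrow> bool" where
  "brownian_motion M T \<F> B \<longleftrightarrow>
     adapted_upto T \<F> B \<and>
     (AE \<omega> in M. B 0 \<omega> = 0) \<and>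
     (AE \<omega> in M. continuous_on {0..T} (\<lambda>t. B t \<omega>)) \<and>
     (\<forall>s\<in>{0..T}. \<forall>t\<in>{0..T}. s < t \<longrightarrow>
        distributed M lborel (\<lambda>\<omega>. B t \<omega> - B s \<omega>)
          (\<lambda>x. ennreal (\<Prod>i\<in>UNIV. normal_density 0 (sqrt (t - s)) (x $ i))) \<and>
        prob_space.indep_set M (sets (\<F> s))
          (sets (vimage_algebra (space M) (\<lambda>\<omega>. B t \<omega> - B s \<omega>) borel)))"

text \<open>
  A simple integrand on \<open>[a, b]\<close> is given by a partition \<open>p 0 \<le> \<dots> \<le> p n\<close> and bounded matrix
  valued random variables \<open>\<phi> i\<close>, the value on \<open>{p i <.. p (Suc i)}\<close> being known at
  time \<open>p i\<close>.
\<close>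

definition simple_integrand ::
    "'a measure \<Rightarrow> (real \<Rightarrow> 'a measure) \<Rightarrow> real \<Rightarrow> real \<Rightarrow> nat \<Rightarrow> (nat \<Rightarrow> real)
      \<Rightarrow> (nat \<Rightarrow> 'a \<Rightarrow> real^'d^'d) \<Rightarrow> bool" where
  "simple_integrand M \<F> a b n p \<phi> \<longleftrightarrow>
     p 0 = a \<and> p n = b \<and>
     (\<forall>i<n. p i \<le> p (Suc i) \<and> \<phi> i \<in> borel_measurable (\<F> (p i)) \<and>
            (\<exists>K. \<forall>\<omega>\<in>space M. norm (\<phi> i \<omega>) \<le> K))"

definition simple_process ::
    "nat \<Rightarrow> (nat \<Rightarrow> real) \<Rightarrow> (nat \<Rightarrow> 'a \<Rightarrow> real^'d^'d) \<Rightarrow> real \<Rightarrow> 'a \<Rightarrow> real^'d^'d" where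
  "simple_process n p \<phi> t \<omega> = (\<Sum>i<n. indicat_real {p i<..p (Suc i)} t *\<^sub>R \<phi> i \<omega>)"

definition simple_ito_integral ::
    "(real \<Rightarrow> 'a \<Rightarrow> real^'d) \<Rightarrow> nat \<Rightarrow> (nat \<Rightarrow> real) \<Rightarrow> (nat \<Rightarrow> 'a \<Rightarrow> real^'d^'d)
      \<Rightarrow> 'a \<Rightarrow> real^'d" where
  "simple_ito_integral B n p \<phi> \<omega> = (\<Sum>i<n. \<phi> i \<omega> *v (B (p (Suc i)) \<omega> - B (p i) \<omega>))"

text \<open>
  \<open>I\<close> is a version of the Ito integral of \<open>Z\<close> over \<open>[a, b]\<close>: the usual extension of the
  integral of simple integrands by \<open>L\<^sup>2\<close>-continuity (Ito isometry). The norm on matrices is the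
  Frobenius norm.
\<close>

definition has_ito_integral ::
    "'a measure \<Rightarrow> (real \<Rightarrow> 'a measure) \<Rightarrow> (real \<Rightarrow> 'a \<Rightarrow> real^'d) \<Rightarrow> real \<Rightarrow> real
      \<Rightarrow> (real \<Rightarrow> 'a \<Rightarrow> real^'d^'d) \<Rightarrow> ('a \<Rightarrow> real^'d) \<Rightarrow> bool" where
  "has_ito_integral M \<F> B a b Z I \<longleftrightarrow>
     I \<in> L2_space M \<and>
     (\<exists>n p \<phi>. (\<forall>k. simple_integrand M \<F> a b (n k) (p k) (\<phi> k)) \<and>
        (\<lambda>k. \<integral>\<^sup>+ (t, \<omega>). ennreal ((norm (simple_process (n k) (p k) (\<phi> k) t \<omega> - Z t \<omega>))\<^sup>2)
               \<partial>(restrict_space lborel {a..b} \<Otimes>\<^sub>M M)) \<longlonglongrightarrow> 0 \<and>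
        (\<lambda>k. \<integral>\<^sup>+ \<omega>. ennreal ((norm (simple_ito_integral B (n k) (p k) (\<phi> k) \<omega> - I \<omega>))\<^sup>2) \<partial>M)
          \<longlonglongrightarrow> 0)"

section \<open>Strong solutions\<close>

definition square_integrable_process ::
    "'a measure \<Rightarrow> real \<Rightarrow> (real \<Rightarrow> 'a \<Rightarrow> 'v::euclidean_space) \<Rightarrow> bool" where
  "square_integrable_process M T X \<longleftrightarrow>
     (\<lambda>(t, \<omega>). X t \<omega>) \<in> L2_space (restrict_space lborel {0..T} \<Otimes>\<^sub>M M)"

text \<open>
  For each time the two equations hold almost surely. Integrability of the drifts along almost
  every path is stated explicitly because the Lebesgue integral of a non-integrable function is 0
  by convention.
\<close>

definition strong_solution ::
    "'a measure \<Rightarrow> real \<Rightarrow> (real^'d \<Rightarrow> (real^'d) measure \<Rightarrow> real^'d)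
      \<Rightarrow> (real^'d \<Rightarrow> (real^'d) measure \<Rightarrow> real^'d \<Rightarrow> real^'d)
      \<Rightarrow> (real^'d \<Rightarrow> (real^'d) measure \<Rightarrow> real^'d \<Rightarrow> real^'d)
      \<Rightarrow> real \<Rightarrow> (real \<Rightarrow> 'a measure) \<Rightarrow> (real \<Rightarrow> 'a \<Rightarrow> real^'d) \<Rightarrow> ('a \<Rightarrow> real^'d)
      \<Rightarrow> (real \<Rightarrow> 'a \<Rightarrow> real^'d) \<Rightarrow> (real \<Rightarrow> 'a \<Rightarrow> real^'d) \<Rightarrow> (real \<Rightarrow> 'a \<Rightarrow> real^'d^'d) \<Rightarrow> bool" where
  "strong_solution M T W0 F G \<sigma> \<F> B X0 X W Z \<longleftrightarrow>
     adapted_upto T \<F> X \<and> adapted_upto T \<F> W \<and> adapted_upto T \<F> Z \<and>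
     (\<forall>t\<in>{0..T}. X t \<in> L2_space M \<and> W t \<in> L2_space M) \<and>
     square_integrable_process M T X \<and> square_integrable_process M T W \<and>
     square_integrable_process M T Z \<and>
     (AE \<omega> in M. set_integrable lborel {0..T} (\<lambda>s. lift_state_control M F (X s) (W s) \<omega>)) \<and>
     (AE \<omega> in M. set_integrable lborel {0..T} (\<lambda>s. lift_state_control M G (X s) (W s) \<omega>)) \<and>
     (\<forall>t\<in>{0..T}. AE \<omega> in M.
        X t \<omega> = X0 \<omega> - (LINT s:{0..t}|lborel. lift_state_control M F (X s) (W s) \<omega>)
                 + \<sigma> *\<^sub>R B t \<omega>) \<and>
     (\<forall>t\<in>{0..T}. \<exists>I. has_ito_integral M \<F> B t T Z I \<and>
        (AE \<omega> in M.
           W t \<omega> = lift_state M W0 (X T) \<omega>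
                    + (LINT s:{t..T}|lborel. lift_state_control M G (X s) (W s) \<omega>) - I \<omega>))"

end

theory Submission
  imports Defs
begin

text \<open>
  Write \<open>dX\<close>, \<open>dW\<close>, \<open>dF\<close>, \<open>dG\<close> for the differences of the states, the values and the drifts of two
  solutions, \<open>n\<close> for the difference of the terminal values, and let \<open>a = \<parallel>X0 - Y0\<parallel>\<close> and
  \<open>b = \<parallel>dW 0\<parallel>\<close>. The noise is the same for both solutions, so \<open>dX\<close> has absolutely continuous
  paths with velocity \<open>- dF\<close>. The estimates rest on three facts.

  \<^item> Duality. The derivative of \<open>\<langle>dW, dX\<rangle>\<close> is \<open>- \<langle>dG, dX\<rangle> - \<langle>dF, dW\<rangle>\<close>, so monotonicity of the
    coefficients and of the terminal condition gives \<open>\<alpha> \<integral> \<parallel>dW\<parallel>\<^sup>2 \<le> \<langle>dW 0, X0 - Y0\<rangle> \<le> a b\<close>.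
  \<^item> Forward energy. The derivative of \<open>\<parallel>dX\<parallel>\<^sup>2\<close> is \<open>- 2 \<langle>dF, dX\<rangle>\<close>, so the one-sided bound on the drift
    and Gronwall's lemma bound \<open>\<parallel>dX\<parallel>\<^sup>2\<close> by \<open>a\<^sup>2 + a b + (a b) powr \<gamma>\<close> up to a constant.
  \<^item> Backward energy. \<open>\<parallel>dW t\<parallel>\<^sup>2 \<le> \<parallel>n\<parallel>\<^sup>2 + 2 \<integral> \<langle>dG, dW\<rangle>\<close>, the integral running from \<open>t\<close> to \<open>T\<close>. By the Hoelder
    bounds this costs one more power \<open>\<gamma>\<close> of the previous estimates.

  At time \<open>0\<close> the last estimate bounds \<open>b\<^sup>2\<close> by terms that are at most linear in \<open>b\<close>, the critical one
  being \<open>(a b) powr \<gamma>\<^sup>2\<close>. Solving for \<open>b\<close> gives \<open>b \<le> C a powr (\<gamma>\<^sup>2 / (2 - \<gamma>\<^sup>2))\<close> for small \<open>a\<close>, and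
  inserting this in the other estimates gives both rates (\<open>self_improving_rate\<close>, \<open>rate_bound\<close>).

  The usual route to the first and third facts is the Ito formula. It can be avoided. The only property
  of the stochastic integral over \<open>[t, T]\<close> that is used is its orthogonality to all
  square integrable random variables known at time \<open>t\<close> (\<open>ito_integral_orthogonal\<close>). Consequently \<open>dW t\<close>
  and the anticipating process \<open>N t = n + \<integral> dG\<close>, integrated from \<open>t\<close> to \<open>T\<close>, have the same inner
  product with every such random variable, in particular with \<open>dF t\<close>, \<open>dG t\<close>
  and \<open>dW t\<close> itself. The process \<open>N\<close> has absolutely continuous paths, so all product rules for it are
  pathwise integration by parts (\<open>duality_identity\<close>, \<open>backward_energy_identity\<close>), and passing back from \<open>N\<close> to
  \<open>dW\<close> loses only a nonnegative term in the backward energy.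

  Fubini's theorem requires the drifts to be jointly measurable in time and chance although they
  depend on the law of the current state. Since \<open>t \<mapsto> X t\<close> is continuous in \<open>L\<^sup>2\<close>
  (\<open>solution_time_continuity\<close>), the law varies continuously and can be discretised
  (\<open>lift_process_measurable\<close>).
\<close>

section \<open>Square integrable random variables\<close>

lemma L2_spaceD:
  assumes "X \<in> L2_space M"
  shows "X \<in> borel_measurable M" "integrable M (\<lambda>\<omega>. (norm (X \<omega>))\<^sup>2)"
  using assms by (auto simp: L2_space_def)

lemma L2_spaceI_bound:
  fixes X :: "'a \<Rightarrow> 'v::euclidean_space" and Y :: "'a \<Rightarrow> 'w::euclidean_space"
  assumes "Y \<in> L2_space M" and [measurable]: "X \<in> borel_measurable M"
    and "AE \<omega> in M. norm (X \<omega>) \<le> norm (Y \<omega>)"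
  shows "X \<in> L2_space M"
proof -
  have "integrable M (\<lambda>\<omega>. (norm (X \<omega>))\<^sup>2)"
  proof (rule Bochner_Integration.integrable_bound[OF L2_spaceD(2)[OF assms(1)]])
    show "AE \<omega> in M. norm ((norm (X \<omega>))\<^sup>2) \<le> norm ((norm (Y \<omega>))\<^sup>2)"
      using assms(3) by eventually_elim (auto intro: power_mono)
  qed simp
  then show ?thesis by (simp add: L2_space_def)
qed

lemma L2_space_add:
  assumes "X \<in> L2_space M" "Y \<in> L2_space M"
  shows "(\<lambda>\<omega>. X \<omega> + Y \<omega>) \<in> L2_space M"
proof -
  note [measurable] = L2_spaceD(1)[OF assms(1)] L2_spaceD(1)[OF assms(2)]
  have "integrable M (\<lambda>\<omega>. (norm (X \<omega> + Y \<omega>))\<^sup>2)"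
  proof (rule Bochner_Integration.integrable_bound)
    show "integrable M (\<lambda>\<omega>. 2 * (norm (X \<omega>))\<^sup>2 + 2 * (norm (Y \<omega>))\<^sup>2)"
      by (intro Bochner_Integration.integrable_add integrable_mult_right L2_spaceD(2) assms)
    have "(norm (x + y))\<^sup>2 \<le> 2 * (norm x)\<^sup>2 + 2 * (norm y)\<^sup>2" for x y :: 'b
    proof -
      have "(norm (x + y))\<^sup>2 \<le> (norm x + norm y)\<^sup>2"
        by (intro power_mono norm_triangle_ineq) auto
      also have "\<dots> \<le> 2 * (norm x)\<^sup>2 + 2 * (norm y)\<^sup>2"
        using sum_squares_bound[of "norm x" "norm y"] by (simp add: power2_sum)
      finally show ?thesis .
    qed
    then show "AE \<omega> in M. norm ((norm (X \<omega> + Y \<omega>))\<^sup>2)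
        \<le> norm (2 * (norm (X \<omega>))\<^sup>2 + 2 * (norm (Y \<omega>))\<^sup>2)"
      by (intro AE_I2) auto
  qed measurable
  then show ?thesis by (simp add: L2_space_def)
qed

lemma L2_space_scaleR:
  assumes "X \<in> L2_space M"
  shows "(\<lambda>\<omega>. c *\<^sub>R X \<omega>) \<in> L2_space M"
  using assms by (auto simp: L2_space_def power_mult_distrib)

lemma L2_space_uminus: "X \<in> L2_space M \<Longrightarrow> (\<lambda>\<omega>. - X \<omega>) \<in> L2_space M"
  using L2_space_scaleR[of X M "-1"] by simp

lemma L2_space_diff:
  "X \<in> L2_space M \<Longrightarrow> Y \<in> L2_space M \<Longrightarrow> (\<lambda>\<omega>. X \<omega> - Y \<omega>) \<in> L2_space M"
  using L2_space_add[OF _ L2_space_uminus, of X M Y] by simp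

lemma L2_space_norm: "X \<in> L2_space M \<Longrightarrow> (\<lambda>\<omega>. norm (X \<omega>)) \<in> L2_space M"
  by (auto simp: L2_space_def)

lemma L2_space_const: "finite_measure M \<Longrightarrow> (\<lambda>\<omega>. c) \<in> L2_space M"
  by (auto simp: L2_space_def finite_measure.integrable_const)

lemma L2_space_integrable_inner:
  assumes "X \<in> L2_space M" "Y \<in> L2_space M"
  shows "integrable M (\<lambda>\<omega>. X \<omega> \<bullet> Y \<omega>)"
proof (rule Bochner_Integration.integrable_bound)
  note [measurable] = L2_spaceD(1)[OF assms(1)] L2_spaceD(1)[OF assms(2)]
  show "integrable M (\<lambda>\<omega>. (norm (X \<omega>))\<^sup>2 + (norm (Y \<omega>))\<^sup>2)"
    by (intro Bochner_Integration.integrable_add L2_spaceD(2) assms)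
  have "\<bar>x \<bullet> y\<bar> \<le> (norm x)\<^sup>2 + (norm y)\<^sup>2" for x y :: 'b
    using sum_squares_bound[of "norm x" "norm y"] Cauchy_Schwarz_ineq2[of x y]
      zero_le_power2[of "norm x"] zero_le_power2[of "norm y"] by linarith
  then show "AE \<omega> in M. norm (X \<omega> \<bullet> Y \<omega>) \<le> norm ((norm (X \<omega>))\<^sup>2 + (norm (Y \<omega>))\<^sup>2)"
    by (intro AE_I2) auto
  show "(\<lambda>\<omega>. X \<omega> \<bullet> Y \<omega>) \<in> borel_measurable M" by measurable
qed

lemma L2_inner_commute: "L2_inner M X Y = L2_inner M Y X"
  by (simp add: L2_inner_def inner_commute)

lemma L2_inner_diff_left:
  "X \<in> L2_space M \<Longrightarrow> Y \<in> L2_space M \<Longrightarrow> Z \<in> L2_space M \<Longrightarrow>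
    L2_inner M (\<lambda>\<omega>. X \<omega> - Y \<omega>) Z = L2_inner M X Z - L2_inner M Y Z"
  by (simp add: L2_inner_def inner_diff_left L2_space_integrable_inner)

lemma L2_inner_scaleR_left: "L2_inner M (\<lambda>\<omega>. c *\<^sub>R X \<omega>) Y = c * L2_inner M X Y"
  by (simp add: L2_inner_def)

lemma L2_inner_scaleR_right: "L2_inner M X (\<lambda>\<omega>. c *\<^sub>R Y \<omega>) = c * L2_inner M X Y"
  by (simp add: L2_inner_def)

lemma L2_inner_self: "L2_inner M X X = (\<integral>\<omega>. (norm (X \<omega>))\<^sup>2 \<partial>M)"
  by (simp add: L2_inner_def power2_norm_eq_inner)

lemma L2_inner_self_nonneg: "0 \<le> L2_inner M X X"
  by (simp add: L2_inner_self)

lemma L2_norm_nonneg: "0 \<le> L2_norm M X"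
  by (simp add: L2_norm_def L2_inner_self_nonneg)

lemma L2_norm_squared: "(L2_norm M X)\<^sup>2 = L2_inner M X X"
  by (simp add: L2_norm_def L2_inner_self_nonneg)

lemma L2_dist_nonneg: "0 \<le> L2_dist M X Y"
  by (simp add: L2_dist_def L2_norm_nonneg)

lemma L2_inner_cong_AE:
  assumes "X \<in> borel_measurable M" "X' \<in> borel_measurable M" "Y \<in> borel_measurable M"
    "Y' \<in> borel_measurable M" "AE \<omega> in M. X \<omega> = X' \<omega>" "AE \<omega> in M. Y \<omega> = Y' \<omega>"
  shows "L2_inner M X Y = L2_inner M X' Y'"
  unfolding L2_inner_def using assms by (intro integral_cong_AE) auto

text \<open>
  The quadratic polynomial \<open>s \<mapsto> \<parallel>X + s Y\<parallel>\<^sup>2\<close> is nonnegative. Random variables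
  are not identified modulo almost sure equality, so \<open>\<parallel>Y\<parallel> = 0\<close> does not make \<open>Y\<close> vanish and
  needs the separate remark that a nonnegative affine function of \<open>s\<close> is constant.
\<close>

lemma L2_Cauchy_Schwarz:
  assumes "X \<in> L2_space M" "Y \<in> L2_space M"
  shows "\<bar>L2_inner M X Y\<bar> \<le> L2_norm M X * L2_norm M Y"
proof -
  have quad: "0 \<le> L2_inner M X X + 2 * s * L2_inner M X Y + s\<^sup>2 * L2_inner M Y Y" for s :: real
  proof -
    let ?Z = "\<lambda>\<omega>. X \<omega> + s *\<^sub>R Y \<omega>"
    have "L2_inner M ?Z ?Z = (\<integral>\<omega>. X \<omega> \<bullet> X \<omega> + 2 * s * (X \<omega> \<bullet> Y \<omega>) + s\<^sup>2 * (Y \<omega> \<bullet> Y \<omega>) \<partial>M)"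
      unfolding L2_inner_def
      by (simp add: inner_add_left inner_add_right inner_commute power2_eq_square algebra_simps)
    also have "\<dots> = L2_inner M X X + 2 * s * L2_inner M X Y + s\<^sup>2 * L2_inner M Y Y"
      unfolding L2_inner_def using assms by (simp add: L2_space_integrable_inner)
    finally have "L2_inner M ?Z ?Z = L2_inner M X X + 2 * s * L2_inner M X Y + s\<^sup>2 * L2_inner M Y Y" .
    then show ?thesis using L2_inner_self_nonneg[of M ?Z] by simp
  qed
  have "(L2_inner M X Y)\<^sup>2 \<le> L2_inner M X X * L2_inner M Y Y"
  proof (cases "L2_inner M Y Y = 0")
    case True
    have "L2_inner M X Y = 0"
    proof (rule ccontr)
      assume ne: "L2_inner M X Y \<noteq> 0"
      show False
        using quad[of "- (L2_inner M X X + 1) / (2 * L2_inner M X Y)"] True ne by (simp add: field_simps)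
    qed
    then show ?thesis using True by simp
  next
    case False
    then have pos: "L2_inner M Y Y > 0" using L2_inner_self_nonneg[of M Y] by simp
    show ?thesis
      \<comment> \<open>the minimiser of the polynomial\<close>
      using quad[of "- L2_inner M X Y / L2_inner M Y Y"] pos
      by (simp add: field_simps power2_eq_square)
  qed
  then have "sqrt ((L2_inner M X Y)\<^sup>2) \<le> sqrt (L2_inner M X X * L2_inner M Y Y)"
    by (rule real_sqrt_le_mono)
  then show ?thesis by (simp add: L2_norm_def real_sqrt_mult)
qed

lemma L2_norm_triangle:
  assumes "X \<in> L2_space M" "Y \<in> L2_space M"
  shows "L2_norm M (\<lambda>\<omega>. X \<omega> + Y \<omega>) \<le> L2_norm M X + L2_norm M Y"
proof (rule power2_le_imp_le)
  have "L2_inner M (\<lambda>\<omega>. X \<omega> + Y \<omega>) (\<lambda>\<omega>. X \<omega> + Y \<omega>)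
      = (\<integral>\<omega>. X \<omega> \<bullet> X \<omega> + 2 * (X \<omega> \<bullet> Y \<omega>) + Y \<omega> \<bullet> Y \<omega> \<partial>M)"
    unfolding L2_inner_def
    by (simp add: inner_add_left inner_add_right inner_commute algebra_simps)
  also have "\<dots> = L2_inner M X X + 2 * L2_inner M X Y + L2_inner M Y Y"
    unfolding L2_inner_def using assms by (simp add: L2_space_integrable_inner)
  finally have "L2_inner M (\<lambda>\<omega>. X \<omega> + Y \<omega>) (\<lambda>\<omega>. X \<omega> + Y \<omega>)
      = L2_inner M X X + 2 * L2_inner M X Y + L2_inner M Y Y" .
  moreover have "L2_inner M X Y \<le> L2_norm M X * L2_norm M Y"
    using L2_Cauchy_Schwarz[OF assms] by linarith
  ultimately show "(L2_norm M (\<lambda>\<omega>. X \<omega> + Y \<omega>))\<^sup>2 \<le> (L2_norm M X + L2_norm M Y)\<^sup>2"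
    by (simp add: power2_sum L2_norm_squared)
qed (simp add: L2_norm_nonneg)

section \<open>Integration by parts on a time interval\<close>

text \<open>
  Time integrals are taken over the finite measure space \<open>[0, T]\<close>, so that joint integrals in
  time and chance are integrals over a product measure and Fubini's theorem applies as it stands.
\<close>

abbreviation time :: "real \<Rightarrow> real measure" where
  "time T \<equiv> restrict_space lborel {0..T}"

lemma finite_measure_time: "finite_measure (time T)"
  by (rule finite_measureI) (auto simp: emeasure_restrict_space space_restrict_space emeasure_lborel_Icc_eq)

lemma measure_time: "T \<ge> 0 \<Longrightarrow> measure (time T) (space (time T)) = T"
  by (simp add: measure_restrict_space space_restrict_space)

lemma time_measurable_ident [measurable]: "(\<lambda>s. s) \<in> borel_measurable (time T)"
  by (rule measurable_restrict_space1) simp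

lemma AE_time_neq: "AE s in time T. s \<noteq> (t::real)"
proof -
  have "AE s in lborel. s \<noteq> t" by (rule AE_lborel_singleton)
  then show ?thesis by (subst AE_restrict_space_iff) (auto elim: eventually_mono)
qed

definition integral_upto :: "real \<Rightarrow> (real \<Rightarrow> 'v::euclidean_space) \<Rightarrow> real \<Rightarrow> 'v" where
  "integral_upto T f s = (\<integral>r. indicat_real {..s} r *\<^sub>R f r \<partial>time T)"

definition integral_from :: "real \<Rightarrow> (real \<Rightarrow> 'v::euclidean_space) \<Rightarrow> real \<Rightarrow> 'v" where
  "integral_from T f s = (\<integral>r. indicat_real {s..} r *\<^sub>R f r \<partial>time T)"

lemma integral_upto_eq_set_integral:
  "t \<in> {0..T} \<Longrightarrow> (LINT s:{0..t}|lborel. f s) = integral_upto T f t"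
  unfolding set_lebesgue_integral_def integral_upto_def
  by (subst integral_restrict_space) (auto intro!: Bochner_Integration.integral_cong simp: indicator_def)

lemma integral_from_eq_set_integral:
  "t \<in> {0..T} \<Longrightarrow> (LINT s:{t..T}|lborel. f s) = integral_from T f t"
  unfolding set_lebesgue_integral_def integral_from_def
  by (subst integral_restrict_space) (auto intro!: Bochner_Integration.integral_cong simp: indicator_def)

lemma set_integrable_time:
  fixes f :: "real \<Rightarrow> 'v::euclidean_space"
  shows "set_integrable lborel {0..T} f \<longleftrightarrow> integrable (time T) f"
  by (simp add: set_integrable_def integrable_restrict_space)

lemma integrable_time_indicator:
  fixes f :: "real \<Rightarrow> 'v::euclidean_space"
  assumes "integrable (time T) f" "A \<in> sets borel"
  shows "integrable (time T) (\<lambda>r. indicat_real A r *\<^sub>R f r)"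
proof (rule Bochner_Integration.integrable_bound[OF assms(1)])
  have [measurable]: "A \<in> sets borel" by fact
  have [measurable]: "f \<in> borel_measurable (time T)" using assms(1) by simp
  have [measurable]: "indicat_real A \<in> borel_measurable (time T)"
    by (rule measurable_restrict_space1) simp
  show "(\<lambda>r. indicat_real A r *\<^sub>R f r) \<in> borel_measurable (time T)" by measurable
qed (auto simp: indicator_def)

lemma norm_integral_from_le:
  assumes "integrable (time T) f"
  shows "norm (integral_from T f s) \<le> (\<integral>r. norm (f r) \<partial>time T)"
  unfolding integral_from_def
  by (rule order_trans[OF integral_norm_bound integral_mono])
     (use assms integrable_time_indicator[OF integrable_norm[OF assms], of "{s..}"] in \<open>auto simp: indicator_def\<close>)

lemma integral_upto_T:
  "integral_upto T f T = (\<integral>r. f r \<partial>time T)"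
  unfolding integral_upto_def
  by (rule Bochner_Integration.integral_cong) (auto simp: space_restrict_space)

lemma integral_from_0:
  "integral_from T f 0 = (\<integral>r. f r \<partial>time T)"
  unfolding integral_from_def
  by (rule Bochner_Integration.integral_cong) (auto simp: space_restrict_space)

lemma integral_upto_add_from:
  fixes f :: "real \<Rightarrow> 'v::euclidean_space"
  assumes "integrable (time T) f"
  shows "integral_upto T f s + integral_from T f s = (\<integral>r. f r \<partial>time T)"
proof -
  have [measurable]: "f \<in> borel_measurable (time T)" using assms by simp
  have "integral_upto T f s + integral_from T f s
      = (\<integral>r. indicat_real {..s} r *\<^sub>R f r + indicat_real {s..} r *\<^sub>R f r \<partial>time T)"
    unfolding integral_upto_def integral_from_def
    using assms by (subst Bochner_Integration.integral_add) (auto intro!: integrable_time_indicator)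
  also have "\<dots> = (\<integral>r. f r \<partial>time T)"
  proof (rule integral_cong_AE)
    show "AE r in time T. indicat_real {..s} r *\<^sub>R f r + indicat_real {s..} r *\<^sub>R f r = f r"
      using AE_time_neq[where t = s] by eventually_elim (auto simp: indicator_def)
    show "(\<lambda>r. indicat_real {..s} r *\<^sub>R f r + indicat_real {s..} r *\<^sub>R f r) \<in> borel_measurable (time T)"
      using integrable_time_indicator[OF assms] by (intro borel_measurable_add) auto
  qed fact
  finally show ?thesis .
qed

text \<open>
  Both sides are the integral of \<open>f s \<bullet> g r\<close> over the triangle \<open>s \<le> r\<close>, written in the two orders
  of integration. Together with \<open>integral_upto_add_from\<close> this is integration by parts
  for absolutely continuous paths; all product rules below reduce to it.
\<close>

lemma integral_inner_from_eq_upto: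
  fixes f g :: "real \<Rightarrow> 'v::euclidean_space"
  assumes f: "integrable (time T) f" and g: "integrable (time T) g"
  shows "(\<integral>s. f s \<bullet> integral_from T g s \<partial>time T) = (\<integral>r. g r \<bullet> integral_upto T f r \<partial>time T)"
proof -
  interpret L: finite_measure "time T" by (rule finite_measure_time)
  interpret LL: pair_sigma_finite "time T" "time T" ..
  have [measurable]: "f \<in> borel_measurable (time T)" "g \<in> borel_measurable (time T)"
    using f g by auto
  let ?h = "\<lambda>s r. if s \<le> r then f s \<bullet> g r else 0"
  have "integrable (time T \<Otimes>\<^sub>M time T) (\<lambda>(s, r). norm (f s) * norm (g r))"
    using f g
    by (intro LL.Fubini_integrable)
       (auto simp: integrable_mult_left_iff)
  then have int: "integrable (time T \<Otimes>\<^sub>M time T) (\<lambda>(s, r). ?h s r)"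
    by (rule Bochner_Integration.integrable_bound)
       (auto intro!: AE_I2 simp: Cauchy_Schwarz_ineq2)
  have from_eq: "f s \<bullet> integral_from T g s = (\<integral>r. ?h s r \<partial>time T)" for s
  proof -
    have "f s \<bullet> integral_from T g s = (\<integral>r. f s \<bullet> (indicat_real {s..} r *\<^sub>R g r) \<partial>time T)"
      unfolding integral_from_def using g
      by (intro integral_inner_right[symmetric] integrable_time_indicator) auto
    also have "\<dots> = (\<integral>r. ?h s r \<partial>time T)"
      by (rule Bochner_Integration.integral_cong) (auto simp: indicator_def)
    finally show ?thesis .
  qed
  have upto_eq: "g r \<bullet> integral_upto T f r = (\<integral>s. ?h s r \<partial>time T)" for r
  proof -
    have "g r \<bullet> integral_upto T f r = (\<integral>s. g r \<bullet> (indicat_real {..r} s *\<^sub>R f s) \<partial>time T)"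
      unfolding integral_upto_def using f
      by (intro integral_inner_right[symmetric] integrable_time_indicator) auto
    also have "\<dots> = (\<integral>s. ?h s r \<partial>time T)"
      by (rule Bochner_Integration.integral_cong) (auto simp: indicator_def inner_commute)
    finally show ?thesis .
  qed
  show ?thesis
    unfolding from_eq upto_eq using LL.Fubini_integral[OF int] by simp
qed

lemma integrable_inner_integral_from:
  fixes f g :: "real \<Rightarrow> 'v::euclidean_space"
  assumes f: "integrable (time T) f" and g: "integrable (time T) g"
  shows "integrable (time T) (\<lambda>s. f s \<bullet> integral_from T g s)"
proof (rule Bochner_Integration.integrable_bound)
  interpret L: finite_measure "time T" by (rule finite_measure_time)
  have [measurable]: "f \<in> borel_measurable (time T)" "g \<in> borel_measurable (time T)"
    using f g by auto
  have "(\<lambda>s. \<integral>r. (if s \<le> r then 1 else 0) *\<^sub>R g r \<partial>time T) \<in> borel_measurable (time T)"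
    by measurable
  then have [measurable]: "integral_from T g \<in> borel_measurable (time T)"
    unfolding integral_from_def indicator_def atLeast_iff of_bool_def by simp
  show "(\<lambda>s. f s \<bullet> integral_from T g s) \<in> borel_measurable (time T)" by measurable
  show "integrable (time T) (\<lambda>s. norm (f s) * (\<integral>r. norm (g r) \<partial>time T))"
    using f by auto
  show "AE s in time T. norm (f s \<bullet> integral_from T g s)
      \<le> norm (norm (f s) * (\<integral>r. norm (g r) \<partial>time T))"
    by (intro AE_I2)
       (auto simp: abs_mult intro!: order_trans[OF Cauchy_Schwarz_ineq2] mult_left_mono
          order_trans[OF norm_integral_from_le[OF g]])
qed

text \<open>
  The square \<open>[0, T]\<^sup>2\<close> is the union of the two triangles above and below the diagonal, and the
  symmetric integrand \<open>f s \<bullet> f r\<close> has the same integral over both.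
\<close>

lemma norm_integral_squared_from:
  fixes f :: "real \<Rightarrow> 'v::euclidean_space"
  assumes f: "integrable (time T) f"
  shows "(norm (\<integral>s. f s \<partial>time T))\<^sup>2 = 2 * (\<integral>s. f s \<bullet> integral_from T f s \<partial>time T)"
proof -
  have upto: "integral_upto T f s = (\<integral>s. f s \<partial>time T) - integral_from T f s" for s
    using integral_upto_add_from[OF f, of s] by (simp add: algebra_simps)
  have "(\<integral>s. f s \<bullet> integral_from T f s \<partial>time T)
      = (\<integral>s. f s \<bullet> (\<integral>s. f s \<partial>time T) - f s \<bullet> integral_from T f s \<partial>time T)"
    using integral_inner_from_eq_upto[OF f f] unfolding upto by (simp add: inner_diff_right)
  also have "\<dots> = (norm (\<integral>s. f s \<partial>time T))\<^sup>2 - (\<integral>s. f s \<bullet> integral_from T f s \<partial>time T)"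
    using f integrable_inner_integral_from[OF f f] by (simp add: power2_norm_eq_inner)
  finally show ?thesis by simp
qed

lemma norm_integral_squared_upto:
  fixes f :: "real \<Rightarrow> 'v::euclidean_space"
  assumes f: "integrable (time T) f"
  shows "(norm (\<integral>s. f s \<partial>time T))\<^sup>2 = 2 * (\<integral>s. f s \<bullet> integral_upto T f s \<partial>time T)"
  using norm_integral_squared_from[OF f] integral_inner_from_eq_upto[OF f f] by simp

section \<open>Square integrable processes\<close>

lemma square_integrable_processD:
  assumes "square_integrable_process M T X"
  shows "case_prod X \<in> L2_space (time T \<Otimes>\<^sub>M M)"
    and "case_prod X \<in> borel_measurable (time T \<Otimes>\<^sub>M M)"
    and "integrable (time T \<Otimes>\<^sub>M M) (\<lambda>(t, \<omega>). (norm (X t \<omega>))\<^sup>2)"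
  using assms by (auto simp: square_integrable_process_def L2_space_def split_beta')

lemma square_integrable_process_section_measurable:
  assumes "square_integrable_process M T X"
  shows "t \<in> {0..T} \<Longrightarrow> X t \<in> borel_measurable M"
    and "\<omega> \<in> space M \<Longrightarrow> (\<lambda>t. X t \<omega>) \<in> borel_measurable (time T)"
  using measurable_Pair2[OF square_integrable_processD(2)[OF assms], of t]
    measurable_Pair1[OF square_integrable_processD(2)[OF assms], of \<omega>]
  by (auto simp: space_restrict_space)

lemma square_integrable_process_add:
  "square_integrable_process M T X \<Longrightarrow> square_integrable_process M T Y \<Longrightarrow>
    square_integrable_process M T (\<lambda>t \<omega>. X t \<omega> + Y t \<omega>)"
  using L2_space_add[of "case_prod X" "time T \<Otimes>\<^sub>M M" "case_prod Y"]
  by (simp add: square_integrable_process_def split_beta')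

lemma square_integrable_process_diff:
  "square_integrable_process M T X \<Longrightarrow> square_integrable_process M T Y \<Longrightarrow>
    square_integrable_process M T (\<lambda>t \<omega>. X t \<omega> - Y t \<omega>)"
  using L2_space_diff[of "case_prod X" "time T \<Otimes>\<^sub>M M" "case_prod Y"]
  by (simp add: square_integrable_process_def split_beta')

lemma square_integrable_process_bound:
  assumes "square_integrable_process M T Y" "case_prod X \<in> borel_measurable (time T \<Otimes>\<^sub>M M)"
    and "\<And>t \<omega>. t \<in> {0..T} \<Longrightarrow> \<omega> \<in> space M \<Longrightarrow> norm (X t \<omega>) \<le> norm (Y t \<omega>)"
  shows "square_integrable_process M T X"
  unfolding square_integrable_process_def
  by (rule L2_spaceI_bound[OF square_integrable_processD(1)[OF assms(1)] assms(2)])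
     (auto intro!: AE_I2 assms(3) simp: space_pair_measure space_restrict_space)

lemma square_integrable_process_indicator:
  assumes "square_integrable_process M T X" and A: "A \<in> sets borel"
  shows "square_integrable_process M T (\<lambda>t \<omega>. indicat_real A t *\<^sub>R X t \<omega>)"
proof (rule square_integrable_process_bound[OF assms(1)])
  have [measurable]: "indicat_real A \<in> borel_measurable (time T)"
    using A by (intro measurable_restrict_space1) simp
  note [measurable] = square_integrable_processD(2)[OF assms(1)]
  show "(\<lambda>(t, \<omega>). indicat_real A t *\<^sub>R X t \<omega>) \<in> borel_measurable (time T \<Otimes>\<^sub>M M)"
    by measurable
qed (auto simp: indicator_def)

context prob_space
begin

lemma pair_sigma_finite_time: "pair_sigma_finite (time T) M"
proof -
  interpret L: finite_measure "time T" by (rule finite_measure_time)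
  show ?thesis ..
qed

lemma finite_measure_time_pair: "finite_measure (time T \<Otimes>\<^sub>M M)"
  by (intro finite_measure_pair_measure finite_measure_time) unfold_locales

lemma square_integrable_process_const:
  assumes "X \<in> L2_space M"
  shows "square_integrable_process M T (\<lambda>t. X)"
proof -
  interpret P: pair_sigma_finite "time T" M by (rule pair_sigma_finite_time)
  interpret L: finite_measure "time T" by (rule finite_measure_time)
  note [measurable] = L2_spaceD(1)[OF assms]
  have "integrable (time T \<Otimes>\<^sub>M M) (\<lambda>(t, \<omega>). (norm (X \<omega>))\<^sup>2)"
    using L2_spaceD(2)[OF assms] by (intro P.Fubini_integrable) auto
  then show ?thesis by (simp add: square_integrable_process_def L2_space_def split_beta')
qed

lemma square_integrable_process_integrable:
  assumes "square_integrable_process M T X"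
  shows "integrable (time T \<Otimes>\<^sub>M M) (case_prod X)"
proof -
  interpret finite_measure "time T \<Otimes>\<^sub>M M" by (rule finite_measure_time_pair)
  have "integrable (time T \<Otimes>\<^sub>M M) (\<lambda>x. norm (case_prod X x) \<bullet> (1::real))"
    by (intro L2_space_integrable_inner L2_space_norm L2_space_const square_integrable_processD(1) assms)
       unfold_locales
  then show ?thesis
    using square_integrable_processD(2)[OF assms] by (simp add: integrable_norm_iff)
qed

lemma square_integrable_process_AE_integrable:
  assumes "square_integrable_process M T X"
  shows "AE \<omega> in M. integrable (time T) (\<lambda>t. X t \<omega>)"
proof -
  interpret P: pair_sigma_finite "time T" M by (rule pair_sigma_finite_time)
  show ?thesis using P.AE_integrable_snd square_integrable_process_integrable[OF assms] by blast
qed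

lemma square_integrable_process_AE_square_integrable:
  assumes "square_integrable_process M T X"
  shows "AE \<omega> in M. (\<lambda>t. X t \<omega>) \<in> L2_space (time T)"
proof -
  interpret P: pair_sigma_finite "time T" M by (rule pair_sigma_finite_time)
  have "AE \<omega> in M. integrable (time T) (\<lambda>t. (norm (X t \<omega>))\<^sup>2)"
    using P.AE_integrable_snd[OF square_integrable_processD(3)[OF assms]] .
  then show ?thesis
    using AE_space
    by eventually_elim (use square_integrable_process_section_measurable[OF assms] in \<open>auto simp: L2_space_def\<close>)
qed

text \<open>
  The Cauchy--Schwarz inequality in time against the constant \<open>1\<close>. For a null set of outcomes the
  path need not be square integrable, and there the bound may fail, which is why it is only
  asserted almost surely.
\<close>

lemma L2_space_time_integral_norm:
  assumes X: "square_integrable_process M T X"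
  shows "(\<lambda>\<omega>. \<integral>t. norm (X t \<omega>) \<partial>time T) \<in> L2_space M"
proof -
  interpret P: pair_sigma_finite "time T" M by (rule pair_sigma_finite_time)
  interpret L: finite_measure "time T" by (rule finite_measure_time)
  note [measurable] = square_integrable_processD(2)[OF X]
  have [measurable]: "(\<lambda>\<omega>. \<integral>t. norm (X t \<omega>) \<partial>time T) \<in> borel_measurable M"
  proof -
    have "(\<lambda>(\<omega>, t). norm (X t \<omega>)) \<in> borel_measurable (M \<Otimes>\<^sub>M time T)"
      using measurable_pair_swap[OF square_integrable_processD(2)[OF X]] by (simp add: split_beta')
    then show ?thesis by (rule P.M1.borel_measurable_lebesgue_integral)
  qed
  have "integrable M (\<lambda>\<omega>. (norm (\<integral>t. norm (X t \<omega>) \<partial>time T))\<^sup>2)"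
  proof (rule Bochner_Integration.integrable_bound)
    show "integrable M (\<lambda>\<omega>. L2_inner (time T) (\<lambda>t. 1::real) (\<lambda>t. 1) * (\<integral>t. (norm (X t \<omega>))\<^sup>2 \<partial>time T))"
      using P.integrable_snd[OF square_integrable_processD(3)[OF X]] by simp
    show "AE \<omega> in M. norm ((norm (\<integral>t. norm (X t \<omega>) \<partial>time T))\<^sup>2)
        \<le> norm (L2_inner (time T) (\<lambda>t. 1::real) (\<lambda>t. 1) * (\<integral>t. (norm (X t \<omega>))\<^sup>2 \<partial>time T))"
      using square_integrable_process_AE_square_integrable[OF X]
    proof eventually_elim
      case (elim \<omega>)
      let ?f = "\<lambda>t. norm (X t \<omega>)"
      have "\<bar>L2_inner (time T) (\<lambda>t. 1) ?f\<bar> \<le> L2_norm (time T) (\<lambda>t. 1::real) * L2_norm (time T) ?f"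
        by (intro L2_Cauchy_Schwarz L2_space_const L2_space_norm elim) unfold_locales
      then have "\<bar>L2_inner (time T) (\<lambda>t. 1) ?f\<bar>\<^sup>2 \<le> (L2_norm (time T) (\<lambda>t. 1::real) * L2_norm (time T) ?f)\<^sup>2"
        by (rule power_mono) simp
      then show ?case
        by (simp add: power_mult_distrib L2_norm_squared L2_inner_self[of "time T" ?f])
           (simp add: L2_inner_def)
    qed
  qed simp
  then show ?thesis by (simp add: L2_space_def)
qed

text \<open>
  The relation \<open>R s r\<close> selects the times \<open>r\<close> seen from \<open>s\<close>; with \<open>r \<le> s\<close> and \<open>s \<le> r\<close> it gives the
  running integral and the remaining integral. Both are dominated by the integral of the norm over
  all of \<open>[0, T]\<close>, uniformly in \<open>s\<close>.
\<close>

lemma time_integral_kernel_square_integrable: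
  fixes X :: "real \<Rightarrow> 'a \<Rightarrow> 'v::euclidean_space"
  assumes X: "square_integrable_process M T X"
    and R: "Measurable.pred (borel \<Otimes>\<^sub>M borel) (\<lambda>x. R (fst x) (snd x :: real))"
  shows "square_integrable_process M T (\<lambda>s \<omega>. \<integral>r. indicat_real {r. R s r} r *\<^sub>R X r \<omega> \<partial>time T)"
    and "s \<in> {0..T} \<Longrightarrow> (\<lambda>\<omega>. \<integral>r. indicat_real {r. R s r} r *\<^sub>R X r \<omega> \<partial>time T) \<in> L2_space M"
proof -
  interpret P: pair_sigma_finite "time T" M by (rule pair_sigma_finite_time)
  interpret L: finite_measure "time T" by (rule finite_measure_time)
  let ?I = "\<lambda>s \<omega>. \<integral>r. indicat_real {r. R s r} r *\<^sub>R X r \<omega> \<partial>time T"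
  let ?J = "\<lambda>\<omega>. \<integral>t. norm (X t \<omega>) \<partial>time T"
  note [measurable] = square_integrable_processD(2)[OF X]
  have J: "?J \<in> L2_space M" by (rule L2_space_time_integral_norm[OF X])
  note [measurable] = L2_spaceD(1)[OF J]
  have bound: "AE \<omega> in M. \<forall>s\<in>{0..T}. norm (?I s \<omega>) \<le> norm (?J \<omega>)"
    using square_integrable_process_AE_integrable[OF X]
  proof eventually_elim
    case (elim \<omega>)
    show ?case
    proof
      fix s
      have "norm (?I s \<omega>) \<le> ?J \<omega>"
      proof (cases "integrable (time T) (\<lambda>r. indicat_real {r. R s r} r *\<^sub>R X r \<omega>)")
        case True
        then show ?thesis
          using elim
          by (intro order_trans[OF integral_norm_bound] integral_mono integrable_norm)
             (auto simp: indicator_def)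
      next
        case False
        then show ?thesis by (simp add: not_integrable_integral_eq)
      qed
      then show "norm (?I s \<omega>) \<le> norm (?J \<omega>)" by simp
    qed
  qed
  have m: "(\<lambda>(s, \<omega>). ?I s \<omega>) \<in> borel_measurable (time T \<Otimes>\<^sub>M M)"
  proof -
    have R': "(\<lambda>(x, r). R (fst x) r) \<in> measurable ((time T \<Otimes>\<^sub>M M) \<Otimes>\<^sub>M time T) (count_space UNIV)"
    proof -
      have "(\<lambda>x. (fst (fst x), snd x)) \<in> measurable ((time T \<Otimes>\<^sub>M M) \<Otimes>\<^sub>M time T) (borel \<Otimes>\<^sub>M borel)"
        by measurable
      from measurable_compose[OF this R] show ?thesis by (simp add: split_beta')
    qed
    have X': "(\<lambda>(x, r). X r (snd x)) \<in> borel_measurable ((time T \<Otimes>\<^sub>M M) \<Otimes>\<^sub>M time T)"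
    proof -
      have "(\<lambda>x. (snd x, snd (fst x))) \<in> measurable ((time T \<Otimes>\<^sub>M M) \<Otimes>\<^sub>M time T) (time T \<Otimes>\<^sub>M M)"
        by measurable
      from measurable_compose[OF this square_integrable_processD(2)[OF X]]
      show ?thesis by (simp add: split_beta')
    qed
    have "(\<lambda>(x, r). (if R (fst x) r then X r (snd x) else 0)) \<in> borel_measurable ((time T \<Otimes>\<^sub>M M) \<Otimes>\<^sub>M time T)"
      using X' R' by (simp add: split_beta' measurable_If pred_def)
    from P.M1.borel_measurable_lebesgue_integral[OF this]
    have "(\<lambda>x. \<integral>r. (if R (fst x) r then X r (snd x) else 0) \<partial>time T) \<in> borel_measurable (time T \<Otimes>\<^sub>M M)" .
    moreover have "(if R s r then X r \<omega> else 0) = indicat_real {r. R s r} r *\<^sub>R X r \<omega>" for s r \<omega>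
      by (simp add: indicator_def)
    ultimately show ?thesis by (simp add: split_beta')
  qed
  show "square_integrable_process M T ?I"
    unfolding square_integrable_process_def
  proof (rule L2_spaceI_bound)
    show "(\<lambda>(t, \<omega>). ?J \<omega>) \<in> L2_space (time T \<Otimes>\<^sub>M M)"
      using square_integrable_process_const[OF J] by (simp add: square_integrable_process_def)
    note [measurable] = m
    show "AE x in time T \<Otimes>\<^sub>M M. norm (case x of (s, \<omega>) \<Rightarrow> ?I s \<omega>) \<le> norm (case x of (t, \<omega>) \<Rightarrow> ?J \<omega>)"
    proof (rule P.AE_pair_measure)
      show "AE s in time T. AE \<omega> in M. norm (case (s, \<omega>) of (s, \<omega>) \<Rightarrow> ?I s \<omega>)
          \<le> norm (case (s, \<omega>) of (t, \<omega>) \<Rightarrow> ?J \<omega>)"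
      proof (rule AE_I2)
        fix s assume "s \<in> space (time T)"
        then have "s \<in> {0..T}" by (simp add: space_restrict_space)
        with bound show "AE \<omega> in M. norm (case (s, \<omega>) of (s, \<omega>) \<Rightarrow> ?I s \<omega>)
            \<le> norm (case (s, \<omega>) of (t, \<omega>) \<Rightarrow> ?J \<omega>)"
          by (auto elim!: eventually_mono)
      qed
    qed measurable
  qed (rule m)
  show "(\<lambda>\<omega>. ?I s \<omega>) \<in> L2_space M" if s: "s \<in> {0..T}"
  proof (rule L2_spaceI_bound[OF J])
    show "?I s \<in> borel_measurable M"
      using measurable_Pair2[OF m, of s] s by (simp add: space_restrict_space)
    show "AE \<omega> in M. norm (?I s \<omega>) \<le> norm (?J \<omega>)"
      using bound s by (auto elim!: eventually_mono)
  qed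
qed

lemma integral_upto_square_integrable:
  fixes X :: "real \<Rightarrow> 'a \<Rightarrow> 'v::euclidean_space"
  assumes X: "square_integrable_process M T X"
  shows "square_integrable_process M T (\<lambda>s \<omega>. integral_upto T (\<lambda>r. X r \<omega>) s)"
    and "s \<in> {0..T} \<Longrightarrow> (\<lambda>\<omega>. integral_upto T (\<lambda>r. X r \<omega>) s) \<in> L2_space M"
  using time_integral_kernel_square_integrable[OF X, of "\<lambda>s r. r \<le> s"]
  by (simp_all add: integral_upto_def atMost_def)

lemma integral_from_square_integrable:
  fixes X :: "real \<Rightarrow> 'a \<Rightarrow> 'v::euclidean_space"
  assumes X: "square_integrable_process M T X"
  shows "square_integrable_process M T (\<lambda>s \<omega>. integral_from T (\<lambda>r. X r \<omega>) s)"
    and "s \<in> {0..T} \<Longrightarrow> (\<lambda>\<omega>. integral_from T (\<lambda>r. X r \<omega>) s) \<in> L2_space M"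
  using time_integral_kernel_square_integrable[OF X, of "\<lambda>s r. s \<le> r"]
  by (simp_all add: integral_from_def atLeast_def)

text \<open>
  Fubini's theorem turns time integrals of expectations into expectations of path integrals, to
  which the pathwise product rules apply.
\<close>

lemma integrable_L2_inner_process:
  assumes "square_integrable_process M T X" "square_integrable_process M T Y"
  shows "integrable (time T) (\<lambda>s. L2_inner M (X s) (Y s))"
    and "(\<integral>s. L2_inner M (X s) (Y s) \<partial>time T) = (\<integral>\<omega>. \<integral>s. X s \<omega> \<bullet> Y s \<omega> \<partial>time T \<partial>M)"
    and "integrable M (\<lambda>\<omega>. \<integral>s. X s \<omega> \<bullet> Y s \<omega> \<partial>time T)"
proof -
  interpret P: pair_sigma_finite "time T" M by (rule pair_sigma_finite_time)
  have i: "integrable (time T \<Otimes>\<^sub>M M) (\<lambda>(s, \<omega>). X s \<omega> \<bullet> Y s \<omega>)"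
    using L2_space_integrable_inner[OF square_integrable_processD(1)[OF assms(1)]
        square_integrable_processD(1)[OF assms(2)]] by (simp add: split_beta')
  show "integrable (time T) (\<lambda>s. L2_inner M (X s) (Y s))"
    unfolding L2_inner_def using P.integrable_fst[OF i] .
  show "(\<integral>s. L2_inner M (X s) (Y s) \<partial>time T) = (\<integral>\<omega>. \<integral>s. X s \<omega> \<bullet> Y s \<omega> \<partial>time T \<partial>M)"
    unfolding L2_inner_def using P.Fubini_integral[OF i] by simp
  show "integrable M (\<lambda>\<omega>. \<integral>s. X s \<omega> \<bullet> Y s \<omega> \<partial>time T)"
    using P.integrable_snd[OF i] .
qed

end

section \<open>Energy identities without stochastic calculus\<close>

context prob_space
begin

text \<open>
  This is the product rule for \<open>t \<mapsto> \<langle>N t, X t\<rangle>\<close>, where \<open>X\<close> starts from \<open>x\<close> with velocity \<open>- F\<close> and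
  \<open>N\<close> ends in \<open>n\<close> with velocity \<open>- G\<close>. The process \<open>N\<close> anticipates the future; it
  stands for the solution of a backward equation before conditioning on the present.
\<close>

lemma duality_identity:
  fixes F G :: "real \<Rightarrow> 'a \<Rightarrow> 'v::euclidean_space"
  assumes F: "square_integrable_process M T F" and G: "square_integrable_process M T G"
    and x: "x \<in> L2_space M" and n: "n \<in> L2_space M" and "T \<ge> 0"
  defines "X \<equiv> \<lambda>s \<omega>. x \<omega> - integral_upto T (\<lambda>r. F r \<omega>) s"
    and "N \<equiv> \<lambda>s \<omega>. n \<omega> + integral_from T (\<lambda>r. G r \<omega>) s"
  shows "L2_inner M (N 0) x
    = L2_inner M n (X T) + (\<integral>s. L2_inner M (G s) (X s) + L2_inner M (F s) (N s) \<partial>time T)"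
proof -
  have X: "square_integrable_process M T X" "X T \<in> L2_space M"
    unfolding X_def using \<open>T \<ge> 0\<close>
    by (intro square_integrable_process_diff square_integrable_process_const L2_space_diff
        integral_upto_square_integrable F x; simp)+
  have N: "square_integrable_process M T N" "N 0 \<in> L2_space M"
    unfolding N_def using \<open>T \<ge> 0\<close>
    by (intro square_integrable_process_add square_integrable_process_const L2_space_add
        integral_from_square_integrable G n; simp)+
  have path: "N 0 \<omega> \<bullet> x \<omega> - n \<omega> \<bullet> X T \<omega> = (\<integral>s. G s \<omega> \<bullet> X s \<omega> \<partial>time T) + (\<integral>s. F s \<omega> \<bullet> N s \<omega> \<partial>time T)"
    if f: "integrable (time T) (\<lambda>s. F s \<omega>)" and g: "integrable (time T) (\<lambda>s. G s \<omega>)" for \<omega>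
  proof -
    have upto: "integral_upto T (\<lambda>r. F r \<omega>) s = (\<integral>r. F r \<omega> \<partial>time T) - integral_from T (\<lambda>r. F r \<omega>) s" for s
      using integral_upto_add_from[OF f, of s] by (simp add: algebra_simps)
    have "integrable (time T) (\<lambda>s. G s \<omega> \<bullet> integral_upto T (\<lambda>r. F r \<omega>) s)"
      unfolding upto inner_diff_right
      using g integrable_inner_integral_from[OF g f]
      by (intro Bochner_Integration.integrable_diff) auto
    then have "(\<integral>s. G s \<omega> \<bullet> X s \<omega> \<partial>time T)
        = (\<integral>s. G s \<omega> \<partial>time T) \<bullet> x \<omega> - (\<integral>s. G s \<omega> \<bullet> integral_upto T (\<lambda>r. F r \<omega>) s \<partial>time T)"
      unfolding X_def inner_diff_right using g by simp
    moreover have "(\<integral>s. F s \<omega> \<bullet> N s \<omega> \<partial>time T)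
        = (\<integral>s. F s \<omega> \<partial>time T) \<bullet> n \<omega> + (\<integral>s. F s \<omega> \<bullet> integral_from T (\<lambda>r. G r \<omega>) s \<partial>time T)"
      unfolding N_def inner_add_right using f integrable_inner_integral_from[OF f g] by simp
    ultimately show ?thesis
      using integral_inner_from_eq_upto[OF f g]
      by (simp add: X_def N_def integral_upto_T integral_from_0 inner_diff_right inner_add_left inner_add_right inner_commute)
  qed
  have "L2_inner M (N 0) x - L2_inner M n (X T) = (\<integral>\<omega>. N 0 \<omega> \<bullet> x \<omega> - n \<omega> \<bullet> X T \<omega> \<partial>M)"
    unfolding L2_inner_def using x n X N by (simp add: L2_space_integrable_inner)
  also have "\<dots> = (\<integral>\<omega>. (\<integral>s. G s \<omega> \<bullet> X s \<omega> \<partial>time T) + (\<integral>s. F s \<omega> \<bullet> N s \<omega> \<partial>time T) \<partial>M)"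
  proof (rule integral_cong_AE)
    show "AE \<omega> in M. N 0 \<omega> \<bullet> x \<omega> - n \<omega> \<bullet> X T \<omega>
        = (\<integral>s. G s \<omega> \<bullet> X s \<omega> \<partial>time T) + (\<integral>s. F s \<omega> \<bullet> N s \<omega> \<partial>time T)"
      using square_integrable_process_AE_integrable[OF F] square_integrable_process_AE_integrable[OF G]
      by eventually_elim (rule path)
    show "(\<lambda>\<omega>. N 0 \<omega> \<bullet> x \<omega> - n \<omega> \<bullet> X T \<omega>) \<in> borel_measurable M"
      using x n X N by (intro borel_measurable_diff borel_measurable_integrable L2_space_integrable_inner)
    show "(\<lambda>\<omega>. (\<integral>s. G s \<omega> \<bullet> X s \<omega> \<partial>time T) + (\<integral>s. F s \<omega> \<bullet> N s \<omega> \<partial>time T)) \<in> borel_measurable M"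
      by (intro borel_measurable_add borel_measurable_integrable integrable_L2_inner_process F G X N)
  qed
  also have "\<dots> = (\<integral>s. L2_inner M (G s) (X s) + L2_inner M (F s) (N s) \<partial>time T)"
    using F G X N by (simp add: integrable_L2_inner_process)
  finally show ?thesis by simp
qed

text \<open>
  The pathwise identity \<open>\<bar>n + \<integral> g\<bar>\<^sup>2 = \<bar>n\<bar>\<^sup>2 + 2 \<integral> g \<bullet> N\<close> for \<open>g\<close> cut off before time \<open>t\<close>: the cross
  term with \<open>n\<close> is explicit, and the square of the integral is \<open>norm_integral_squared_from\<close>.
\<close>

lemma backward_energy_identity:
  fixes G :: "real \<Rightarrow> 'a \<Rightarrow> 'v::euclidean_space"
  assumes G: "square_integrable_process M T G" and n: "n \<in> L2_space M" and t: "t \<in> {0..T}"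
  defines "N \<equiv> \<lambda>s \<omega>. n \<omega> + integral_from T (\<lambda>r. G r \<omega>) s"
  shows "L2_inner M (N t) (N t)
    = L2_inner M n n + 2 * (\<integral>s. indicat_real {t..} s * L2_inner M (G s) (N s) \<partial>time T)"
proof -
  have N: "square_integrable_process M T N" "N t \<in> L2_space M"
    unfolding N_def using t
    by (intro square_integrable_process_add square_integrable_process_const L2_space_add
        integral_from_square_integrable G n; simp)+
  let ?g = "\<lambda>s \<omega>. indicat_real {t..} s *\<^sub>R G s \<omega>"
  have g: "square_integrable_process M T ?g"
    using G by (rule square_integrable_process_indicator) simp
  have path: "(norm (N t \<omega>))\<^sup>2 = (norm (n \<omega>))\<^sup>2 + 2 * (\<integral>s. ?g s \<omega> \<bullet> N s \<omega> \<partial>time T)"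
    if "integrable (time T) (\<lambda>s. ?g s \<omega>)" for \<omega>
  proof -
    have "?g s \<omega> \<bullet> integral_from T (\<lambda>r. G r \<omega>) s = ?g s \<omega> \<bullet> integral_from T (\<lambda>r. ?g r \<omega>) s" for s
    proof (cases "t \<le> s")
      case True
      then have "integral_from T (\<lambda>r. G r \<omega>) s = integral_from T (\<lambda>r. ?g r \<omega>) s"
        unfolding integral_from_def by (intro Bochner_Integration.integral_cong) (auto simp: indicator_def)
      then show ?thesis by simp
    qed simp
    then have "?g s \<omega> \<bullet> N s \<omega> = ?g s \<omega> \<bullet> n \<omega> + ?g s \<omega> \<bullet> integral_from T (\<lambda>r. ?g r \<omega>) s" for s
      by (simp add: N_def inner_add_right del: inner_scaleR_left)
    then have "(\<integral>s. ?g s \<omega> \<bullet> N s \<omega> \<partial>time T)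
        = (\<integral>s. ?g s \<omega> \<partial>time T) \<bullet> n \<omega> + (\<integral>s. ?g s \<omega> \<bullet> integral_from T (\<lambda>r. ?g r \<omega>) s \<partial>time T)"
      using that integrable_inner_integral_from[OF that that] by (simp del: inner_scaleR_left)
    then have "2 * (\<integral>s. ?g s \<omega> \<bullet> N s \<omega> \<partial>time T)
        = 2 * ((\<integral>s. ?g s \<omega> \<partial>time T) \<bullet> n \<omega>) + (norm (\<integral>s. ?g s \<omega> \<partial>time T))\<^sup>2"
      using norm_integral_squared_from[OF that] by simp
    moreover have "N t \<omega> = n \<omega> + (\<integral>s. ?g s \<omega> \<partial>time T)"
      by (simp add: N_def integral_from_def)
    ultimately show ?thesis
      by (simp add: power2_norm_eq_inner inner_add_left inner_add_right inner_commute)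
  qed
  have "L2_inner M (N t) (N t) = (\<integral>\<omega>. (norm (n \<omega>))\<^sup>2 + 2 * (\<integral>s. ?g s \<omega> \<bullet> N s \<omega> \<partial>time T) \<partial>M)"
    unfolding L2_inner_self
  proof (rule integral_cong_AE)
    show "AE \<omega> in M. (norm (N t \<omega>))\<^sup>2 = (norm (n \<omega>))\<^sup>2 + 2 * (\<integral>s. ?g s \<omega> \<bullet> N s \<omega> \<partial>time T)"
      using square_integrable_process_AE_integrable[OF g] by eventually_elim (rule path)
    show "(\<lambda>\<omega>. (norm (n \<omega>))\<^sup>2 + 2 * (\<integral>s. ?g s \<omega> \<bullet> N s \<omega> \<partial>time T)) \<in> borel_measurable M"
      using L2_spaceD(2)[OF n] integrable_L2_inner_process(3)[OF g N(1)]
      by (intro borel_measurable_integrable) (simp del: inner_scaleR_left)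
  qed (use L2_spaceD(2)[OF N(2)] in simp)
  also have "\<dots> = L2_inner M n n + 2 * (\<integral>s. L2_inner M (?g s) (N s) \<partial>time T)"
    using L2_spaceD(2)[OF n] integrable_L2_inner_process[OF g N(1)]
    by (simp add: L2_inner_self[of M n] del: inner_scaleR_left)
  finally show ?thesis by (simp add: L2_inner_scaleR_left)
qed

text \<open>
  The mirror image of the backward identity, with \<open>F\<close> cut off after time \<open>t\<close>.
\<close>

lemma forward_energy_identity:
  fixes F :: "real \<Rightarrow> 'a \<Rightarrow> 'v::euclidean_space"
  assumes F: "square_integrable_process M T F" and x: "x \<in> L2_space M" and t: "t \<in> {0..T}"
  defines "X \<equiv> \<lambda>s \<omega>. x \<omega> - integral_upto T (\<lambda>r. F r \<omega>) s"
  shows "L2_inner M (X t) (X t)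
    = L2_inner M x x - 2 * (\<integral>s. indicat_real {..t} s * L2_inner M (F s) (X s) \<partial>time T)"
proof -
  have X: "square_integrable_process M T X" "X t \<in> L2_space M"
    unfolding X_def using t
    by (intro square_integrable_process_diff square_integrable_process_const L2_space_diff
        integral_upto_square_integrable F x; simp)+
  let ?f = "\<lambda>s \<omega>. indicat_real {..t} s *\<^sub>R F s \<omega>"
  have f: "square_integrable_process M T ?f"
    using F by (rule square_integrable_process_indicator) simp
  have path: "(norm (X t \<omega>))\<^sup>2 = (norm (x \<omega>))\<^sup>2 - 2 * (\<integral>s. ?f s \<omega> \<bullet> X s \<omega> \<partial>time T)"
    if "integrable (time T) (\<lambda>s. ?f s \<omega>)" for \<omega>
  proof -
    have upto: "integral_upto T (\<lambda>r. ?f r \<omega>) s = (\<integral>r. ?f r \<omega> \<partial>time T) - integral_from T (\<lambda>r. ?f r \<omega>) s" for s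
      using integral_upto_add_from[OF that, of s] by (simp add: algebra_simps)
    have int: "integrable (time T) (\<lambda>s. ?f s \<omega> \<bullet> integral_upto T (\<lambda>r. ?f r \<omega>) s)"
      unfolding upto inner_diff_right
      using that integrable_inner_integral_from[OF that that]
      by (intro Bochner_Integration.integrable_diff integrable_inner_left) auto
    have "?f s \<omega> \<bullet> integral_upto T (\<lambda>r. F r \<omega>) s = ?f s \<omega> \<bullet> integral_upto T (\<lambda>r. ?f r \<omega>) s" for s
    proof (cases "s \<le> t")
      case True
      then have "integral_upto T (\<lambda>r. F r \<omega>) s = integral_upto T (\<lambda>r. ?f r \<omega>) s"
        unfolding integral_upto_def by (intro Bochner_Integration.integral_cong) (auto simp: indicator_def)
      then show ?thesis by simp
    qed simp
    then have "?f s \<omega> \<bullet> X s \<omega> = ?f s \<omega> \<bullet> x \<omega> - ?f s \<omega> \<bullet> integral_upto T (\<lambda>r. ?f r \<omega>) s" for s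
      by (simp add: X_def inner_diff_right del: inner_scaleR_left)
    then have "(\<integral>s. ?f s \<omega> \<bullet> X s \<omega> \<partial>time T)
        = (\<integral>s. ?f s \<omega> \<partial>time T) \<bullet> x \<omega> - (\<integral>s. ?f s \<omega> \<bullet> integral_upto T (\<lambda>r. ?f r \<omega>) s \<partial>time T)"
      using that int by (simp del: inner_scaleR_left)
    then have "2 * (\<integral>s. ?f s \<omega> \<bullet> X s \<omega> \<partial>time T)
        = 2 * ((\<integral>s. ?f s \<omega> \<partial>time T) \<bullet> x \<omega>) - (norm (\<integral>s. ?f s \<omega> \<partial>time T))\<^sup>2"
      using norm_integral_squared_upto[OF that] by simp
    moreover have "X t \<omega> = x \<omega> - (\<integral>s. ?f s \<omega> \<partial>time T)"
      by (simp add: X_def integral_upto_def)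
    ultimately show ?thesis
      by (simp add: power2_norm_eq_inner inner_diff_left inner_diff_right inner_commute)
  qed
  have "L2_inner M (X t) (X t) = (\<integral>\<omega>. (norm (x \<omega>))\<^sup>2 - 2 * (\<integral>s. ?f s \<omega> \<bullet> X s \<omega> \<partial>time T) \<partial>M)"
    unfolding L2_inner_self
  proof (rule integral_cong_AE)
    show "AE \<omega> in M. (norm (X t \<omega>))\<^sup>2 = (norm (x \<omega>))\<^sup>2 - 2 * (\<integral>s. ?f s \<omega> \<bullet> X s \<omega> \<partial>time T)"
      using square_integrable_process_AE_integrable[OF f] by eventually_elim (rule path)
    show "(\<lambda>\<omega>. (norm (x \<omega>))\<^sup>2 - 2 * (\<integral>s. ?f s \<omega> \<bullet> X s \<omega> \<partial>time T)) \<in> borel_measurable M"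
      using L2_spaceD(2)[OF x] integrable_L2_inner_process(3)[OF f X(1)]
      by (intro borel_measurable_integrable) (simp del: inner_scaleR_left)
  qed (use L2_spaceD(2)[OF X(2)] in simp)
  also have "\<dots> = L2_inner M x x - 2 * (\<integral>s. L2_inner M (?f s) (X s) \<partial>time T)"
    using L2_spaceD(2)[OF x] integrable_L2_inner_process[OF f X(1)]
    by (simp add: L2_inner_self[of M x] del: inner_scaleR_left)
  finally show ?thesis by (simp add: L2_inner_scaleR_left)
qed

end

section \<open>Orthogonality of the Ito integral to the past\<close>

lemma borel_measurable_vec_component [measurable (raw)]:
  fixes f :: "'a \<Rightarrow> ('b::euclidean_space)^'d"
  assumes "f \<in> borel_measurable N"
  shows "(\<lambda>\<omega>. f \<omega> $ k) \<in> borel_measurable N"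
  by (rule borel_measurable_continuous_on[OF _ assms]) (intro continuous_intros)

lemma borel_measurable_matrix_vector_mult:
  fixes A :: "'a \<Rightarrow> real^'n^'m" and x :: "'a \<Rightarrow> real^'n"
  assumes [measurable]: "A \<in> borel_measurable N" "x \<in> borel_measurable N"
  shows "(\<lambda>\<omega>. A \<omega> *v x \<omega>) \<in> borel_measurable N"
proof -
  have "(\<lambda>\<omega>. (A \<omega> *v x \<omega>) \<bullet> axis i 1) \<in> borel_measurable N" for i
    unfolding inner_axis by (simp add: matrix_vector_mult_def)
  then show ?thesis
    by (subst borel_measurable_euclidean_space) (auto simp: Basis_vec_def)
qed

lemma prod_Basis_vec: "(\<Prod>b\<in>(Basis :: (real^'d) set). g b) = (\<Prod>i\<in>UNIV. g (axis i 1))"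
proof -
  have eq: "(Basis :: (real^'d) set) = range (\<lambda>i. axis i 1)" by (auto simp: Basis_vec_def)
  have inj: "inj (\<lambda>i::'d. axis i (1::real))" by (auto simp: inj_on_def axis_eq_axis)
  show ?thesis unfolding eq by (subst prod.reindex[OF inj]) (simp add: comp_def)
qed

context prob_space
begin

text \<open>
  Tonelli's theorem: all coordinates but the \<open>k\<close>-th integrate to \<open>1\<close>.
\<close>

lemma nn_integral_gaussian_coordinate:
  fixes D :: "'a \<Rightarrow> real^'d" and h :: "real \<Rightarrow> real"
  assumes D: "distributed M lborel D (\<lambda>x. ennreal (\<Prod>i\<in>UNIV. normal_density 0 \<sigma> (x $ i)))"
    and "\<sigma> > 0" and [measurable]: "h \<in> borel_measurable borel" and h: "\<And>y. 0 \<le> h y"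
  shows "(\<integral>\<^sup>+\<omega>. ennreal (h (D \<omega> $ k)) \<partial>M) = (\<integral>\<^sup>+y. ennreal (normal_density 0 \<sigma> y * h y) \<partial>lborel)"
proof -
  let ?f = "\<lambda>(b::real^'d) y. normal_density 0 \<sigma> y * (if b = axis k 1 then h y else 1)"
  have [simp]: "axis i (1::real) = axis k 1 \<longleftrightarrow> i = k" for i :: 'd by (auto simp: axis_eq_axis)
  have one: "(\<integral>\<^sup>+y. ennreal (normal_density 0 \<sigma> y) \<partial>lborel) = 1"
    using \<open>\<sigma> > 0\<close> by (subst nn_integral_eq_integral) (auto intro!: integrable_normal_density)
  have "(\<integral>\<^sup>+\<omega>. ennreal (h (D \<omega> $ k)) \<partial>M)
      = (\<integral>\<^sup>+x. ennreal (\<Prod>i\<in>UNIV. normal_density 0 \<sigma> (x $ i)) * ennreal (h (x $ k)) \<partial>lborel)"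
    by (rule distributed_nn_integral[OF D, symmetric]) simp
  also have "\<dots> = (\<integral>\<^sup>+x. ennreal (\<Prod>b\<in>Basis. ?f b (x \<bullet> b)) \<partial>lborel)"
    by (intro nn_integral_cong)
       (auto simp: prod_Basis_vec inner_axis prod.distrib h prod_nonneg ennreal_mult)
  also have "\<dots> = (\<integral>\<^sup>+x. (\<Prod>b\<in>Basis. ennreal (?f b (x \<bullet> b))) \<partial>lborel)"
    by (intro nn_integral_cong prod_ennreal[symmetric]) (auto simp: h)
  also have "\<dots> = (\<Prod>b\<in>Basis. \<integral>\<^sup>+y. ennreal (?f b y) \<partial>lborel)"
    by (rule nn_integral_lborel_prod) (auto simp: h)
  also have "\<dots> = (\<Prod>i\<in>UNIV. if i = k then (\<integral>\<^sup>+y. ennreal (normal_density 0 \<sigma> y * h y) \<partial>lborel) else 1)"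
    unfolding prod_Basis_vec by (intro prod.cong) (auto simp: one)
  also have "\<dots> = (\<integral>\<^sup>+y. ennreal (normal_density 0 \<sigma> y * h y) \<partial>lborel)"
    by (simp add: prod.delta)
  finally show ?thesis .
qed

lemma gaussian_moments:
  fixes D :: "'a \<Rightarrow> real^'d"
  assumes D: "distributed M lborel D (\<lambda>x. ennreal (\<Prod>i\<in>UNIV. normal_density 0 \<sigma> (x $ i)))"
    and "\<sigma> > 0"
  shows "D \<in> L2_space M" and "L2_inner M D D = real CARD('d) * \<sigma>\<^sup>2"
    and "\<And>k. integrable M (\<lambda>\<omega>. D \<omega> $ k)" and "\<And>k. (\<integral>\<omega>. D \<omega> $ k \<partial>M) = 0"
proof -
  have [measurable]: "D \<in> borel_measurable M" using distributed_measurable[OF D] by simp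
  have sq: "has_bochner_integral M (\<lambda>\<omega>. (D \<omega> $ k)\<^sup>2) (\<sigma>\<^sup>2)" for k
  proof (rule has_bochner_integral_nn_integral)
    have hb: "has_bochner_integral lborel (\<lambda>y. normal_density 0 \<sigma> y * y\<^sup>2) (\<sigma>\<^sup>2)"
      using normal_moment_even[OF \<open>\<sigma> > 0\<close>, of 0 1] by simp
    have "(\<integral>\<^sup>+\<omega>. ennreal ((D \<omega> $ k)\<^sup>2) \<partial>M) = (\<integral>\<^sup>+y. ennreal (normal_density 0 \<sigma> y * y\<^sup>2) \<partial>lborel)"
      by (rule nn_integral_gaussian_coordinate[OF D \<open>\<sigma> > 0\<close>]) auto
    also have "\<dots> = ennreal (\<sigma>\<^sup>2)"
      using hb by (subst nn_integral_eq_integral) (auto simp: has_bochner_integral_iff)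
    finally show "(\<integral>\<^sup>+\<omega>. ennreal ((D \<omega> $ k)\<^sup>2) \<partial>M) = ennreal (\<sigma>\<^sup>2)" .
  qed auto
  have norm: "(norm (D \<omega>))\<^sup>2 = (\<Sum>k\<in>UNIV. (D \<omega> $ k)\<^sup>2)" for \<omega>
    unfolding power2_norm_eq_inner inner_vec_def by (simp add: power2_eq_square)
  have "has_bochner_integral M (\<lambda>\<omega>. (norm (D \<omega>))\<^sup>2) (\<Sum>k\<in>(UNIV::'d set). \<sigma>\<^sup>2)"
    unfolding norm by (intro has_bochner_integral_sum sq)
  then show "D \<in> L2_space M" "L2_inner M D D = real CARD('d) * \<sigma>\<^sup>2"
    by (auto simp: L2_space_def L2_inner_self has_bochner_integral_iff)
  fix k
  have "(\<lambda>\<omega>. D \<omega> $ k) \<in> L2_space M"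
    using sq[of k] by (simp add: L2_space_def has_bochner_integral_iff)
  then have "integrable M (\<lambda>\<omega>. D \<omega> $ k \<bullet> 1)"
    by (rule L2_space_integrable_inner[OF _ L2_space_const]) unfold_locales
  then show i: "integrable M (\<lambda>\<omega>. D \<omega> $ k)" by simp
  have pos: "(\<integral>\<^sup>+\<omega>. ennreal (max 0 (D \<omega> $ k)) \<partial>M) = (\<integral>\<^sup>+y. ennreal (normal_density 0 \<sigma> y * max 0 y) \<partial>lborel)"
    by (rule nn_integral_gaussian_coordinate[OF D \<open>\<sigma> > 0\<close>, of "\<lambda>y. max 0 y"]) auto
  have neg: "(\<integral>\<^sup>+\<omega>. ennreal (max 0 (- (D \<omega> $ k))) \<partial>M) = (\<integral>\<^sup>+y. ennreal (normal_density 0 \<sigma> y * max 0 (- y)) \<partial>lborel)"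
    by (rule nn_integral_gaussian_coordinate[OF D \<open>\<sigma> > 0\<close>, of "\<lambda>y. max 0 (- y)"]) auto
  have "(\<integral>\<^sup>+y. ennreal (normal_density 0 \<sigma> y * max 0 (- y)) \<partial>lborel)
      = (\<integral>\<^sup>+y. ennreal (normal_density 0 \<sigma> (- y) * max 0 y) \<partial>lborel)"
    by (subst (1) lborel_distr_uminus[symmetric], subst nn_integral_distr) auto
  also have "\<dots> = (\<integral>\<^sup>+y. ennreal (normal_density 0 \<sigma> y * max 0 y) \<partial>lborel)"
    by (simp add: normal_density_def)
  finally have "(\<integral>\<^sup>+\<omega>. ennreal (max 0 (- (D \<omega> $ k))) \<partial>M) = (\<integral>\<^sup>+\<omega>. ennreal (max 0 (D \<omega> $ k)) \<partial>M)"
    using pos neg by simp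
  \<comment> \<open>\<open>ennreal\<close> truncates negative numbers to \<open>0\<close>, so these are the positive and the negative part\<close>
  moreover have "ennreal (max 0 x) = ennreal x" for x by (simp add: max_def ennreal_neg)
  ultimately show "(\<integral>\<omega>. D \<omega> $ k \<partial>M) = 0"
    using real_lebesgue_integral_def[OF i] by simp
qed

text \<open>
  A coordinate of \<open>D\<close> and a function measurable with respect to \<open>N\<close> generate smaller \<open>\<sigma>\<close>-algebras
  than the two that are assumed to be independent.
\<close>

lemma indep_set_imp_indep_var:
  fixes D :: "'a \<Rightarrow> real^'d" and \<eta> :: "'a \<Rightarrow> real"
  assumes ind: "indep_set (sets N) (sets (vimage_algebra (space M) D borel))"
    and sub: "subalgebra M N" and D: "D \<in> borel_measurable M" and \<eta>: "\<eta> \<in> borel_measurable N"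
  shows "indep_var borel \<eta> borel (\<lambda>\<omega>. D \<omega> $ k)"
proof -
  have sp: "space N = space M" using sub by (simp add: subalgebra_def)
  have \<eta>M: "\<eta> \<in> borel_measurable M" using measurable_from_subalg[OF sub \<eta>] .
  have "sigma_sets (space M) {\<eta> -` A \<inter> space M |A. A \<in> sets borel} \<subseteq> sets N"
    using \<eta> sp by (intro sigma_sets_le_sets_iff[THEN iffD2, of _ N, unfolded sp] ) (auto dest: measurable_sets)
  moreover have "sigma_sets (space M) {(\<lambda>\<omega>. D \<omega> $ k) -` A \<inter> space M |A. A \<in> sets borel}
      \<subseteq> sets (vimage_algebra (space M) D borel)"
  proof -
    have D': "D \<in> measurable (vimage_algebra (space M) D borel) borel"
      by (rule measurable_vimage_algebra1) auto
    have "(\<lambda>\<omega>. D \<omega> $ k) \<in> measurable (vimage_algebra (space M) D borel) borel"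
      using D' by (rule borel_measurable_vec_component)
    from measurable_sets[OF this] show ?thesis
      using sets.sigma_sets_subset[of "{(\<lambda>\<omega>. D \<omega> $ k) -` A \<inter> space M |A. A \<in> sets borel}"
          "vimage_algebra (space M) D borel"]
      by auto
  qed
  ultimately have "indep_set (sigma_sets (space M) {\<eta> -` A \<inter> space M |A. A \<in> sets borel})
      (sigma_sets (space M) {(\<lambda>\<omega>. D \<omega> $ k) -` A \<inter> space M |A. A \<in> sets borel})"
    unfolding indep_set_def
    by (intro indep_sets_mono_sets[OF ind[unfolded indep_set_def]]) (simp split: bool.split)
  then show ?thesis
    using D \<eta>M by (simp add: indep_var_eq)
qed

text \<open>
  Moving the matrix to the other side, the inner product is a sum of products of a
  coordinate of the increment, which is centred, with a random variable known at time \<open>s\<close>, which is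
  independent of that increment.
\<close>

lemma simple_ito_summand_orthogonal:
  fixes B :: "real \<Rightarrow> 'a \<Rightarrow> real^'d" and \<phi> :: "'a \<Rightarrow> real^'d^'d"
  assumes filt: "filtration_upto M T \<F>" and B: "brownian_motion M T \<F> B"
    and s: "s \<in> {0..T}" and t: "t \<in> {0..T}" and "s \<le> t"
    and \<phi>: "\<phi> \<in> borel_measurable (\<F> s)" "\<And>\<omega>. \<omega> \<in> space M \<Longrightarrow> norm (\<phi> \<omega>) \<le> K"
    and \<xi>: "\<xi> \<in> borel_measurable (\<F> s)" "\<xi> \<in> L2_space M"
  shows "has_bochner_integral M (\<lambda>\<omega>. (\<phi> \<omega> *v (B t \<omega> - B s \<omega>)) \<bullet> \<xi> \<omega>) 0"
proof (cases "s = t")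
  case True
  then show ?thesis by (simp add: has_bochner_integral_zero)
next
  case False
  with \<open>s \<le> t\<close> have "s < t" by simp
  have sub: "subalgebra M (\<F> s)" using filt s by (simp add: filtration_upto_def)
  have dist: "distributed M lborel (\<lambda>\<omega>. B t \<omega> - B s \<omega>)
          (\<lambda>x. ennreal (\<Prod>i\<in>UNIV. normal_density 0 (sqrt (t - s)) (x $ i)))"
    and ind: "indep_set (sets (\<F> s)) (sets (vimage_algebra (space M) (\<lambda>\<omega>. B t \<omega> - B s \<omega>) borel))"
    using B s t \<open>s < t\<close> by (auto simp: brownian_motion_def)
  have "sqrt (t - s) > 0" using \<open>s < t\<close> by simp
  note D = gaussian_moments[OF dist this]
  let ?\<eta> = "\<lambda>k \<omega>. (\<xi> \<omega> v* \<phi> \<omega>) $ k"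
  have \<eta>m: "?\<eta> k \<in> borel_measurable (\<F> s)" for k
    unfolding vector_matrix_mult_def vec_lambda_beta using \<phi>(1) \<xi>(1)
    by (intro borel_measurable_sum borel_measurable_times borel_measurable_vec_component)
  have "integrable M (?\<eta> k)" for k
  proof (rule Bochner_Integration.integrable_bound)
    have "integrable M (\<lambda>\<omega>. norm (\<xi> \<omega>) \<bullet> (1::real))"
      by (intro L2_space_integrable_inner L2_space_norm \<xi> L2_space_const) unfold_locales
    then show "integrable M (\<lambda>\<omega>. real CARD('d) * K * norm (\<xi> \<omega>))" by simp
    show "?\<eta> k \<in> borel_measurable M" using measurable_from_subalg[OF sub \<eta>m] .
    show "AE \<omega> in M. norm (?\<eta> k \<omega>) \<le> norm (real CARD('d) * K * norm (\<xi> \<omega>))"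
    proof (rule AE_I2)
      fix \<omega> assume \<omega>: "\<omega> \<in> space M"
      have K: "K \<ge> 0" using \<phi>(2)[OF \<omega>] norm_ge_zero order_trans by blast
      have bnd: "\<bar>\<xi> \<omega> $ i * \<phi> \<omega> $ i $ k\<bar> \<le> K * norm (\<xi> \<omega>)" for i
        unfolding abs_mult mult.commute[of "\<bar>\<xi> \<omega> $ i\<bar>"]
        using \<phi>(2)[OF \<omega>] K component_le_norm_cart[of "\<xi> \<omega>" i] component_le_norm_cart[of "\<phi> \<omega> $ i" k]
          Finite_Cartesian_Product.norm_nth_le[of "\<phi> \<omega>" i]
        by (intro mult_mono) auto
      have "\<bar>?\<eta> k \<omega>\<bar> \<le> (\<Sum>i\<in>UNIV. \<bar>\<xi> \<omega> $ i * \<phi> \<omega> $ i $ k\<bar>)"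
        unfolding vector_matrix_mult_def vec_lambda_beta by (rule sum_abs)
      also have "\<dots> \<le> (\<Sum>i\<in>(UNIV::'d set). K * norm (\<xi> \<omega>))"
        by (rule sum_mono, rule bnd)
      finally have "\<bar>?\<eta> k \<omega>\<bar> \<le> real CARD('d) * K * norm (\<xi> \<omega>)"
        by (simp add: mult.assoc)
      then show "norm (?\<eta> k \<omega>) \<le> norm (real CARD('d) * K * norm (\<xi> \<omega>))" by simp
    qed
  qed
  then have int: "integrable M (?\<eta> k)" for k .
  have "has_bochner_integral M (\<lambda>\<omega>. ?\<eta> k \<omega> * (B t \<omega> - B s \<omega>) $ k) 0" for k
  proof -
    have iv: "indep_var borel (?\<eta> k) borel (\<lambda>\<omega>. (B t \<omega> - B s \<omega>) $ k)"
      by (rule indep_set_imp_indep_var[OF ind sub L2_spaceD(1)[OF D(1)] \<eta>m])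
    show ?thesis
      unfolding has_bochner_integral_iff
      using indep_var_lebesgue_integral[OF iv int D(3)] indep_var_integrable[OF iv int D(3)] D(4)
      by auto
  qed
  then have "has_bochner_integral M (\<lambda>\<omega>. \<Sum>k\<in>UNIV. ?\<eta> k \<omega> * (B t \<omega> - B s \<omega>) $ k) (\<Sum>k\<in>(UNIV::'d set). 0)"
    by (intro has_bochner_integral_sum) auto
  moreover have "(\<Sum>k\<in>UNIV. ?\<eta> k \<omega> * (B t \<omega> - B s \<omega>) $ k) = (\<phi> \<omega> *v (B t \<omega> - B s \<omega>)) \<bullet> \<xi> \<omega>" for \<omega>
    using dot_lmul_matrix[of "\<xi> \<omega>" "\<phi> \<omega>" "B t \<omega> - B s \<omega>"]
    by (simp add: inner_vec_def[of _ "B t \<omega> - B s \<omega>"] inner_commute[of _ "\<xi> \<omega>"])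
  ultimately show ?thesis by simp
qed

lemma simple_ito_integral_orthogonal:
  fixes B :: "real \<Rightarrow> 'a \<Rightarrow> real^'d"
  assumes filt: "filtration_upto M T \<F>" and B: "brownian_motion M T \<F> B"
    and t: "t \<in> {0..T}" and \<phi>: "simple_integrand M \<F> t T n p \<phi>"
    and \<xi>: "\<xi> \<in> borel_measurable (\<F> t)" "\<xi> \<in> L2_space M"
  shows "has_bochner_integral M (\<lambda>\<omega>. simple_ito_integral B n p \<phi> \<omega> \<bullet> \<xi> \<omega>) 0"
    and "simple_ito_integral B n p \<phi> \<in> borel_measurable M"
proof -
  have p: "t \<le> p i" if "i \<le> n" for i
    using that
  proof (induction i)
    case 0
    then show ?case using \<phi> by (simp add: simple_integrand_def)
  next
    case (Suc i)
    then show ?case using \<phi> by (auto simp: simple_integrand_def dest: spec[of _ i])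
  qed
  have "p i \<le> T" if "i \<le> n" for i
    using that
  proof (induction rule: inc_induct)
    case base
    then show ?case using \<phi> by (simp add: simple_integrand_def)
  next
    case (step i)
    then show ?case using \<phi> by (auto simp: simple_integrand_def dest: spec[of _ i])
  qed
  with p t have pT: "p i \<in> {0..T}" if "i \<le> n" for i using that by fastforce
  have sub: "subalgebra M (\<F> s)" if "s \<in> {0..T}" for s using filt that by (simp add: filtration_upto_def)
  have mono: "\<xi> \<in> borel_measurable (\<F> (p i))" if "i < n" for i
  proof (rule measurable_from_subalg[OF _ \<xi>(1)])
    show "subalgebra (\<F> (p i)) (\<F> t)"
      using filt t pT[of i] p[of i] sub[of t] sub[of "p i"] that
      by (auto simp: filtration_upto_def subalgebra_def)
  qed
  have summand: "has_bochner_integral M (\<lambda>\<omega>. (\<phi> i \<omega> *v (B (p (Suc i)) \<omega> - B (p i) \<omega>)) \<bullet> \<xi> \<omega>) 0"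
    if i: "i < n" for i
  proof -
    obtain K where "\<forall>\<omega>\<in>space M. norm (\<phi> i \<omega>) \<le> K"
      using \<phi> i unfolding simple_integrand_def by blast
    then show ?thesis
      using \<phi> that pT[of i] pT[of "Suc i"] mono[of i] \<xi>
      by (intro simple_ito_summand_orthogonal[OF filt B]) (auto simp: simple_integrand_def)
  qed
  have "has_bochner_integral M (\<lambda>\<omega>. \<Sum>i<n. (\<phi> i \<omega> *v (B (p (Suc i)) \<omega> - B (p i) \<omega>)) \<bullet> \<xi> \<omega>) (\<Sum>i<n. 0)"
    by (intro has_bochner_integral_sum) (auto intro!: summand)
  then show "has_bochner_integral M (\<lambda>\<omega>. simple_ito_integral B n p \<phi> \<omega> \<bullet> \<xi> \<omega>) 0"
    by (simp add: simple_ito_integral_def inner_sum_left)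
  have \<phi>m: "\<phi> i \<in> borel_measurable M" if "i < n" for i
    using \<phi> that pT[of i] by (intro measurable_from_subalg[OF sub]) (auto simp: simple_integrand_def)
  have Bm: "B s \<in> borel_measurable M" if "s \<in> {0..T}" for s
    using B that by (intro measurable_from_subalg[OF sub]) (auto simp: brownian_motion_def adapted_upto_def)
  show "simple_ito_integral B n p \<phi> \<in> borel_measurable M"
    unfolding simple_ito_integral_def[abs_def]
    using \<phi>m Bm pT
    by (intro borel_measurable_sum borel_measurable_matrix_vector_mult borel_measurable_diff) auto
qed

text \<open>
  The martingale property of the Ito integral in weak form, obtained by passing to the
  \<open>L\<^sup>2\<close>-limit. This is all that the argument needs to know about the martingale
  part of a backward equation: tested against random variables known at time \<open>t\<close> it disappears.
\<close>

lemma ito_integral_orthogonal: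
  fixes B :: "real \<Rightarrow> 'a \<Rightarrow> real^'d"
  assumes filt: "filtration_upto M T \<F>" and B: "brownian_motion M T \<F> B"
    and t: "t \<in> {0..T}" and I: "has_ito_integral M \<F> B t T Z I"
    and \<xi>: "\<xi> \<in> borel_measurable (\<F> t)" "\<xi> \<in> L2_space M"
  shows "L2_inner M I \<xi> = 0"
proof -
  have IL: "I \<in> L2_space M" using I by (simp add: has_ito_integral_def)
  obtain n p \<phi> where \<phi>: "\<And>k. simple_integrand M \<F> t T (n k) (p k) (\<phi> k)"
    and lim: "(\<lambda>k. \<integral>\<^sup>+ \<omega>. ennreal ((norm (simple_ito_integral B (n k) (p k) (\<phi> k) \<omega> - I \<omega>))\<^sup>2) \<partial>M) \<longlonglongrightarrow> 0"
    using I unfolding has_ito_integral_def by blast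
  let ?S = "\<lambda>k. simple_ito_integral B (n k) (p k) (\<phi> k)"
  let ?e = "\<lambda>k. \<integral>\<^sup>+ \<omega>. ennreal ((norm (?S k \<omega> - I \<omega>))\<^sup>2) \<partial>M"
  note S = simple_ito_integral_orthogonal[OF filt B t \<phi> \<xi>]
  note [measurable] = S(2) L2_spaceD(1)[OF IL]
  have bound: "\<forall>\<^sub>F k in sequentially. \<bar>L2_inner M I \<xi>\<bar> \<le> sqrt (enn2real (?e k)) * L2_norm M \<xi>"
    using order_tendstoD(2)[OF lim zero_less_one]
  proof eventually_elim
    case (elim k)
    then have fin: "?e k < \<infinity>" using order_less_trans[OF elim, of \<infinity>] by simp
    have d: "(\<lambda>\<omega>. ?S k \<omega> - I \<omega>) \<in> L2_space M"
      unfolding L2_space_def using fin by (auto intro!: integrableI_bounded)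
    have "L2_inner M (\<lambda>\<omega>. ?S k \<omega> - I \<omega>) \<xi> = (\<integral>\<omega>. ?S k \<omega> \<bullet> \<xi> \<omega> - I \<omega> \<bullet> \<xi> \<omega> \<partial>M)"
      by (simp add: L2_inner_def inner_diff_left)
    also have "\<dots> = 0 - L2_inner M I \<xi>"
      using S(1)[of k] L2_space_integrable_inner[OF IL \<xi>(2)]
      by (simp add: L2_inner_def has_bochner_integral_iff)
    finally have "\<bar>L2_inner M I \<xi>\<bar> = \<bar>L2_inner M (\<lambda>\<omega>. ?S k \<omega> - I \<omega>) \<xi>\<bar>" by simp
    also have "\<dots> \<le> L2_norm M (\<lambda>\<omega>. ?S k \<omega> - I \<omega>) * L2_norm M \<xi>"
      by (rule L2_Cauchy_Schwarz[OF d \<xi>(2)])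
    also have "L2_norm M (\<lambda>\<omega>. ?S k \<omega> - I \<omega>) = sqrt (enn2real (?e k))"
      unfolding L2_norm_def L2_inner_self by (subst integral_eq_nn_integral) auto
    finally show ?case .
  qed
  have "(\<lambda>k. enn2real (?e k)) \<longlonglongrightarrow> 0"
    using tendsto_enn2real[of ?e 0 sequentially] lim by simp
  then have "(\<lambda>k. sqrt (enn2real (?e k)) * L2_norm M \<xi>) \<longlonglongrightarrow> sqrt 0 * L2_norm M \<xi>"
    by (intro tendsto_mult tendsto_real_sqrt tendsto_const)
  then have "\<bar>L2_inner M I \<xi>\<bar> \<le> sqrt 0 * L2_norm M \<xi>"
    by (rule tendsto_lowerbound) (use bound in auto)
  then show ?thesis by simp
qed

end

section \<open>Laws and lifted coefficients\<close>

lemma continuous_lift_borel_measurable: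
  fixes f :: "'v::euclidean_space \<Rightarrow> 'v measure \<Rightarrow> 'v \<Rightarrow> 'w::euclidean_space"
  assumes f: "continuous_state_law_control f" and \<mu>: "\<mu> \<in> P2" and self: "wasserstein2 \<mu> \<mu> = 0"
    and X: "X \<in> borel_measurable N" "U \<in> borel_measurable N"
  shows "(\<lambda>\<omega>. f (X \<omega>) \<mu> (U \<omega>)) \<in> borel_measurable N"
proof -
  have "continuous_on UNIV (\<lambda>z. f (fst z) \<mu> (snd z))"
  proof (unfold continuous_on_iff, intro ballI allI impI)
    fix z :: "'v \<times> 'v" and e :: real assume "e > 0"
    then obtain d where d: "d > 0"
      "\<And>x' \<mu>' u'. \<mu>' \<in> P2 \<Longrightarrow> dist x' (fst z) < d \<Longrightarrow> wasserstein2 \<mu>' \<mu> < d \<Longrightarrow> dist u' (snd z) < d \<Longrightarrow>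
          dist (f x' \<mu>' u') (f (fst z) \<mu> (snd z)) < e"
      using f \<mu> unfolding continuous_state_law_control_def by meson
    show "\<exists>d>0. \<forall>z'\<in>UNIV. dist z' z < d \<longrightarrow> dist (f (fst z') \<mu> (snd z')) (f (fst z) \<mu> (snd z)) < e"
    proof (intro exI[of _ d] conjI ballI impI \<open>d > 0\<close>)
      fix z' assume "dist z' z < d"
      then show "dist (f (fst z') \<mu> (snd z')) (f (fst z) \<mu> (snd z)) < e"
        using d self \<mu> dist_fst_le[of z' z] dist_snd_le[of z' z] by (intro d(2)) auto
    qed
  qed
  then have "(\<lambda>z. f (fst z) \<mu> (snd z)) \<in> borel_measurable borel"
    by (rule borel_measurable_continuous_onI)
  from measurable_compose[OF _ this, of "\<lambda>\<omega>. (X \<omega>, U \<omega>)" N] X show ?thesis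
    by (simp add: borel_prod[symmetric])
qed

context prob_space
begin

lemma law_in_P2:
  fixes X :: "'a \<Rightarrow> 'v::euclidean_space"
  assumes "X \<in> L2_space M"
  shows "law M X \<in> P2" and "second_moment (law M X) = L2_inner M X X"
  using L2_spaceD[OF assms]
  by (auto simp: P2_def law_def second_moment_def L2_inner_self prob_space_distr integrable_distr_eq integral_distr)

text \<open>
  The joint law of \<open>X\<close> and \<open>Y\<close> is one of the couplings over which the infimum is taken.
\<close>

lemma wasserstein2_law_le:
  fixes X Y :: "'a \<Rightarrow> 'v::euclidean_space"
  assumes X: "X \<in> L2_space M" and Y: "Y \<in> L2_space M"
  shows "wasserstein2 (law M X) (law M Y) \<le> L2_dist M X Y"
proof -
  note [measurable] = L2_spaceD(1)[OF X] L2_spaceD(1)[OF Y]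
  let ?\<pi> = "distr M (borel \<Otimes>\<^sub>M borel) (\<lambda>\<omega>. (X \<omega>, Y \<omega>))"
  have "?\<pi> \<in> couplings (law M X) (law M Y)"
    by (auto simp: couplings_def law_def distr_distr comp_def)
  then have "(INF \<pi> \<in> couplings (law M X) (law M Y). \<integral>\<^sup>+ (x, y). ennreal ((dist x y)\<^sup>2) \<partial>\<pi>)
      \<le> (\<integral>\<^sup>+ (x, y). ennreal ((dist x y)\<^sup>2) \<partial>?\<pi>)"
    by (rule INF_lower)
  also have "\<dots> = (\<integral>\<^sup>+ \<omega>. ennreal ((norm (X \<omega> - Y \<omega>))\<^sup>2) \<partial>M)"
    by (subst nn_integral_distr) (auto simp: split_beta' dist_norm)
  also have "\<dots> = ennreal (L2_inner M (\<lambda>\<omega>. X \<omega> - Y \<omega>) (\<lambda>\<omega>. X \<omega> - Y \<omega>))"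
    unfolding L2_inner_self
    using L2_spaceD(2)[OF L2_space_diff[OF X Y]] by (intro nn_integral_eq_integral) auto
  finally have "enn2real (INF \<pi> \<in> couplings (law M X) (law M Y). \<integral>\<^sup>+ (x, y). ennreal ((dist x y)\<^sup>2) \<partial>\<pi>)
      \<le> L2_inner M (\<lambda>\<omega>. X \<omega> - Y \<omega>) (\<lambda>\<omega>. X \<omega> - Y \<omega>)"
    by (rule enn2real_leI[OF L2_inner_self_nonneg])
  then show ?thesis
    unfolding wasserstein2_def L2_dist_def L2_norm_def by (rule real_sqrt_le_mono)
qed

end

lemma wasserstein2_self:
  fixes \<mu> :: "'v::euclidean_space measure"
  assumes "\<mu> \<in> P2" shows "wasserstein2 \<mu> \<mu> = 0"
proof -
  interpret prob_space \<mu> using assms by (simp add: P2_def)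
  have sets: "sets \<mu> = sets borel" using assms by (simp add: P2_def)
  have id: "(\<lambda>x. x) \<in> L2_space \<mu>"
    using assms measurable_ident_sets[OF sets] by (simp add: P2_def L2_space_def)
  have "law \<mu> (\<lambda>x. x) = \<mu>"
    unfolding law_def by (rule distr_id2) (simp add: sets)
  then have "wasserstein2 \<mu> \<mu> \<le> 0"
    using wasserstein2_law_le[OF id id] by (simp add: L2_dist_def L2_norm_def L2_inner_def)
  moreover have "0 \<le> wasserstein2 \<mu> \<mu>" by (simp add: wasserstein2_def)
  ultimately show ?thesis by simp
qed

context prob_space
begin

lemma lift_state_control_measurable:
  fixes f :: "'v::euclidean_space \<Rightarrow> 'v measure \<Rightarrow> 'v \<Rightarrow> 'v"
  assumes "continuous_state_law_control f" "X \<in> L2_space M"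
    "X \<in> borel_measurable N" "U \<in> borel_measurable N"
  shows "lift_state_control M f X U \<in> borel_measurable N"
  unfolding lift_state_control_def
  by (rule continuous_lift_borel_measurable[OF assms(1) law_in_P2(1)[OF assms(2)]
        wasserstein2_self[OF law_in_P2(1)[OF assms(2)]] assms(3,4)])

text \<open>
  The linear growth of the coefficients, evaluated along \<open>X\<close> and \<open>U\<close>; the moment of the law of \<open>X\<close> is
  \<open>\<parallel>X\<parallel>\<^sup>2\<close>. Its joint measurability in time and chance is visible from the formula, whereas that of the
  coefficients themselves depends on the regularity of \<open>t \<mapsto> \<L>(X t)\<close>.
\<close>

definition growth_bound :: "real \<Rightarrow> ('a \<Rightarrow> 'v::euclidean_space) \<Rightarrow> ('a \<Rightarrow> 'v) \<Rightarrow> 'a \<Rightarrow> real" where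
  "growth_bound K X U \<omega> = K * (1 + norm (X \<omega>) + norm (U \<omega>) + L2_norm M X)"

lemma growth_bound_L2:
  assumes "X \<in> L2_space M" "U \<in> L2_space M"
  shows "growth_bound K X U \<in> L2_space M"
proof -
  have "(\<lambda>\<omega>. K *\<^sub>R (1 + norm (X \<omega>) + norm (U \<omega>) + L2_norm M X)) \<in> L2_space M"
    by (intro L2_space_scaleR L2_space_add L2_space_norm L2_space_const assms) unfold_locales
  then show ?thesis by (simp add: growth_bound_def[abs_def])
qed

lemma L2_norm_process_square_integrable:
  fixes X :: "real \<Rightarrow> 'a \<Rightarrow> 'v::euclidean_space"
  assumes X: "square_integrable_process M T X"
  shows "square_integrable_process M T (\<lambda>t \<omega>. L2_norm M (X t))"
proof -
  interpret P: pair_sigma_finite "time T" M by (rule pair_sigma_finite_time)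
  have i: "integrable (time T) (\<lambda>t. L2_inner M (X t) (X t))"
    by (rule integrable_L2_inner_process(1)[OF X X])
  have [measurable]: "(\<lambda>t. L2_norm M (X t)) \<in> borel_measurable (time T)"
    using i unfolding L2_norm_def by measurable
  have "integrable (time T \<Otimes>\<^sub>M M) (\<lambda>(t, \<omega>). (L2_norm M (X t))\<^sup>2)"
  proof (rule P.Fubini_integrable)
    show "integrable (time T) (\<lambda>x. \<integral>y. norm (case (x, y) of (t, \<omega>) \<Rightarrow> (L2_norm M (X t))\<^sup>2) \<partial>M)"
      using i by (simp add: L2_norm_squared prob_space L2_inner_self_nonneg)
  qed auto
  then show ?thesis by (simp add: square_integrable_process_def L2_space_def split_beta')
qed

lemma growth_bound_square_integrable:
  assumes X: "square_integrable_process M T X" and U: "square_integrable_process M T U"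
  shows "square_integrable_process M T (\<lambda>t. growth_bound K (X t) (U t))"
proof -
  interpret P: finite_measure "time T \<Otimes>\<^sub>M M" by (rule finite_measure_time_pair)
  have "(\<lambda>z. K *\<^sub>R (1 + norm (case_prod X z) + norm (case_prod U z)
      + (case z of (t, \<omega>) \<Rightarrow> L2_norm M (X t)))) \<in> L2_space (time T \<Otimes>\<^sub>M M)"
    by (intro L2_space_scaleR L2_space_add L2_space_norm L2_space_const square_integrable_processD(1) X U
        L2_norm_process_square_integrable[OF X, THEN square_integrable_processD(1)] P.finite_measure_axioms)
  then show ?thesis
    by (simp add: square_integrable_process_def growth_bound_def split_beta')
qed

lemma lift_state_control_growth:
  fixes f :: "'v::euclidean_space \<Rightarrow> 'v measure \<Rightarrow> 'v \<Rightarrow> 'v"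
  assumes "\<And>x \<mu> u. \<mu> \<in> P2 \<Longrightarrow> norm (f x \<mu> u) \<le> K * (1 + norm x + norm u + sqrt (second_moment \<mu>))"
    and "X \<in> L2_space M"
  shows "norm (lift_state_control M f X U \<omega>) \<le> growth_bound K X U \<omega>"
  using assms(1)[OF law_in_P2(1)[OF assms(2)]] law_in_P2(2)[OF assms(2)]
  by (simp add: lift_state_control_def growth_bound_def L2_norm_def)

lemma lift_state_control_L2:
  fixes f :: "'v::euclidean_space \<Rightarrow> 'v measure \<Rightarrow> 'v \<Rightarrow> 'v"
  assumes f: "continuous_state_law_control f"
    and g: "\<And>x \<mu> u. \<mu> \<in> P2 \<Longrightarrow> norm (f x \<mu> u) \<le> K * (1 + norm x + norm u + sqrt (second_moment \<mu>))"
    and X: "X \<in> L2_space M" and U: "U \<in> L2_space M"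
  shows "lift_state_control M f X U \<in> L2_space M"
proof (rule L2_spaceI_bound[OF growth_bound_L2[OF X U]])
  show "lift_state_control M f X U \<in> borel_measurable M"
    using f X U by (auto intro!: lift_state_control_measurable dest: L2_spaceD)
  show "AE \<omega> in M. norm (lift_state_control M f X U \<omega>) \<le> norm (growth_bound K X U \<omega>)"
    using order_trans[OF lift_state_control_growth[OF g X] abs_ge_self] by (intro AE_I2) simp
qed

lemma lift_state_L2:
  fixes f :: "'v::euclidean_space \<Rightarrow> 'v measure \<Rightarrow> 'v"
  assumes f: "continuous_state_law f"
    and g: "\<And>x \<mu>. \<mu> \<in> P2 \<Longrightarrow> norm (f x \<mu>) \<le> K * (1 + norm x + sqrt (second_moment \<mu>))"
    and X: "X \<in> L2_space M"
  shows "lift_state M f X \<in> L2_space M"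
proof -
  have c: "continuous_state_law_control (\<lambda>x \<mu> (u::'v). f x \<mu>)"
    using f unfolding continuous_state_law_control_def continuous_state_law_def by meson
  have "norm (f x \<mu>) \<le> \<bar>K\<bar> * (1 + norm x + norm u + sqrt (second_moment \<mu>))" if "\<mu> \<in> P2" for x \<mu> u
  proof -
    have "norm (f x \<mu>) \<le> K * (1 + norm x + sqrt (second_moment \<mu>))" using g[OF that] .
    also have "\<dots> \<le> \<bar>K\<bar> * (1 + norm x + norm u + sqrt (second_moment \<mu>))"
      by (intro mult_mono) (auto simp: second_moment_def)
    finally show ?thesis .
  qed
  from lift_state_control_L2[OF c this X X] show ?thesis
    by (simp add: lift_state_control_def lift_state_def)
qed

text \<open>
  The coefficient depends on time also through the law of \<open>X t\<close>, which lives in a space of measures.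
  If the time in the law is rounded down to a grid, only countably many laws occur and for
  each of them the coefficient is a continuous function of \<open>(X, U)\<close>. Continuity of \<open>X\<close> in
  \<open>L\<^sup>2\<close> makes the laws converge in Wasserstein distance as the grid is refined, hence the coefficient
  converges at every point.
\<close>

lemma lift_process_measurable:
  fixes f :: "'v::euclidean_space \<Rightarrow> 'v measure \<Rightarrow> 'v \<Rightarrow> 'v"
  assumes f: "continuous_state_law_control f" and "T > 0"
    and X: "square_integrable_process M T X" and U: "square_integrable_process M T U"
    and L2: "\<And>t. t \<in> {0..T} \<Longrightarrow> X t \<in> L2_space M"
    and cont: "\<And>s t. 0 \<le> s \<Longrightarrow> s \<le> t \<Longrightarrow> t \<le> T \<Longrightarrow> L2_dist M (X s) (X t) \<le> K * sqrt (t - s)"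
  shows "(\<lambda>(t, \<omega>). lift_state_control M f (X t) (U t) \<omega>) \<in> borel_measurable (time T \<Otimes>\<^sub>M M)"
proof -
  \<comment> \<open>the largest multiple of \<open>1 / n\<close> below \<open>t\<close>; the minimum with \<open>T\<close> only serves to keep the countably many
    candidate laws in \<open>P2\<close>\<close>
  define r where "r n t = min T (real (nat \<lfloor>real n * t\<rfloor>) / real n)" for n t
  let ?f = "\<lambda>n (t, \<omega>). f (X t \<omega>) (law M (X (r n t))) (U t \<omega>)"
  have r_le: "r (Suc n) t \<in> {0..T}" "r (Suc n) t \<le> t" "t - r (Suc n) t \<le> 1 / real (Suc n)" if t: "t \<in> {0..T}" for n t
  proof -
    have nn: "0 \<le> real (Suc n) * t" using t by simp
    have "real (nat \<lfloor>real (Suc n) * t\<rfloor>) \<le> real (Suc n) * t"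
      using nn by (simp add: of_nat_floor)
    then have le: "real (nat \<lfloor>real (Suc n) * t\<rfloor>) / real (Suc n) \<le> t"
      by (simp add: divide_le_eq mult.commute)
    have "real (Suc n) * t - 1 \<le> real (nat \<lfloor>real (Suc n) * t\<rfloor>)"
      using nn by linarith
    then have "(real (Suc n) * t - 1) / real (Suc n) \<le> real (nat \<lfloor>real (Suc n) * t\<rfloor>) / real (Suc n)"
      by (intro divide_right_mono) auto
    then have "t - 1 / real (Suc n) \<le> real (nat \<lfloor>real (Suc n) * t\<rfloor>) / real (Suc n)"
      by (simp add: diff_divide_distrib del: of_nat_Suc)
    then show "r (Suc n) t \<in> {0..T}" "r (Suc n) t \<le> t" "t - r (Suc n) t \<le> 1 / real (Suc n)"
      using le t unfolding r_def by auto
  qed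
  show ?thesis
  proof (rule borel_measurable_LIMSEQ_metric)
    fix n
    have "(\<lambda>z. f (case_prod X z) (law M (X (min T (real i / real (Suc n))))) (case_prod U z))
        \<in> borel_measurable (time T \<Otimes>\<^sub>M M)" for i
    proof -
      have P2: "law M (X (min T (real i / real (Suc n)))) \<in> P2"
        using \<open>T > 0\<close> by (intro law_in_P2 L2) auto
      show ?thesis
        by (rule continuous_lift_borel_measurable[OF f P2 wasserstein2_self[OF P2]
              square_integrable_processD(2)[OF X] square_integrable_processD(2)[OF U]])
    qed
    moreover have "(\<lambda>z. nat \<lfloor>real (Suc n) * fst z\<rfloor>) \<in> measurable (time T \<Otimes>\<^sub>M M) (count_space UNIV)"
      by measurable
    ultimately have "(\<lambda>z. f (case_prod X z) (law M (X (min T (real (nat \<lfloor>real (Suc n) * fst z\<rfloor>) / real (Suc n))))) (case_prod U z))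
        \<in> borel_measurable (time T \<Otimes>\<^sub>M M)"
      by (rule measurable_compose_countable)
    then show "?f (Suc n) \<in> borel_measurable (time T \<Otimes>\<^sub>M M)"
      by (simp add: r_def split_beta')
  next
    fix z assume "z \<in> space (time T \<Otimes>\<^sub>M M)"
    then obtain t \<omega> where z: "z = (t, \<omega>)" and t: "t \<in> {0..T}"
      by (auto simp: space_pair_measure space_restrict_space)
    have W: "wasserstein2 (law M (X (r (Suc n) t))) (law M (X t)) \<le> K * sqrt (1 / real (Suc n))" for n
    proof -
      have K: "0 \<le> K"
        using cont[of 0 T] L2_dist_nonneg[of M "X 0" "X T"] \<open>T > 0\<close>
        by (smt (verit) mult_neg_pos real_sqrt_gt_zero)
      have "wasserstein2 (law M (X (r (Suc n) t))) (law M (X t)) \<le> L2_dist M (X (r (Suc n) t)) (X t)"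
        by (intro wasserstein2_law_le L2 r_le t)
      also have "\<dots> \<le> K * sqrt (t - r (Suc n) t)"
        using r_le[OF t] t by (intro cont) auto
      also have "\<dots> \<le> K * sqrt (1 / real (Suc n))"
        using r_le[OF t] K by (intro mult_left_mono real_sqrt_le_mono) auto
      finally show ?thesis .
    qed
    have lim: "(\<lambda>n. K * sqrt (1 / real (Suc n))) \<longlonglongrightarrow> 0"
    proof -
      have "(\<lambda>n. K * sqrt (1 / real (Suc n))) \<longlonglongrightarrow> K * sqrt 0"
        using LIMSEQ_inverse_real_of_nat
        by (intro tendsto_mult tendsto_const tendsto_real_sqrt) (simp add: inverse_eq_divide)
      then show ?thesis by simp
    qed
    have "(\<lambda>n. f (X t \<omega>) (law M (X (r (Suc n) t))) (U t \<omega>)) \<longlonglongrightarrow> f (X t \<omega>) (law M (X t)) (U t \<omega>)"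
    proof (rule tendstoI)
      fix e :: real assume "e > 0"
      then obtain d where d: "d > 0"
        "\<And>x' \<mu>' u'. \<mu>' \<in> P2 \<Longrightarrow> dist x' (X t \<omega>) < d \<Longrightarrow> wasserstein2 \<mu>' (law M (X t)) < d \<Longrightarrow> dist u' (U t \<omega>) < d \<Longrightarrow>
          dist (f x' \<mu>' u') (f (X t \<omega>) (law M (X t)) (U t \<omega>)) < e"
        using f law_in_P2(1)[OF L2[OF t]] unfolding continuous_state_law_control_def by meson
      have "\<forall>\<^sub>F n in sequentially. K * sqrt (1 / real (Suc n)) < d"
        using order_tendstoD(2)[OF lim \<open>d > 0\<close>] .
      then show "\<forall>\<^sub>F n in sequentially. dist (f (X t \<omega>) (law M (X (r (Suc n) t))) (U t \<omega>))
          (f (X t \<omega>) (law M (X t)) (U t \<omega>)) < e"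
      proof eventually_elim
        case (elim n)
        then show ?case
          using W[of n] \<open>d > 0\<close> r_le(1)[OF t, of n] by (intro d(2) law_in_P2 L2) auto
      qed
    qed
    then show "(\<lambda>n. ?f (Suc n) z) \<longlonglongrightarrow> (case z of (t, \<omega>) \<Rightarrow> lift_state_control M f (X t) (U t) \<omega>)"
      by (simp add: z lift_state_control_def)
  qed
qed

end

section \<open>Solutions of the forward-backward system\<close>

context prob_space
begin

text \<open>
  Cauchy--Schwarz in time against the indicator of the interval, which has squared norm \<open>t - s\<close>.
\<close>

lemma L2_norm_time_integral_le:
  assumes H: "square_integrable_process M T H" and "0 \<le> s" "s \<le> t" "t \<le> T"
  defines "R \<equiv> \<lambda>\<omega>. \<integral>r. norm (indicat_real {s<..t} r *\<^sub>R H r \<omega>) \<partial>time T"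
  shows "R \<in> L2_space M"
    and "L2_norm M R \<le> sqrt (t - s) * sqrt (\<integral>r. L2_inner M (H r) (H r) \<partial>time T)"
proof -
  have ind: "square_integrable_process M T (\<lambda>r \<omega>. indicat_real {s<..t} r *\<^sub>R H r \<omega>)"
    by (rule square_integrable_process_indicator[OF H]) simp
  show R: "R \<in> L2_space M"
    unfolding R_def by (rule L2_space_time_integral_norm[OF ind])
  interpret L: finite_measure "time T" by (rule finite_measure_time)
  have "indicat_real {s<..t} \<in> borel_measurable (time T)"
    by (rule measurable_restrict_space1) simp
  then have one: "indicat_real {s<..t} \<in> L2_space (time T)"
    by (intro L2_spaceI_bound[OF L2_space_const[OF finite_measure_time, of "1::real"]])
       (auto simp: indicator_def)
  have len: "L2_inner (time T) (indicat_real {s<..t}) (indicat_real {s<..t}) = t - s"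
  proof -
    have "L2_inner (time T) (indicat_real {s<..t}) (indicat_real {s<..t})
        = (\<integral>r. indicat_real {0..T} r *\<^sub>R (indicat_real {s<..t} r * indicat_real {s<..t} r) \<partial>lborel)"
      unfolding L2_inner_def by (subst integral_restrict_space) auto
    also have "\<dots> = (\<integral>r. indicat_real {s<..t} r \<partial>lborel)"
      using assms by (intro Bochner_Integration.integral_cong) (auto simp: indicator_def)
    also have "\<dots> = t - s" using assms by simp
    finally show ?thesis .
  qed
  have "L2_inner M R R \<le> (\<integral>\<omega>. (t - s) * (\<integral>r. H r \<omega> \<bullet> H r \<omega> \<partial>time T) \<partial>M)"
    unfolding L2_inner_self
  proof (rule integral_mono_AE)
    show "integrable M (\<lambda>\<omega>. (norm (R \<omega>))\<^sup>2)" using L2_spaceD(2)[OF R] .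
    show "integrable M (\<lambda>\<omega>. (t - s) * (\<integral>r. H r \<omega> \<bullet> H r \<omega> \<partial>time T))"
      by (intro integrable_mult_right integrable_L2_inner_process[OF H H])
    show "AE \<omega> in M. (norm (R \<omega>))\<^sup>2 \<le> (t - s) * (\<integral>r. H r \<omega> \<bullet> H r \<omega> \<partial>time T)"
      using square_integrable_process_AE_square_integrable[OF H]
    proof eventually_elim
      case (elim \<omega>)
      let ?h = "\<lambda>r. norm (H r \<omega>)"
      have "\<bar>L2_inner (time T) (indicat_real {s<..t}) ?h\<bar>
          \<le> L2_norm (time T) (indicat_real {s<..t}) * L2_norm (time T) ?h"
        by (intro L2_Cauchy_Schwarz one L2_space_norm elim)
      then have "\<bar>L2_inner (time T) (indicat_real {s<..t}) ?h\<bar>\<^sup>2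
          \<le> (L2_norm (time T) (indicat_real {s<..t}) * L2_norm (time T) ?h)\<^sup>2"
        by (rule power_mono) simp
      moreover have "L2_inner (time T) (indicat_real {s<..t}) ?h = R \<omega>"
        by (simp add: L2_inner_def R_def)
      ultimately show ?case
        by (simp add: power_mult_distrib L2_norm_squared len L2_inner_self[of "time T" ?h] power2_norm_eq_inner)
    qed
  qed
  also have "\<dots> = (t - s) * (\<integral>r. L2_inner M (H r) (H r) \<partial>time T)"
    using integrable_L2_inner_process(2)[OF H H] by simp
  finally show "L2_norm M R \<le> sqrt (t - s) * sqrt (\<integral>r. L2_inner M (H r) (H r) \<partial>time T)"
    unfolding L2_norm_def real_sqrt_mult[symmetric] by (rule real_sqrt_le_mono)
qed

end

lemma L2_norm_mono_AE:
  assumes Y: "Y \<in> L2_space M" and X: "X \<in> borel_measurable M" and le: "AE \<omega> in M. norm (X \<omega>) \<le> norm (Y \<omega>)"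
  shows "L2_norm M X \<le> L2_norm M Y"
  unfolding L2_norm_def L2_inner_self
  by (rule real_sqrt_le_mono, rule integral_mono_AE)
     (use L2_spaceD(2)[OF Y] L2_spaceD(2)[OF L2_spaceI_bound[OF Y X le]] le in \<open>auto elim!: eventually_mono intro: power_mono\<close>)

lemma L2_norm_norm: "L2_norm M (\<lambda>\<omega>. norm (X \<omega>)) = L2_norm M X"
  by (simp add: L2_norm_def L2_inner_self)

lemma L2_norm_scaleR: "L2_norm M (\<lambda>\<omega>. c *\<^sub>R X \<omega>) = \<bar>c\<bar> * L2_norm M X"
proof -
  have "L2_inner M (\<lambda>\<omega>. c *\<^sub>R X \<omega>) (\<lambda>\<omega>. c *\<^sub>R X \<omega>) = c\<^sup>2 * L2_inner M X X"
    by (simp only: L2_inner_scaleR_left L2_inner_scaleR_right power2_eq_square mult.assoc)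
  then show ?thesis by (simp add: L2_norm_def real_sqrt_mult)
qed

lemma integral_upto_diff:
  fixes f g :: "real \<Rightarrow> 'v::euclidean_space"
  assumes "integrable (time T) f" "integrable (time T) g"
  shows "integral_upto T (\<lambda>r. f r - g r) s = integral_upto T f s - integral_upto T g s"
  unfolding integral_upto_def scaleR_diff_right
  using assms by (intro Bochner_Integration.integral_diff integrable_time_indicator) auto

lemma integral_from_diff:
  fixes f g :: "real \<Rightarrow> 'v::euclidean_space"
  assumes "integrable (time T) f" "integrable (time T) g"
  shows "integral_from T (\<lambda>r. f r - g r) s = integral_from T f s - integral_from T g s"
  unfolding integral_from_def scaleR_diff_right
  using assms by (intro Bochner_Integration.integral_diff integrable_time_indicator) auto

text \<open>
  The coefficients of the forward-backward system, with linear growth and continuity only. The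
  monotonicity and Hoelder conditions enter after the energy identities.
\<close>

locale mean_field_system = prob_space M for M :: "'a measure" +
  fixes T K :: real and W0 :: "real^'d \<Rightarrow> (real^'d) measure \<Rightarrow> real^'d"
    and F G :: "real^'d \<Rightarrow> (real^'d) measure \<Rightarrow> real^'d \<Rightarrow> real^'d"
  assumes T_pos: "T > 0"
    and W0_cont: "continuous_state_law W0"
    and F_cont: "continuous_state_law_control F" and G_cont: "continuous_state_law_control G"
    and W0_growth: "\<And>x \<mu>. \<mu> \<in> P2 \<Longrightarrow> norm (W0 x \<mu>) \<le> K * (1 + norm x + sqrt (second_moment \<mu>))"
    and F_growth: "\<And>x \<mu> u. \<mu> \<in> P2 \<Longrightarrow> norm (F x \<mu> u) \<le> K * (1 + norm x + norm u + sqrt (second_moment \<mu>))"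
    and G_growth: "\<And>x \<mu> u. \<mu> \<in> P2 \<Longrightarrow> norm (G x \<mu> u) \<le> K * (1 + norm x + norm u + sqrt (second_moment \<mu>))"
begin

context
  fixes \<sigma> \<F> B X0 X W Z
  assumes filt: "filtration_upto M T \<F>" and B: "brownian_motion M T \<F> B"
    and \<sigma>: "\<sigma> \<ge> 0"
    and sol: "strong_solution M T W0 F G \<sigma> \<F> B X0 X W Z"
begin

lemma solution_L2: "t \<in> {0..T} \<Longrightarrow> X t \<in> L2_space M" "t \<in> {0..T} \<Longrightarrow> W t \<in> L2_space M"
  and solution_square_integrable: "square_integrable_process M T X" "square_integrable_process M T W"
  and solution_adapted: "t \<in> {0..T} \<Longrightarrow> X t \<in> borel_measurable (\<F> t)"
    "t \<in> {0..T} \<Longrightarrow> W t \<in> borel_measurable (\<F> t)"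
  using sol by (auto simp: strong_solution_def adapted_upto_def)

lemma solution_forward_equation:
  assumes "t \<in> {0..T}"
  shows "AE \<omega> in M. X t \<omega> = X0 \<omega> - integral_upto T (\<lambda>s. lift_state_control M F (X s) (W s) \<omega>) t
      + \<sigma> *\<^sub>R B t \<omega>"
  unfolding integral_upto_eq_set_integral[OF assms, symmetric]
  using sol assms unfolding strong_solution_def by blast

text \<open>
  Joint measurability of the drift in time and chance will follow from this lemma and cannot be used
  here. Almost every path of the drift is integrable, however, and dominated by \<open>growth_bound\<close>, which
  is jointly measurable. So the drift contributes at most a multiple of \<open>sqrt (t - s)\<close> to the norm of the
  increment, and so does the Brownian motion.
\<close>

lemma solution_time_continuity:
  "\<exists>C. \<forall>s t. 0 \<le> s \<longrightarrow> s \<le> t \<longrightarrow> t \<le> T \<longrightarrow> L2_dist M (X s) (X t) \<le> C * sqrt (t - s)"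
proof (intro exI allI impI)
  fix s t assume st: "0 \<le> s" "s \<le> t" "t \<le> T"
  let ?H = "\<lambda>r. growth_bound K (X r) (W r)"
  let ?R = "\<lambda>\<omega>. \<integral>r. norm (indicat_real {s<..t} r *\<^sub>R ?H r \<omega>) \<partial>time T"
  let ?D = "\<lambda>\<omega>. B t \<omega> - B s \<omega>"
  have H: "square_integrable_process M T ?H"
    by (rule growth_bound_square_integrable[OF solution_square_integrable])
  note R = L2_norm_time_integral_le[OF H st]
  have D: "?D \<in> L2_space M \<and> L2_norm M ?D \<le> sqrt (real CARD('d)) * sqrt (t - s)"
  proof (cases "s = t")
    case True
    then show ?thesis by (simp add: L2_space_def L2_norm_def L2_inner_def)
  next
    case False
    with st have "distributed M lborel ?D (\<lambda>x. ennreal (\<Prod>i\<in>UNIV. normal_density 0 (sqrt (t - s)) (x $ i)))"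
      and pos: "sqrt (t - s) > 0"
      using B by (auto simp: brownian_motion_def)
    from gaussian_moments(1,2)[OF this] st show ?thesis
      by (simp add: L2_norm_def real_sqrt_mult)
  qed
  let ?E = "\<lambda>\<omega>. norm (?R \<omega>) + \<sigma> *\<^sub>R norm (?D \<omega>)"
  have E: "?E \<in> L2_space M"
    using R(1) D by (intro L2_space_add L2_space_scaleR L2_space_norm) auto
  have "L2_dist M (X s) (X t) \<le> L2_norm M ?E"
    unfolding L2_dist_def
  proof (rule L2_norm_mono_AE[OF E])
    show "(\<lambda>\<omega>. X s \<omega> - X t \<omega>) \<in> borel_measurable M"
      using st by (intro L2_spaceD(1) L2_space_diff solution_L2) auto
    have Fint: "AE \<omega> in M. integrable (time T) (\<lambda>r. lift_state_control M F (X r) (W r) \<omega>)"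
      using sol by (simp add: strong_solution_def set_integrable_time)
    have s: "s \<in> {0..T}" and t: "t \<in> {0..T}" using st by auto
    show "AE \<omega> in M. norm (X s \<omega> - X t \<omega>) \<le> norm (?E \<omega>)"
      using Fint square_integrable_process_AE_integrable[OF H]
        solution_forward_equation[OF s] solution_forward_equation[OF t]
    proof eventually_elim
      case (elim \<omega>)
      let ?F = "\<lambda>r. lift_state_control M F (X r) (W r) \<omega>"
      have "integral_upto T ?F t - integral_upto T ?F s
          = (\<integral>r. indicat_real {..t} r *\<^sub>R ?F r - indicat_real {..s} r *\<^sub>R ?F r \<partial>time T)"
        unfolding integral_upto_def using elim(1)
        by (intro Bochner_Integration.integral_diff[symmetric] integrable_time_indicator) auto
      also have "\<dots> = (\<integral>r. indicat_real {s<..t} r *\<^sub>R ?F r \<partial>time T)"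
        using st by (intro Bochner_Integration.integral_cong) (auto simp: indicator_def)
      finally have eq: "integral_upto T ?F t - integral_upto T ?F s = \<dots>" .
      have "norm (\<integral>r. indicat_real {s<..t} r *\<^sub>R ?F r \<partial>time T) \<le> ?R \<omega>"
      proof (rule order_trans[OF integral_norm_bound integral_mono])
        show "integrable (time T) (\<lambda>r. norm (indicat_real {s<..t} r *\<^sub>R ?F r))"
          by (intro integrable_norm integrable_time_indicator elim) simp
        show "integrable (time T) (\<lambda>r. norm (indicat_real {s<..t} r *\<^sub>R ?H r \<omega>))"
          by (intro integrable_norm integrable_time_indicator elim) simp
        fix r assume "r \<in> space (time T)"
        then have "r \<in> {0..T}" by (simp add: space_restrict_space)
        from lift_state_control_growth[OF F_growth solution_L2(1)[OF this], of _ \<omega>]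
        show "norm (indicat_real {s<..t} r *\<^sub>R ?F r) \<le> norm (indicat_real {s<..t} r *\<^sub>R ?H r \<omega>)"
          by (auto simp: indicator_def intro: order_trans[OF _ abs_ge_self])
      qed
      then have "norm (integral_upto T ?F t - integral_upto T ?F s) \<le> norm (?R \<omega>)"
        unfolding eq by (rule order_trans) simp
      moreover have "X s \<omega> - X t \<omega> = (integral_upto T ?F t - integral_upto T ?F s) + - (\<sigma> *\<^sub>R ?D \<omega>)"
        using elim(3,4) by (simp add: scaleR_diff_right)
      moreover have "norm (- (\<sigma> *\<^sub>R ?D \<omega>)) = \<sigma> * norm (?D \<omega>)"
        using \<sigma> by simp
      ultimately have "norm (X s \<omega> - X t \<omega>) \<le> ?E \<omega>"
        using norm_triangle_ineq[of "integral_upto T ?F t - integral_upto T ?F s" "- (\<sigma> *\<^sub>R ?D \<omega>)"]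
        by (simp del: norm_minus_cancel norm_scaleR)
      from order_trans[OF this abs_ge_self] show ?case by (simp only: real_norm_def)
    qed
  qed
  also have "\<dots> \<le> L2_norm M (\<lambda>\<omega>. norm (?R \<omega>)) + L2_norm M (\<lambda>\<omega>. \<sigma> *\<^sub>R norm (?D \<omega>))"
    using R(1) D by (intro L2_norm_triangle L2_space_scaleR L2_space_norm) auto
  also have "\<dots> = L2_norm M ?R + \<sigma> * L2_norm M ?D"
    using \<sigma> by (simp only: L2_norm_scaleR L2_norm_norm abs_of_nonneg)
  also have "\<dots> \<le> (sqrt (\<integral>r. L2_inner M (?H r) (?H r) \<partial>time T) + \<sigma> * sqrt (real CARD('d))) * sqrt (t - s)"
    using R(2) mult_left_mono[OF conjunct2[OF D] \<sigma>] by (simp add: algebra_simps)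
  finally show "L2_dist M (X s) (X t)
      \<le> (sqrt (\<integral>r. L2_inner M (?H r) (?H r) \<partial>time T) + \<sigma> * sqrt (real CARD('d))) * sqrt (t - s)" .
qed

lemma solution_lift_square_integrable:
  assumes f: "continuous_state_law_control f"
    and g: "\<And>x \<mu> u. \<mu> \<in> P2 \<Longrightarrow> norm (f x \<mu> u) \<le> K * (1 + norm x + norm u + sqrt (second_moment \<mu>))"
  shows "square_integrable_process M T (\<lambda>s. lift_state_control M f (X s) (W s))"
proof (rule square_integrable_process_bound[OF growth_bound_square_integrable[OF solution_square_integrable]])
  obtain C where "\<And>s t. 0 \<le> s \<Longrightarrow> s \<le> t \<Longrightarrow> t \<le> T \<Longrightarrow> L2_dist M (X s) (X t) \<le> C * sqrt (t - s)"
    using solution_time_continuity by blast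
  then show "(\<lambda>(t, \<omega>). lift_state_control M f (X t) (W t) \<omega>) \<in> borel_measurable (time T \<Otimes>\<^sub>M M)"
    by (intro lift_process_measurable[OF f T_pos solution_square_integrable solution_L2(1)]) auto
  fix t \<omega> assume "t \<in> {0..T}"
  from lift_state_control_growth[OF g solution_L2(1)[OF this], of _ \<omega>]
  show "norm (lift_state_control M f (X t) (W t) \<omega>) \<le> norm (growth_bound K (X t) (W t) \<omega>)"
    by (auto intro: order_trans[OF _ abs_ge_self])
qed

lemma solution_drift_square_integrable:
  "square_integrable_process M T (\<lambda>s. lift_state_control M F (X s) (W s))"
  "square_integrable_process M T (\<lambda>s. lift_state_control M G (X s) (W s))"
  using solution_lift_square_integrable[OF F_cont F_growth] solution_lift_square_integrable[OF G_cont G_growth]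
  by auto

lemma solution_terminal_L2: "lift_state M W0 (X T) \<in> L2_space M"
  using T_pos by (intro lift_state_L2[OF W0_cont W0_growth] solution_L2) auto

text \<open>
  The conditional form of the backward equation: \<open>W t\<close> is the orthogonal projection of terminal
  value plus remaining drift onto the random variables known at time \<open>t\<close>.
\<close>

lemma solution_backward_equation_weak:
  assumes t: "t \<in> {0..T}" and \<xi>: "\<xi> \<in> borel_measurable (\<F> t)" "\<xi> \<in> L2_space M"
  shows "L2_inner M (W t) \<xi> = L2_inner M
    (\<lambda>\<omega>. lift_state M W0 (X T) \<omega> + integral_from T (\<lambda>s. lift_state_control M G (X s) (W s) \<omega>) t) \<xi>"
proof -
  obtain I where I: "has_ito_integral M \<F> B t T Z I"
    and eq: "AE \<omega> in M. W t \<omega> = lift_state M W0 (X T) \<omega>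
        + integral_from T (\<lambda>s. lift_state_control M G (X s) (W s) \<omega>) t - I \<omega>"
    unfolding integral_from_eq_set_integral[OF t, symmetric]
    using sol t unfolding strong_solution_def by blast
  let ?N = "\<lambda>\<omega>. lift_state M W0 (X T) \<omega> + integral_from T (\<lambda>s. lift_state_control M G (X s) (W s) \<omega>) t"
  have N: "?N \<in> L2_space M"
    by (intro L2_space_add solution_terminal_L2 integral_from_square_integrable(2)[OF _ t]
        solution_lift_square_integrable G_cont G_growth)
  have IL: "I \<in> L2_space M" using I by (simp add: has_ito_integral_def)
  have "L2_inner M (W t) \<xi> = L2_inner M (\<lambda>\<omega>. ?N \<omega> - I \<omega>) \<xi>"
    using eq by (intro L2_inner_cong_AE L2_spaceD(1) solution_L2 t L2_space_diff N IL \<xi>) auto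
  also have "\<dots> = L2_inner M ?N \<xi> - L2_inner M I \<xi>"
    by (rule L2_inner_diff_left[OF N IL \<xi>(2)])
  also have "L2_inner M I \<xi> = 0"
    by (rule ito_integral_orthogonal[OF filt B t I \<xi>])
  finally show ?thesis by simp
qed

end

section \<open>The difference of two solutions\<close>

context
  fixes \<sigma> \<F> B X0 X W Z Y0 Y V Z'
  assumes filt: "filtration_upto M T \<F>" and B: "brownian_motion M T \<F> B" and \<sigma>: "\<sigma> \<ge> 0"
    and X0: "X0 \<in> L2_space M" "X0 \<in> borel_measurable (\<F> 0)"
    and Y0: "Y0 \<in> L2_space M" "Y0 \<in> borel_measurable (\<F> 0)"
    and solX: "strong_solution M T W0 F G \<sigma> \<F> B X0 X W Z"
    and solY: "strong_solution M T W0 F G \<sigma> \<F> B Y0 Y V Z'"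
begin

abbreviation (input) "dX \<equiv> \<lambda>t \<omega>. X t \<omega> - Y t \<omega>"
abbreviation (input) "dW \<equiv> \<lambda>t \<omega>. W t \<omega> - V t \<omega>"
abbreviation (input) "dF \<equiv> \<lambda>t \<omega>. lift_state_control M F (X t) (W t) \<omega> - lift_state_control M F (Y t) (V t) \<omega>"
abbreviation (input) "dG \<equiv> \<lambda>t \<omega>. lift_state_control M G (X t) (W t) \<omega> - lift_state_control M G (Y t) (V t) \<omega>"
abbreviation (input) "dW0 \<equiv> \<lambda>\<omega>. lift_state M W0 (X T) \<omega> - lift_state M W0 (Y T) \<omega>"
abbreviation (input) "dX0 \<equiv> \<lambda>\<omega>. X0 \<omega> - Y0 \<omega>"

lemmas factsX = filt B \<sigma> solX
lemmas factsY = filt B \<sigma> solY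

lemma difference_square_integrable:
  "square_integrable_process M T dX" "square_integrable_process M T dW"
  "square_integrable_process M T dF" "square_integrable_process M T dG"
  by (intro square_integrable_process_diff
      solution_square_integrable[OF factsX] solution_square_integrable[OF factsY]
      solution_drift_square_integrable[OF factsX] solution_drift_square_integrable[OF factsY])+

lemma difference_L2:
  "t \<in> {0..T} \<Longrightarrow> dX t \<in> L2_space M" "t \<in> {0..T} \<Longrightarrow> dW t \<in> L2_space M"
  "t \<in> {0..T} \<Longrightarrow> dF t \<in> L2_space M" "t \<in> {0..T} \<Longrightarrow> dG t \<in> L2_space M"
  "dW0 \<in> L2_space M" "dX0 \<in> L2_space M"
  by (intro L2_space_diff X0 Y0 lift_state_control_L2[OF F_cont F_growth] lift_state_control_L2[OF G_cont G_growth]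
      solution_L2[OF factsX] solution_L2[OF factsY]
      solution_terminal_L2[OF factsX] solution_terminal_L2[OF factsY]; assumption)+

lemma difference_adapted:
  assumes t: "t \<in> {0..T}"
  shows "dW t \<in> borel_measurable (\<F> t)" "dF t \<in> borel_measurable (\<F> t)" "dG t \<in> borel_measurable (\<F> t)"
  by (intro borel_measurable_diff lift_state_control_measurable F_cont G_cont
      solution_L2[OF factsX t] solution_L2[OF factsY t]
      solution_adapted[OF factsX t] solution_adapted[OF factsY t])+

lemma difference_forward_equation:
  assumes t: "t \<in> {0..T}"
  shows "AE \<omega> in M. dX t \<omega> = dX0 \<omega> - integral_upto T (\<lambda>s. dF s \<omega>) t"
  using solution_forward_equation[OF factsX t] solution_forward_equation[OF factsY t]
    square_integrable_process_AE_integrable[OF solution_drift_square_integrable(1)[OF factsX]]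
    square_integrable_process_AE_integrable[OF solution_drift_square_integrable(1)[OF factsY]]
  by eventually_elim (simp add: integral_upto_diff)

lemma difference_backward_equation_weak:
  assumes t: "t \<in> {0..T}" and \<xi>: "\<xi> \<in> borel_measurable (\<F> t)" "\<xi> \<in> L2_space M"
  shows "L2_inner M (dW t) \<xi> = L2_inner M (\<lambda>\<omega>. dW0 \<omega> + integral_from T (\<lambda>s. dG s \<omega>) t) \<xi>"
proof -
  let ?NX = "\<lambda>\<omega>. lift_state M W0 (X T) \<omega> + integral_from T (\<lambda>s. lift_state_control M G (X s) (W s) \<omega>) t"
  let ?NY = "\<lambda>\<omega>. lift_state M W0 (Y T) \<omega> + integral_from T (\<lambda>s. lift_state_control M G (Y s) (V s) \<omega>) t"
  have G: "square_integrable_process M T (\<lambda>s. lift_state_control M G (X s) (W s))"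
    "square_integrable_process M T (\<lambda>s. lift_state_control M G (Y s) (V s))"
    by (rule solution_drift_square_integrable(2)[OF factsX] solution_drift_square_integrable(2)[OF factsY])+
  have N: "?NX \<in> L2_space M" "?NY \<in> L2_space M"
    by (intro L2_space_add solution_terminal_L2[OF factsX] solution_terminal_L2[OF factsY]
        integral_from_square_integrable(2) G t)+
  have "L2_inner M (dW t) \<xi> = L2_inner M ?NX \<xi> - L2_inner M ?NY \<xi>"
    using L2_inner_diff_left[OF solution_L2(2)[OF factsX t] solution_L2(2)[OF factsY t] \<xi>(2)]
      solution_backward_equation_weak[OF factsX t \<xi>] solution_backward_equation_weak[OF factsY t \<xi>] by simp
  also have "\<dots> = L2_inner M (\<lambda>\<omega>. ?NX \<omega> - ?NY \<omega>) \<xi>"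
    by (rule L2_inner_diff_left[OF N \<xi>(2), symmetric])
  also have "\<dots> = L2_inner M (\<lambda>\<omega>. dW0 \<omega> + integral_from T (\<lambda>s. dG s \<omega>) t) \<xi>"
  proof (rule L2_inner_cong_AE)
    show "AE \<omega> in M. ?NX \<omega> - ?NY \<omega> = dW0 \<omega> + integral_from T (\<lambda>s. dG s \<omega>) t"
      using square_integrable_process_AE_integrable[OF G(1)] square_integrable_process_AE_integrable[OF G(2)]
      by eventually_elim (simp add: integral_from_diff)
  qed (use \<xi> N difference_L2(5) integral_from_square_integrable(2)[OF difference_square_integrable(4) t]
        in \<open>auto intro!: L2_spaceD(1) L2_space_add L2_space_diff\<close>)
  finally show ?thesis .
qed

text \<open>
  The drift difference \<open>dF s\<close> and the initial difference are known at times \<open>s\<close> and \<open>0\<close>, so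
  the anticipating process of \<open>duality_identity\<close> may be replaced by \<open>dW\<close> in the inner products.
\<close>

lemma difference_duality:
  "L2_inner M (dW 0) dX0 = L2_inner M dW0 (dX T)
     + (\<integral>s. L2_inner M (dG s) (dX s) + L2_inner M (dF s) (dW s) \<partial>time T)"
proof -
  have 0: "0 \<in> {0..T}" "T \<in> {0..T}" "0 \<le> T" using T_pos by auto
  let ?X = "\<lambda>s \<omega>. dX0 \<omega> - integral_upto T (\<lambda>r. dF r \<omega>) s"
  let ?N = "\<lambda>s \<omega>. dW0 \<omega> + integral_from T (\<lambda>r. dG r \<omega>) s"
  have X: "?X s \<in> L2_space M" if "s \<in> {0..T}" for s
    by (intro L2_space_diff difference_L2(6) X0 Y0 integral_upto_square_integrable(2)[OF difference_square_integrable(3)] that)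
  have eqX: "L2_inner M \<eta> (?X s) = L2_inner M \<eta> (dX s)" if s: "s \<in> {0..T}" and \<eta>: "\<eta> \<in> L2_space M" for s \<eta>
    using difference_forward_equation[OF s]
    by (intro L2_inner_cong_AE L2_spaceD(1)[OF \<eta>] L2_spaceD(1)[OF X[OF s]] L2_spaceD(1)[OF difference_L2(1)[OF s]])
       (auto elim: eventually_mono)
  have eqN: "L2_inner M (dF s) (?N s) = L2_inner M (dF s) (dW s)" if s: "s \<in> {0..T}" for s
    using difference_backward_equation_weak[OF s difference_adapted(2)[OF s] difference_L2(3)[OF s]]
    by (simp add: L2_inner_commute[of M "dF s"])
  have "L2_inner M (dW 0) dX0 = L2_inner M (?N 0) dX0"
    by (rule difference_backward_equation_weak[OF 0(1) borel_measurable_diff[OF X0(2) Y0(2)] difference_L2(6)])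
  also have "\<dots> = L2_inner M dW0 (?X T) + (\<integral>s. L2_inner M (dG s) (?X s) + L2_inner M (dF s) (?N s) \<partial>time T)"
    by (rule duality_identity[OF difference_square_integrable(3,4) difference_L2(6,5) 0(3)])
  also have "L2_inner M dW0 (?X T) = L2_inner M dW0 (dX T)"
    by (rule eqX[OF 0(2) difference_L2(5)])
  also have "(\<integral>s. L2_inner M (dG s) (?X s) + L2_inner M (dF s) (?N s) \<partial>time T)
      = (\<integral>s. L2_inner M (dG s) (dX s) + L2_inner M (dF s) (dW s) \<partial>time T)"
    by (intro Bochner_Integration.integral_cong refl) (simp add: space_restrict_space eqX eqN difference_L2)
  finally show ?thesis .
qed

text \<open>
  A projection does not increase the norm, so \<open>\<parallel>dW t\<parallel>\<^sup>2\<close> is at most the energy of the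
  anticipating process. The discarded term is what the Ito formula would write as the integral of
  \<open>\<parallel>dZ\<parallel>\<^sup>2\<close>.
\<close>

lemma difference_backward_energy:
  assumes t: "t \<in> {0..T}"
  shows "L2_inner M (dW t) (dW t)
    \<le> L2_inner M dW0 dW0 + 2 * (\<integral>s. indicat_real {t..} s * L2_inner M (dG s) (dW s) \<partial>time T)"
proof -
  let ?N = "\<lambda>s \<omega>. dW0 \<omega> + integral_from T (\<lambda>r. dG r \<omega>) s"
  have N: "?N t \<in> L2_space M"
    by (intro L2_space_add difference_L2(5) integral_from_square_integrable(2)[OF difference_square_integrable(4) t])
  have eqN: "L2_inner M (dG s) (?N s) = L2_inner M (dG s) (dW s)" if s: "s \<in> {0..T}" for s
    using difference_backward_equation_weak[OF s difference_adapted(3)[OF s] difference_L2(4)[OF s]]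
    by (simp add: L2_inner_commute[of M "dG s"])
  have "L2_inner M (dW t) (dW t) = L2_inner M (?N t) (dW t)"
    by (rule difference_backward_equation_weak[OF t difference_adapted(1)[OF t] difference_L2(2)[OF t]])
  also have "\<dots> \<le> L2_norm M (?N t) * L2_norm M (dW t)"
    using L2_Cauchy_Schwarz[OF N difference_L2(2)[OF t]] by linarith
  finally have "L2_norm M (dW t) * L2_norm M (dW t) \<le> L2_norm M (?N t) * L2_norm M (dW t)"
    by (simp add: L2_norm_squared[symmetric] power2_eq_square)
  then have "L2_norm M (dW t) \<le> L2_norm M (?N t)"
    using L2_norm_nonneg[of M "dW t"] L2_norm_nonneg[of M "?N t"] by (cases "L2_norm M (dW t) = 0") auto
  then have "L2_inner M (dW t) (dW t) \<le> L2_inner M (?N t) (?N t)"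
    unfolding L2_norm_squared[symmetric] by (intro power_mono L2_norm_nonneg)
  also have "\<dots> = L2_inner M dW0 dW0 + 2 * (\<integral>s. indicat_real {t..} s * L2_inner M (dG s) (?N s) \<partial>time T)"
    by (rule backward_energy_identity[OF difference_square_integrable(4) difference_L2(5) t])
  also have "(\<integral>s. indicat_real {t..} s * L2_inner M (dG s) (?N s) \<partial>time T)
      = (\<integral>s. indicat_real {t..} s * L2_inner M (dG s) (dW s) \<partial>time T)"
    by (intro Bochner_Integration.integral_cong refl) (simp add: space_restrict_space eqN)
  finally show ?thesis .
qed

lemma difference_forward_energy:
  assumes t: "t \<in> {0..T}"
  shows "L2_inner M (dX t) (dX t)
    = L2_inner M dX0 dX0 - 2 * (\<integral>s. indicat_real {..t} s * L2_inner M (dF s) (dX s) \<partial>time T)"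
proof -
  let ?X = "\<lambda>s \<omega>. dX0 \<omega> - integral_upto T (\<lambda>r. dF r \<omega>) s"
  have X: "?X s \<in> borel_measurable M" "AE \<omega> in M. ?X s \<omega> = dX s \<omega>" if s: "s \<in> {0..T}" for s
  proof -
    show "?X s \<in> borel_measurable M"
      by (intro L2_spaceD(1) L2_space_diff difference_L2(6) X0 Y0
          integral_upto_square_integrable(2)[OF difference_square_integrable(3)] s)
    show "AE \<omega> in M. ?X s \<omega> = dX s \<omega>"
      using difference_forward_equation[OF s] by eventually_elim simp
  qed
  have "L2_inner M (dX t) (dX t) = L2_inner M (?X t) (?X t)"
    using X[OF t] L2_spaceD(1)[OF difference_L2(1)[OF t]]
    by (intro L2_inner_cong_AE) (auto elim: eventually_mono)
  also have "\<dots> = L2_inner M dX0 dX0 - 2 * (\<integral>s. indicat_real {..t} s * L2_inner M (dF s) (?X s) \<partial>time T)"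
    by (rule forward_energy_identity[OF difference_square_integrable(3) difference_L2(6) t])
  also have "(\<integral>s. indicat_real {..t} s * L2_inner M (dF s) (?X s) \<partial>time T)
      = (\<integral>s. indicat_real {..t} s * L2_inner M (dF s) (dX s) \<partial>time T)"
  proof (intro Bochner_Integration.integral_cong refl)
    fix s assume "s \<in> space (time T)"
    then have s: "s \<in> {0..T}" by (simp add: space_restrict_space)
    have "L2_inner M (dF s) (?X s) = L2_inner M (dF s) (dX s)"
      using X[OF s] L2_spaceD(1)[OF difference_L2(1)[OF s]] L2_spaceD(1)[OF difference_L2(3)[OF s]]
      by (intro L2_inner_cong_AE) auto
    then show "indicat_real {..t} s * L2_inner M (dF s) (?X s) = indicat_real {..t} s * L2_inner M (dF s) (dX s)"
      by simp
  qed
  finally show ?thesis .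
qed

end

end

section \<open>From energy estimates to rates\<close>

lemma integral_time_exp_le:
  assumes "0 < k" "t \<in> {0..T}"
  shows "(\<integral>s. indicat_real {..t} s * exp (k * s) \<partial>time T) \<le> exp (k * t) / k"
    and "integrable (time T) (\<lambda>s. indicat_real {..t} s * exp (k * s))"
proof -
  have "has_bochner_integral lborel (\<lambda>s. exp (k * s) * indicator {0..t} s) (exp (k * t) / k - exp (k * 0) / k)"
    using assms
    by (intro has_bochner_integral_FTC_Icc_real[where F = "\<lambda>s. exp (k * s) / k"])
       (auto intro!: derivative_eq_intros)
  moreover have eq: "indicat_real {0..T} s *\<^sub>R (indicat_real {..t} s * exp (k * s)) = exp (k * s) * indicator {0..t} s" for s
    using assms by (auto simp: indicator_def)
  ultimately show "(\<integral>s. indicat_real {..t} s * exp (k * s) \<partial>time T) \<le> exp (k * t) / k"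
    and "integrable (time T) (\<lambda>s. indicat_real {..t} s * exp (k * s))"
    using integral_restrict_space[of "{0..T}" lborel "\<lambda>s. indicat_real {..t} s * exp (k * s)"]
      integrable_restrict_space[of "{0..T}" lborel "\<lambda>s. indicat_real {..t} s * exp (k * s)"] \<open>0 < k\<close>
    unfolding eq by (auto simp: has_bochner_integral_iff)
qed

text \<open>
  The supremum \<open>S\<close> of \<open>exp (- 2 k t) x t\<close> is finite, because \<open>x\<close> is bounded by its own
  integral. In the weighted norm the Volterra operator has norm at most \<open>1 / 2\<close>, hence
  \<open>S \<le> c + S / 2\<close>.
\<close>

lemma Gronwall_integral:
  fixes x :: "real \<Rightarrow> real"
  assumes x: "integrable (time T) x" and nonneg: "\<And>t. t \<in> {0..T} \<Longrightarrow> 0 \<le> x t"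
    and "0 < k" "0 \<le> c"
    and le: "\<And>t. t \<in> {0..T} \<Longrightarrow> x t \<le> c + k * (\<integral>s. indicat_real {..t} s * x s \<partial>time T)"
    and t: "t \<in> {0..T}"
  shows "x t \<le> 2 * c * exp (2 * k * T)"
proof -
  define z where "z t = exp (- (2 * k * t)) * x t" for t
  define S where "S = (SUP t\<in>{0..T}. z t)"
  have ind: "integrable (time T) (\<lambda>s. indicat_real {..t} s * x s)" for t
    using integrable_time_indicator[OF x, of "{..t}"] by simp
  have bdd: "bdd_above (z ` {0..T})"
  proof (rule bdd_aboveI2)
    fix t assume t: "t \<in> {0..T}"
    have *: "(\<integral>s. indicat_real {..t} s * x s \<partial>time T) \<le> (\<integral>s. x s \<partial>time T)"
      by (intro integral_mono ind x) (auto simp: indicator_def nonneg space_restrict_space)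
    then have "x t \<le> c + k * (\<integral>s. x s \<partial>time T)"
      using le[OF t] mult_left_mono[OF *, of k] \<open>0 < k\<close> by linarith
    moreover have "z t \<le> x t"
      using t nonneg[OF t] \<open>0 < k\<close> by (simp add: z_def mult_left_le_one_le)
    ultimately show "z t \<le> c + k * (\<integral>s. x s \<partial>time T)" by simp
  qed
  have zS: "z s \<le> S" if "s \<in> {0..T}" for s
    unfolding S_def by (rule cSUP_upper[OF that bdd])
  have xS: "x s \<le> S * exp (2 * k * s)" if "s \<in> {0..T}" for s
  proof -
    have "x s = z s * exp (2 * k * s)"
      by (simp add: z_def exp_minus field_simps)
    then show ?thesis using zS[OF that] by simp
  qed
  have S0: "0 \<le> S"
    using zS[OF t] nonneg[OF t] by (smt (verit) z_def exp_ge_zero mult_nonneg_nonneg)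
  have "S \<le> c + S / 2"
    unfolding S_def
  proof (rule cSUP_least)
    fix t assume t: "t \<in> {0..T}"
    have k2: "0 < 2 * k" using \<open>0 < k\<close> by simp
    have "(\<integral>s. indicat_real {..t} s * x s \<partial>time T)
        \<le> (\<integral>s. S * (indicat_real {..t} s * exp (2 * k * s)) \<partial>time T)"
      using xS by (intro integral_mono ind integrable_mult_right integral_time_exp_le[OF k2 t])
        (auto simp: indicator_def space_restrict_space)
    also have "\<dots> \<le> S * (exp (2 * k * t) / (2 * k))"
      using mult_left_mono[OF integral_time_exp_le(1)[OF k2 t] S0] by simp
    finally have *: "(\<integral>s. indicat_real {..t} s * x s \<partial>time T) \<le> S * (exp (2 * k * t) / (2 * k))" .
    have "x t \<le> c + k * (S * (exp (2 * k * t) / (2 * k)))"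
      using le[OF t] mult_left_mono[OF *, of k] \<open>0 < k\<close> by linarith
    also have "\<dots> = c + S / 2 * exp (2 * k * t)" using \<open>0 < k\<close> by simp
    finally have "z t \<le> exp (- (2 * k * t)) * (c + S / 2 * exp (2 * k * t))"
      unfolding z_def by (intro mult_left_mono) auto
    also have "\<dots> = exp (- (2 * k * t)) * c + S / 2"
      by (simp add: distrib_left exp_minus)
    also have "\<dots> \<le> c + S / 2"
      using t \<open>0 \<le> c\<close> \<open>0 < k\<close> by (simp add: mult_left_le_one_le)
    finally show "z t \<le> c + (SUP t\<in>{0..T}. z t) / 2" unfolding S_def .
  qed (use t in auto)
  then have "S \<le> 2 * c" by simp
  have "x t \<le> S * exp (2 * k * t)" by (rule xS[OF t])
  also have "\<dots> \<le> 2 * c * exp (2 * k * T)"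
    using \<open>S \<le> 2 * c\<close> t \<open>0 < k\<close> \<open>0 \<le> c\<close> by (intro mult_mono) auto
  finally show ?thesis .
qed

lemma powr_subadditive:
  fixes u v :: real
  assumes "0 \<le> u" "0 \<le> v" "0 < \<gamma>" "\<gamma> \<le> 1"
  shows "(u + v) powr \<gamma> \<le> u powr \<gamma> + v powr \<gamma>"
proof (cases "u + v = 0")
  case True
  then show ?thesis by simp
next
  case False
  then have pos: "u + v > 0" using assms by simp
  have le: "r \<le> r powr \<gamma>" if "0 \<le> r" "r \<le> 1" for r :: real
    using powr_mono'[of \<gamma> 1 r] that assms by (cases "r = 0") auto
  have "1 = u / (u + v) + v / (u + v)" using pos by (simp add: add_divide_distrib[symmetric])
  also have "\<dots> \<le> (u / (u + v)) powr \<gamma> + (v / (u + v)) powr \<gamma>"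
    using assms pos by (intro add_mono le) auto
  also have "\<dots> = (u powr \<gamma> + v powr \<gamma>) / (u + v) powr \<gamma>"
    using assms pos by (simp add: powr_divide add_divide_distrib)
  finally show ?thesis using pos by (simp add: le_divide_eq)
qed

text \<open>
  A form of Jensen's inequality for the concave function \<open>v \<mapsto> v powr \<gamma>\<close>. It follows by integrating
  \<open>v powr \<gamma> \<le> l powr \<gamma> + l powr (\<gamma> - 1) * v\<close> with \<open>l = p\<close>; this choice of \<open>l\<close> balances the two
  terms. If \<open>p = 0\<close> the function \<open>y\<close> vanishes almost everywhere.
\<close>

lemma integral_powr_le:
  fixes y :: "real \<Rightarrow> real"
  assumes y: "integrable (time T) y" and nonneg: "\<And>t. t \<in> {0..T} \<Longrightarrow> 0 \<le> y t"
    and \<gamma>: "0 < \<gamma>" "\<gamma> \<le> 1" and "0 \<le> T" "0 < \<alpha>" "0 \<le> p"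
    and le: "\<alpha> * (\<integral>s. y s \<partial>time T) \<le> p"
  shows "integrable (time T) (\<lambda>s. y s powr \<gamma>)"
    and "(\<integral>s. y s powr \<gamma> \<partial>time T) \<le> (T + 1 / \<alpha>) * p powr \<gamma>"
proof -
  interpret L: finite_measure "time T" by (rule finite_measure_time)
  have [measurable]: "y \<in> borel_measurable (time T)" using y by simp
  have young: "v powr \<gamma> \<le> l powr \<gamma> + l powr (\<gamma> - 1) * v" if "0 \<le> v" "0 < l" for v l :: real
  proof (cases "v \<le> l")
    case True
    then have "v powr \<gamma> \<le> l powr \<gamma>" using that \<gamma> by (intro powr_mono2) auto
    then show ?thesis using that by (smt (verit) mult_nonneg_nonneg powr_ge_zero)
  next
    case False
    then have "v powr \<gamma> = v powr (\<gamma> - 1) * v"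
      using that powr_add[of v "\<gamma> - 1" 1] by simp
    also have "\<dots> \<le> l powr (\<gamma> - 1) * v"
      using that False \<gamma> by (intro mult_right_mono powr_mono2') auto
    finally show ?thesis by (smt (verit) powr_ge_zero)
  qed
  show int: "integrable (time T) (\<lambda>s. y s powr \<gamma>)"
  proof (rule Bochner_Integration.integrable_bound)
    show "integrable (time T) (\<lambda>s. 1 + y s)" using y by simp
    show "AE s in time T. norm (y s powr \<gamma>) \<le> norm (1 + y s)"
      using young[of _ 1] by (intro AE_I2) (auto simp: space_restrict_space nonneg)
  qed simp
  show "(\<integral>s. y s powr \<gamma> \<partial>time T) \<le> (T + 1 / \<alpha>) * p powr \<gamma>"
  proof (cases "p = 0")
    case True
    have "0 \<le> (\<integral>s. y s \<partial>time T)"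
      by (intro integral_nonneg_AE AE_I2) (auto simp: space_restrict_space nonneg)
    moreover have "(\<integral>s. y s \<partial>time T) \<le> 0" using le True \<open>0 < \<alpha>\<close> by (simp add: mult_le_0_iff)
    ultimately have "(\<integral>s. y s \<partial>time T) = 0" by simp
    then have "AE s in time T. y s = 0"
      using integral_nonneg_eq_0_iff_AE[OF y AE_I2] by (auto simp: space_restrict_space nonneg)
    then have "(\<integral>s. y s powr \<gamma> \<partial>time T) = (\<integral>s. 0 \<partial>time T)"
      by (intro integral_cong_AE) (auto elim: eventually_mono)
    then show ?thesis using True by simp
  next
    case False
    with \<open>0 \<le> p\<close> have p: "0 < p" by simp
    have "(\<integral>s. y s powr \<gamma> \<partial>time T) \<le> (\<integral>s. p powr \<gamma> + p powr (\<gamma> - 1) * y s \<partial>time T)"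
      using y int by (intro integral_mono) (auto intro!: young simp: p nonneg space_restrict_space)
    also have "\<dots> = T * p powr \<gamma> + p powr (\<gamma> - 1) * (\<integral>s. y s \<partial>time T)"
      using y measure_time[OF \<open>0 \<le> T\<close>] by simp
    also have "\<dots> \<le> T * p powr \<gamma> + p powr (\<gamma> - 1) * (p / \<alpha>)"
      using le \<open>0 < \<alpha>\<close> by (intro add_left_mono mult_left_mono) (auto simp: field_simps)
    also have "p powr (\<gamma> - 1) * (p / \<alpha>) = p powr \<gamma> / \<alpha>"
      using p powr_add[of p "\<gamma> - 1" 1] by simp
    finally show ?thesis by (simp add: algebra_simps)
  qed
qed

text \<open>
  The exponents \<open>\<eta> = \<gamma>\<^sup>2 / (2 - \<gamma>\<^sup>2)\<close> and \<open>\<theta> = \<gamma> / (2 - \<gamma>\<^sup>2)\<close> are determined by the critical terms: if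
  \<open>b\<close> is of order \<open>a powr \<eta>\<close> then \<open>(a b) powr \<gamma>\<^sup>2\<close> is of order \<open>b\<^sup>2\<close> exactly when \<open>(1 + \<eta>) \<gamma>\<^sup>2 = 2 \<eta>\<close>, and
  then \<open>(a b) powr \<gamma>\<close> has order \<open>a powr (2 \<theta>)\<close>. For small \<open>a\<close> no other term has a smaller exponent; for
  \<open>a \<ge> 1\<close> everything is dominated by \<open>a\<^sup>2\<close>.
\<close>

lemma rate_bound:
  fixes a b R :: real
  assumes \<gamma>: "0 < \<gamma>" "\<gamma> \<le> 1" and a: "0 \<le> a" and b: "0 \<le> b" and R: "1 \<le> R"
  defines "m \<equiv> max a (a powr (\<gamma>\<^sup>2 / (2 - \<gamma>\<^sup>2)))" and "m' \<equiv> max a (a powr (\<gamma> / (2 - \<gamma>\<^sup>2)))"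
  assumes le: "b \<le> R * m"
  shows "a\<^sup>2 + a powr (2 * \<gamma>) + a * b + (a * b) powr \<gamma> + (a * b) powr (\<gamma>\<^sup>2) \<le> 5 * R * m\<^sup>2"
    and "a\<^sup>2 + a * b + (a * b) powr \<gamma> \<le> 3 * R * m'\<^sup>2"
proof -
  have \<gamma>2: "0 < \<gamma>\<^sup>2" "\<gamma>\<^sup>2 \<le> 1" "\<gamma>\<^sup>2 \<le> \<gamma>"
    using \<gamma> power_le_one[of \<gamma> 2] by (auto simp: power2_eq_square mult_left_le)
  have d: "1 \<le> 2 - \<gamma>\<^sup>2" using \<gamma>2 by simp
  define u where "u = a * m"
  have m0: "0 \<le> m" "a \<le> m" "0 \<le> m'" "a \<le> m'" using a by (auto simp: m_def m'_def)
  have u0: "0 \<le> u" using a m0 by (simp add: u_def)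
  have ab: "a * b \<le> R * u" using mult_left_mono[OF le a] by (simp add: u_def ac_simps)
  have powr: "(a * b) powr e \<le> R * u powr e" if "0 < e" "e \<le> 1" for e
  proof -
    have "(a * b) powr e \<le> (R * u) powr e" using ab a b that by (intro powr_mono2) auto
    also have "\<dots> = R powr e * u powr e" using R u0 by (simp add: powr_mult)
    also have "\<dots> \<le> R * u powr e"
      using R that powr_mono[of e 1 R] by (intro mult_right_mono) auto
    finally show ?thesis .
  qed
  have key: "a\<^sup>2 \<le> m\<^sup>2 \<and> a powr (2 * \<gamma>) \<le> m\<^sup>2 \<and> u \<le> m\<^sup>2 \<and> u powr \<gamma> \<le> m\<^sup>2 \<and> u powr (\<gamma>\<^sup>2) \<le> m\<^sup>2
      \<and> a\<^sup>2 \<le> m'\<^sup>2 \<and> u \<le> m'\<^sup>2 \<and> u powr \<gamma> \<le> m'\<^sup>2"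
  proof -
    consider "a = 0" | "0 < a" "a \<le> 1" | "1 < a" using a by linarith
    then show ?thesis
    proof cases
      case 1
      then show ?thesis by (simp add: u_def m_def m'_def)
    next
      case 2
      define \<eta> where "\<eta> = \<gamma>\<^sup>2 / (2 - \<gamma>\<^sup>2)"
      define \<theta> where "\<theta> = \<gamma> / (2 - \<gamma>\<^sup>2)"
      have "\<theta> * \<gamma> = \<eta>" by (simp add: \<eta>_def \<theta>_def power2_eq_square)
      have "\<eta> \<le> \<gamma>\<^sup>2 / 1" unfolding \<eta>_def using d \<gamma>2 by (intro divide_left_mono) auto
      have "\<theta> \<le> \<gamma> / 1" unfolding \<theta>_def using d \<gamma> by (intro divide_left_mono) auto
      have \<eta>: "0 < \<eta>" "\<eta> \<le> \<gamma>" "\<eta> \<le> 1" using \<open>\<eta> \<le> \<gamma>\<^sup>2 / 1\<close> \<gamma>2 d by (auto simp: \<eta>_def)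
      have \<theta>: "0 < \<theta>" "\<theta> \<le> 1" using \<open>\<theta> \<le> \<gamma> / 1\<close> \<gamma> d by (auto simp: \<theta>_def)
      have "1 + \<eta> = 2 / (2 - \<gamma>\<^sup>2)" using d by (simp add: \<eta>_def field_simps)
      then have e\<gamma>: "(1 + \<eta>) * \<gamma> = 2 * \<theta>" by (simp add: \<theta>_def)
      then have e\<gamma>2: "(1 + \<eta>) * \<gamma>\<^sup>2 = 2 * \<eta>"
        using \<open>\<theta> * \<gamma> = \<eta>\<close> by (simp add: power2_eq_square flip: mult.assoc)
      have \<theta>le: "2 * \<theta> \<le> 1 + \<eta>" using e\<gamma> \<gamma> \<eta> by (metis mult_left_le add_nonneg_nonneg less_imp_le zero_le_one)
      have \<eta>\<theta>: "\<eta> \<le> \<theta>" using \<open>\<theta> * \<gamma> = \<eta>\<close> \<theta> \<gamma> by (metis mult_left_le less_imp_le)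
      have mono: "a powr e \<le> a powr e'" if "e' \<le> e" for e e' :: real
        using powr_mono'[OF that] 2 by simp
      have "a \<le> a powr \<eta>" "a \<le> a powr \<theta>" using mono[of \<eta> 1] mono[of \<theta> 1] \<eta> \<theta> 2 by auto
      then have m: "m = a powr \<eta>" "m' = a powr \<theta>"
        by (auto simp: m_def m'_def \<eta>_def \<theta>_def)
      have sq: "a\<^sup>2 = a powr 2" "m\<^sup>2 = a powr (2 * \<eta>)" "m'\<^sup>2 = a powr (2 * \<theta>)"
        using 2 by (simp_all add: m powr_power mult.commute)
      have u: "u = a powr (1 + \<eta>)" using 2 by (simp add: u_def m powr_add)
      have u\<gamma>: "u powr \<gamma> = a powr (2 * \<theta>)" "u powr (\<gamma>\<^sup>2) = a powr (2 * \<eta>)"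
        unfolding u powr_powr e\<gamma> e\<gamma>2 by auto
      show ?thesis
        unfolding u\<gamma> unfolding u sq using \<eta> \<theta> \<theta>le \<eta>\<theta> by (intro conjI mono) auto
    next
      case 3
      have "a powr e \<le> a" if "e \<le> 1" for e using 3 that powr_mono[of e 1 a] by simp
      moreover have "\<gamma>\<^sup>2 / (2 - \<gamma>\<^sup>2) \<le> 1" "\<gamma> / (2 - \<gamma>\<^sup>2) \<le> 1" using \<gamma> \<gamma>2 d by auto
      ultimately have m: "m = a" "m' = a" by (auto simp: m_def m'_def max_def intro: antisym)
      have u: "u = a powr 2" "a\<^sup>2 = a powr 2" using 3 by (simp_all add: u_def m power2_eq_square)
      show ?thesis
        unfolding m u powr_powr
        using 3 \<gamma> \<gamma>2 powr_mono[of "2 * \<gamma>" 2 a] powr_mono[of "2 * \<gamma>\<^sup>2" 2 a] by simp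
    qed
  qed
  have Rm: "v \<le> R * z\<^sup>2" if "v \<le> z\<^sup>2" for v z :: real
    using that R mult_right_mono[of 1 R "z\<^sup>2"] by simp
  have Ru: "R * v \<le> R * z\<^sup>2" if "v \<le> z\<^sup>2" for v z :: real
    using that R by (intro mult_left_mono) auto
  show "a\<^sup>2 + a powr (2 * \<gamma>) + a * b + (a * b) powr \<gamma> + (a * b) powr (\<gamma>\<^sup>2) \<le> 5 * R * m\<^sup>2"
    using key Rm[of "a\<^sup>2" m] Rm[of "a powr (2 * \<gamma>)" m] Ru[of u m] Ru[of "u powr \<gamma>" m] Ru[of "u powr (\<gamma>\<^sup>2)" m]
      ab powr[OF \<gamma>] powr[OF \<gamma>2(1,2)] by linarith
  show "a\<^sup>2 + a * b + (a * b) powr \<gamma> \<le> 3 * R * m'\<^sup>2"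
    using key Rm[of "a\<^sup>2" m'] Ru[of u m'] Ru[of "u powr \<gamma>" m'] ab powr[OF \<gamma>] by linarith
qed

text \<open>
  Apply \<open>rate_bound\<close> with the unknown ratio \<open>R = b / m\<close>, which may be taken to exceed \<open>1\<close>. The
  right-hand side is then only linear in \<open>R\<close>, while the left-hand side is \<open>R\<^sup>2 m\<^sup>2\<close>, so \<open>R \<le> 5 K\<close>.
\<close>

lemma self_improving_rate:
  fixes a b K :: real
  assumes \<gamma>: "0 < \<gamma>" "\<gamma> \<le> 1" and a: "0 \<le> a" and b: "0 \<le> b" and K: "1 \<le> K"
  defines "m \<equiv> max a (a powr (\<gamma>\<^sup>2 / (2 - \<gamma>\<^sup>2)))"
  assumes le: "b\<^sup>2 \<le> K * (a\<^sup>2 + a powr (2 * \<gamma>) + a * b + (a * b) powr \<gamma> + (a * b) powr (\<gamma>\<^sup>2))"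
  shows "b \<le> 5 * K * m"
proof (cases "b \<le> m \<or> m = 0")
  case True
  have m0: "0 \<le> m" using a by (simp add: m_def)
  have "b \<le> m"
  proof (cases "m = 0")
    case True
    then have "a = 0" using a unfolding m_def by (metis max.cobounded1 order_antisym)
    then have "b\<^sup>2 \<le> 0" using le by simp
    then show ?thesis using m0 by simp
  qed (use True in simp)
  then show ?thesis using K m0 mult_right_mono[of 1 "5 * K" m] by linarith
next
  case False
  then have m: "m > 0" "m < b" using a by (auto simp: m_def max_def split: if_splits)
  have "b\<^sup>2 \<le> K * (5 * (b / m) * m\<^sup>2)"
    using rate_bound(1)[OF \<gamma> a b, of "b / m"] m K
    by (intro order_trans[OF le] mult_left_mono) (auto simp: m_def[symmetric])
  also have "\<dots> = 5 * K * m * b" using m by (simp add: power2_eq_square)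
  finally have "b * b \<le> (5 * K * m) * b" by (simp add: power2_eq_square)
  then show ?thesis using m by simp
qed

text \<open>
  Here \<open>x\<close> and \<open>y\<close> are the squared distances of the two solutions, and \<open>a\<close>, \<open>b\<close> the initial distances.
  The first estimate bounds \<open>\<integral> y\<close> by \<open>a b\<close>; the second, by Gronwall, bounds \<open>x\<close> in terms
  of \<open>a\<^sup>2\<close>, \<open>a b\<close> and \<open>(a b) powr \<gamma>\<close>; the third bounds \<open>y\<close> by a sum that contains in addition the
  \<open>\<gamma>\<close>-th powers of these quantities. At time \<open>0\<close> the third bound is an inequality for
  \<open>b\<close> itself, which \<open>self_improving_rate\<close> solves.
\<close>

lemma energy_estimates_imp_rate:
  fixes T \<alpha> C \<gamma> :: real
  assumes "0 < T" "0 < \<alpha>" "0 \<le> C" and \<gamma>: "0 < \<gamma>" "\<gamma> \<le> 1"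
  obtains K where "\<And>x y a b t. \<lbrakk>\<forall>t\<in>{0..T}. 0 \<le> x t; \<forall>t\<in>{0..T}. 0 \<le> y t;
      integrable (time T) x; integrable (time T) y; 0 \<le> a; 0 \<le> b; y 0 = b\<^sup>2;
      \<alpha> * (\<integral>s. y s \<partial>time T) \<le> a * b;
      \<forall>t\<in>{0..T}. x t \<le> a\<^sup>2 + C * (\<integral>s. indicat_real {..t} s * (x s + (y s + y s powr \<gamma>)) \<partial>time T);
      \<forall>t\<in>{0..T}. y t \<le> C * (x T + x T powr \<gamma>)
          + C * (\<integral>s. indicat_real {t..} s * ((x s + x s powr \<gamma>) + (y s + y s powr \<gamma>)) \<partial>time T);
      t \<in> {0..T}\<rbrakk> \<Longrightarrow>
      sqrt (y t) \<le> K * max a (a powr (\<gamma>\<^sup>2 / (2 - \<gamma>\<^sup>2))) \<and>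
      sqrt (x t) \<le> K * max a (a powr (\<gamma> / (2 - \<gamma>\<^sup>2)))"
proof -
  \<comment> \<open>\<open>K1\<close> bounds the integral of \<open>y + y powr \<gamma>\<close> (\<open>integral_powr_le\<close>), \<open>E\<close> is the Gronwall factor, \<open>K2\<close> bounds \<open>x\<close>
    and \<open>K3\<close> bounds \<open>y\<close>; the summand \<open>K2\<close> in \<open>K3\<close> only makes \<open>K3\<close> the larger of the two\<close>
  define K1 where "K1 = T + 1 / \<alpha>"
  define E where "E = 2 * exp (2 * (C + 1) * T)"
  define K2 where "K2 = E * (1 + C * K1)"
  define K3 where "K3 = C * (2 * K2) + C * (2 * T * K2 + K1) + K2"
  have K1: "0 < K1" "1 / \<alpha> \<le> K1" using assms by (auto simp: K1_def add_pos_pos)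
  have E: "1 \<le> E"
  proof -
    have "1 \<le> exp (2 * (C + 1) * T)" using assms by simp
    then show ?thesis unfolding E_def by linarith
  qed
  have K2: "1 \<le> K2"
    unfolding K2_def using E K1 \<open>0 \<le> C\<close> mult_mono[of 1 E 1 "1 + C * K1"] by simp
  have K3: "1 \<le> K3" "K2 \<le> K3"
  proof -
    have "0 \<le> C * (2 * K2) + C * (2 * T * K2 + K1)" using assms K1 K2 by simp
    then show "1 \<le> K3" "K2 \<le> K3" using K2 unfolding K3_def by linarith+
  qed
  show thesis
  proof (rule that[of "5 * K3"])
    fix x y :: "real \<Rightarrow> real" and a b :: real and t
    assume x0: "\<forall>t\<in>{0..T}. 0 \<le> x t" and y0: "\<forall>t\<in>{0..T}. 0 \<le> y t"
      and ix: "integrable (time T) x" and iy: "integrable (time T) y"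
      and a: "0 \<le> a" and b: "0 \<le> b" and yb: "y 0 = b\<^sup>2"
      and dual: "\<alpha> * (\<integral>s. y s \<partial>time T) \<le> a * b"
      and fwd: "\<forall>t\<in>{0..T}. x t \<le> a\<^sup>2 + C * (\<integral>s. indicat_real {..t} s * (x s + (y s + y s powr \<gamma>)) \<partial>time T)"
      and bwd: "\<forall>t\<in>{0..T}. y t \<le> C * (x T + x T powr \<gamma>)
          + C * (\<integral>s. indicat_real {t..} s * ((x s + x s powr \<gamma>) + (y s + y s powr \<gamma>)) \<partial>time T)"
      and t: "t \<in> {0..T}"
    interpret L: finite_measure "time T" by (rule finite_measure_time)
    define p where "p = a * b"
    define q where "q = p + p powr \<gamma>"
    define Q where "Q = a\<^sup>2 + a powr (2 * \<gamma>) + p + p powr \<gamma> + p powr (\<gamma>\<^sup>2)"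
    have p: "0 \<le> p" using a b by (simp add: p_def)
    have q: "0 \<le> q" using p by (simp add: q_def)
    note ipow = integral_powr_le[OF iy _ \<gamma> less_imp_le[OF \<open>0 < T\<close>] \<open>0 < \<alpha>\<close> p dual[folded p_def]]
    have iyp: "integrable (time T) (\<lambda>s. y s + y s powr \<gamma>)"
      using iy ipow(1) y0 by auto
    have Iy: "(\<integral>s. y s + y s powr \<gamma> \<partial>time T) \<le> K1 * q"
    proof -
      have "(\<integral>s. y s \<partial>time T) \<le> 1 / \<alpha> * p"
        using dual \<open>0 < \<alpha>\<close> by (simp add: p_def field_simps)
      also have "\<dots> \<le> K1 * p" using K1 p by (intro mult_right_mono) auto
      finally show ?thesis
        using iy ipow y0 by (simp add: q_def K1_def distrib_left)
    qed
    have Iy_part: "(\<integral>s. indicat_real A s * (y s + y s powr \<gamma>) \<partial>time T) \<le> K1 * q" if "A \<in> sets borel" for A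
    proof -
      have "(\<integral>s. indicat_real A s * (y s + y s powr \<gamma>) \<partial>time T) \<le> (\<integral>s. y s + y s powr \<gamma> \<partial>time T)"
        using integrable_time_indicator[OF iyp that] y0
        by (intro integral_mono iyp) (auto simp: indicator_def space_restrict_space)
      with Iy show ?thesis by simp
    qed
    have xbound: "x s \<le> K2 * (a\<^sup>2 + q)" if s: "s \<in> {0..T}" for s
    proof -
      have "x s \<le> 2 * (a\<^sup>2 + C * (K1 * q)) * exp (2 * (C + 1) * T)"
      \<comment> \<open>the rate \<open>C + 1\<close> instead of \<open>C\<close> is positive also when \<open>C = 0\<close>\<close>
      proof (rule Gronwall_integral[OF ix _ _ _ _ s])
        show "0 \<le> a\<^sup>2 + C * (K1 * q)" using \<open>0 \<le> C\<close> K1 q by simp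
        fix r assume r: "r \<in> {0..T}"
        have ixr: "integrable (time T) (\<lambda>s. indicat_real {..r} s * x s)"
          using integrable_time_indicator[OF ix, of "{..r}"] by simp
        have iyr: "integrable (time T) (\<lambda>s. indicat_real {..r} s * (y s + y s powr \<gamma>))"
          using integrable_time_indicator[OF iyp, of "{..r}"] by simp
        have nn: "0 \<le> (\<integral>s. indicat_real {..r} s * x s \<partial>time T)"
          using x0 by (intro integral_nonneg_AE AE_I2) (auto simp: space_restrict_space indicator_def)
        have split: "(\<integral>s. indicat_real {..r} s * (x s + (y s + y s powr \<gamma>)) \<partial>time T)
            = (\<integral>s. indicat_real {..r} s * x s \<partial>time T)
              + (\<integral>s. indicat_real {..r} s * (y s + y s powr \<gamma>) \<partial>time T)"
          unfolding Bochner_Integration.integral_add[OF ixr iyr, symmetric] by (simp add: distrib_left)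
        have "x r \<le> a\<^sup>2 + C * ((\<integral>s. indicat_real {..r} s * x s \<partial>time T)
            + (\<integral>s. indicat_real {..r} s * (y s + y s powr \<gamma>) \<partial>time T))"
          using bspec[OF fwd r] unfolding split .
        also have "\<dots> \<le> a\<^sup>2 + C * ((\<integral>s. indicat_real {..r} s * x s \<partial>time T) + K1 * q)"
          using Iy_part[of "{..r}"] \<open>0 \<le> C\<close> by (intro add_left_mono mult_left_mono) auto
        also have "\<dots> \<le> a\<^sup>2 + C * (K1 * q) + (C + 1) * (\<integral>s. indicat_real {..r} s * x s \<partial>time T)"
          using nn by (simp add: algebra_simps)
        finally show "x r \<le> a\<^sup>2 + C * (K1 * q) + (C + 1) * (\<integral>s. indicat_real {..r} s * x s \<partial>time T)" .
      qed (use x0 \<open>0 \<le> C\<close> in auto)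
      also have "\<dots> = E * (a\<^sup>2 + C * K1 * q)" by (simp add: E_def)
      also have "\<dots> \<le> E * ((1 + C * K1) * (a\<^sup>2 + q))"
        using E \<open>0 \<le> C\<close> K1 q by (intro mult_left_mono) (auto simp: algebra_simps)
      finally show ?thesis by (simp add: K2_def mult.assoc)
    qed
    have xpow: "x s powr \<gamma> \<le> K2 * (a powr (2 * \<gamma>) + (p powr \<gamma> + p powr (\<gamma>\<^sup>2)))" if s: "s \<in> {0..T}" for s
    proof -
      have "x s powr \<gamma> \<le> (K2 * (a\<^sup>2 + q)) powr \<gamma>"
        using xbound[OF s] x0 s \<gamma> by (intro powr_mono2) auto
      also have "\<dots> = K2 powr \<gamma> * (a\<^sup>2 + q) powr \<gamma>" using K2 q by (simp add: powr_mult)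
      also have "\<dots> \<le> K2 * (a\<^sup>2 + q) powr \<gamma>"
        using K2 powr_mono[of \<gamma> 1 K2] \<gamma> by (intro mult_right_mono) auto
      also have "(a\<^sup>2 + q) powr \<gamma> \<le> (a\<^sup>2) powr \<gamma> + (p powr \<gamma> + (p powr \<gamma>) powr \<gamma>)"
        using powr_subadditive[of "a\<^sup>2" q \<gamma>] powr_subadditive[of p "p powr \<gamma>" \<gamma>] p q \<gamma>
        by (simp add: q_def)
      also have "(a\<^sup>2) powr \<gamma> = a powr (2 * \<gamma>)"
        using a by (cases "a = 0") (simp_all add: powr_powr[symmetric])
      also have "(p powr \<gamma>) powr \<gamma> = p powr (\<gamma>\<^sup>2)" by (simp add: powr_powr power2_eq_square)
      finally show ?thesis using K2 by simp
    qed
    have xsum: "x s + x s powr \<gamma> \<le> 2 * K2 * Q" if "s \<in> {0..T}" for s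
    proof -
      have "x s + x s powr \<gamma> \<le> K2 * ((a\<^sup>2 + q) + (a powr (2 * \<gamma>) + (p powr \<gamma> + p powr (\<gamma>\<^sup>2))))"
        using xbound[OF that] xpow[OF that] by (simp add: distrib_left)
      also have "\<dots> \<le> K2 * (2 * Q)"
        using K2 p a by (intro mult_left_mono) (auto simp: Q_def q_def)
      finally show ?thesis by simp
    qed
    have qQ: "q \<le> Q" using a p by (simp add: q_def Q_def)
    have Q0: "0 \<le> Q" using q qQ by simp
    have ybound: "y s \<le> K3 * Q" if s: "s \<in> {0..T}" for s
    proof -
      have "(\<integral>r. indicat_real {s..} r * ((x r + x r powr \<gamma>) + (y r + y r powr \<gamma>)) \<partial>time T)
          \<le> (\<integral>r. 2 * K2 * Q + indicat_real {s..} r * (y r + y r powr \<gamma>) \<partial>time T)"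
      proof (rule integral_mono')
        show "integrable (time T) (\<lambda>r. 2 * K2 * Q + indicat_real {s..} r * (y r + y r powr \<gamma>))"
          using integrable_time_indicator[OF iyp, of "{s..}"] by simp
        fix r assume "r \<in> space (time T)"
        then have r: "r \<in> {0..T}" by (simp add: space_restrict_space)
        show "indicat_real {s..} r * ((x r + x r powr \<gamma>) + (y r + y r powr \<gamma>))
            \<le> 2 * K2 * Q + indicat_real {s..} r * (y r + y r powr \<gamma>)"
          using xsum[OF r] K2 Q0 by (auto simp: indicator_def)
        show "0 \<le> 2 * K2 * Q + indicat_real {s..} r * (y r + y r powr \<gamma>)"
          using y0 r K2 Q0 by (intro add_nonneg_nonneg mult_nonneg_nonneg) auto
      qed
      also have "\<dots> = T * (2 * K2 * Q) + (\<integral>r. indicat_real {s..} r * (y r + y r powr \<gamma>) \<partial>time T)"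
        using integrable_time_indicator[OF iyp, of "{s..}"] measure_time[of T] \<open>0 < T\<close> by simp
      also have "\<dots> \<le> T * (2 * K2 * Q) + K1 * Q"
        using order_trans[OF Iy_part[of "{s..}"] mult_left_mono[OF qQ, of K1]] K1 by simp
      finally have I: "(\<integral>r. indicat_real {s..} r * ((x r + x r powr \<gamma>) + (y r + y r powr \<gamma>)) \<partial>time T)
          \<le> T * (2 * K2 * Q) + K1 * Q" .
      have "y s \<le> C * (x T + x T powr \<gamma>)
          + C * (\<integral>r. indicat_real {s..} r * ((x r + x r powr \<gamma>) + (y r + y r powr \<gamma>)) \<partial>time T)"
        using bwd s by blast
      also have "\<dots> \<le> C * (2 * K2 * Q) + C * (T * (2 * K2 * Q) + K1 * Q)"
        using I xsum[of T] \<open>0 \<le> C\<close> \<open>0 < T\<close> by (intro add_mono mult_left_mono) auto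
      also have "\<dots> = (C * (2 * K2) + C * (2 * T * K2 + K1)) * Q" by (simp add: algebra_simps)
      also have "\<dots> \<le> K3 * Q" using Q0 K2 by (intro mult_right_mono) (auto simp: K3_def)
      finally show ?thesis .
    qed
    let ?m = "max a (a powr (\<gamma>\<^sup>2 / (2 - \<gamma>\<^sup>2)))" and ?m' = "max a (a powr (\<gamma> / (2 - \<gamma>\<^sup>2)))"
    have "b\<^sup>2 \<le> K3 * (a\<^sup>2 + a powr (2 * \<gamma>) + a * b + (a * b) powr \<gamma> + (a * b) powr (\<gamma>\<^sup>2))"
      using ybound[of 0] yb \<open>0 < T\<close> by (simp add: Q_def p_def)
    from self_improving_rate[OF \<gamma> a b K3(1) this] have bm: "b \<le> 5 * K3 * ?m" .
    have R: "1 \<le> 5 * K3" using K3 by simp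
    have m0: "0 \<le> ?m" "0 \<le> ?m'" using a by auto
    have "K3 * Q \<le> K3 * (5 * (5 * K3) * ?m\<^sup>2)"
      unfolding Q_def p_def using K3 by (intro mult_left_mono rate_bound(1)[OF \<gamma> a b R bm]) auto
    then have "y t \<le> K3 * (5 * (5 * K3) * ?m\<^sup>2)" using ybound[OF t] by (rule order_trans[rotated])
    also have "\<dots> = (5 * K3 * ?m)\<^sup>2" by (simp add: power2_eq_square)
    finally have "sqrt (y t) \<le> 5 * K3 * ?m" using K3 m0 by (intro real_le_lsqrt) auto
    moreover have "K2 * (a\<^sup>2 + q) \<le> K2 * (3 * (5 * K3) * ?m'\<^sup>2)"
      unfolding q_def p_def add.assoc[symmetric]
      using K2 by (intro mult_left_mono rate_bound(2)[OF \<gamma> a b R bm]) auto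
    then have "x t \<le> K2 * (3 * (5 * K3) * ?m'\<^sup>2)" using xbound[OF t] by (rule order_trans[rotated])
    then have "x t \<le> K3 * (5 * (5 * K3) * ?m'\<^sup>2)"
      by (rule order_trans) (use K2 K3 in \<open>intro mult_mono, auto\<close>)
    then have "x t \<le> (5 * K3 * ?m')\<^sup>2" by (simp add: power2_eq_square mult_ac)
    then have "sqrt (x t) \<le> 5 * K3 * ?m'" using K3 m0 by (intro real_le_lsqrt) auto
    ultimately show "sqrt (y t) \<le> 5 * K3 * ?m \<and> sqrt (x t) \<le> 5 * K3 * ?m'" ..
  qed
qed

section \<open>Stability of the forward-backward system\<close>

theorem lemma3p32:
  fixes M :: "'a measure" and T :: real
    and W0 :: "real^'d \<Rightarrow> (real^'d) measure \<Rightarrow> real^'d"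
    and F G :: "real^'d \<Rightarrow> (real^'d) measure \<Rightarrow> real^'d \<Rightarrow> real^'d"
    and C1 C2 \<alpha> \<gamma> :: real and w :: "real \<Rightarrow> real"
  assumes "rich_prob_space M" and "T > 0"
    and "continuous_state_law W0"
    and "continuous_state_law_control F" and "continuous_state_law_control G"
    and growth: "\<And>x \<mu> u. \<mu> \<in> P2 \<Longrightarrow>
      norm (W0 x \<mu>) + norm (F x \<mu> u) + norm (G x \<mu> u)
        \<le> C1 * (1 + norm x + norm u + sqrt (second_moment \<mu>))"
    and "\<alpha> > 0"
    and monotone_W0: "\<And>X Y. X \<in> L2_space M \<Longrightarrow> Y \<in> L2_space M \<Longrightarrow>
      L2_inner M (\<lambda>\<omega>. lift_state M W0 X \<omega> - lift_state M W0 Y \<omega>) (\<lambda>\<omega>. X \<omega> - Y \<omega>) \<ge> 0"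
    and monotone_GF: "\<And>X Y U V. X \<in> L2_space M \<Longrightarrow> Y \<in> L2_space M \<Longrightarrow>
      U \<in> L2_space M \<Longrightarrow> V \<in> L2_space M \<Longrightarrow>
      L2_inner M (\<lambda>\<omega>. lift_state_control M G X U \<omega> - lift_state_control M G Y V \<omega>)
          (\<lambda>\<omega>. X \<omega> - Y \<omega>)
        + L2_inner M (\<lambda>\<omega>. lift_state_control M F X U \<omega> - lift_state_control M F Y V \<omega>)
            (\<lambda>\<omega>. U \<omega> - V \<omega>)
        \<ge> \<alpha> * (L2_dist M U V)\<^sup>2"
    and "0 < \<gamma>" and "\<gamma> \<le> 1" and "modulus_of_continuity w"
    and holder_G: "\<And>X Y U V. X \<in> L2_space M \<Longrightarrow> Y \<in> L2_space M \<Longrightarrow>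
      U \<in> L2_space M \<Longrightarrow> V \<in> L2_space M \<Longrightarrow>
      L2_inner M (\<lambda>\<omega>. lift_state_control M G X U \<omega> - lift_state_control M G Y V \<omega>)
          (\<lambda>\<omega>. U \<omega> - V \<omega>)
        \<le> C2 * ((L2_dist_exp M \<gamma> X Y)\<^sup>2 + (L2_dist_exp M \<gamma> U V)\<^sup>2)"
    and holder_F: "\<And>X Y U V. X \<in> L2_space M \<Longrightarrow> Y \<in> L2_space M \<Longrightarrow>
      U \<in> L2_space M \<Longrightarrow> V \<in> L2_space M \<Longrightarrow>
      L2_inner M (\<lambda>\<omega>. lift_state_control M F X U \<omega> - lift_state_control M F Y V \<omega>)
          (\<lambda>\<omega>. X \<omega> - Y \<omega>)
        \<ge> - C2 * ((L2_dist M X Y)\<^sup>2 + (L2_dist_exp M \<gamma> U V)\<^sup>2)"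
    and holder_W0: "\<And>X Y. X \<in> L2_space M \<Longrightarrow> Y \<in> L2_space M \<Longrightarrow>
      L2_dist M (lift_state M W0 X) (lift_state M W0 Y) \<le> C2 * L2_dist_exp M \<gamma> X Y"
    and law_modulus: "\<And>x u \<mu> \<nu>. \<mu> \<in> P2 \<Longrightarrow> \<nu> \<in> P2 \<Longrightarrow>
      norm (F x \<mu> u - F x \<nu> u) + norm (G x \<mu> u - G x \<nu> u) + norm (W0 x \<mu> - W0 x \<nu>)
        \<le> w (wasserstein2 \<mu> \<nu>)"
  shows "\<exists>C. \<forall>\<sigma> \<F> B X0 Y0 X Wx Zx Y Wy Zy.
    \<sigma> \<ge> 0 \<and> filtration_upto M T \<F> \<and> brownian_motion M T \<F> B \<and>
    X0 \<in> L2_space M \<and> X0 \<in> borel_measurable (\<F> 0) \<and>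
    Y0 \<in> L2_space M \<and> Y0 \<in> borel_measurable (\<F> 0) \<and>
    strong_solution M T W0 F G \<sigma> \<F> B X0 X Wx Zx \<and>
    strong_solution M T W0 F G \<sigma> \<F> B Y0 Y Wy Zy \<longrightarrow>
    (\<forall>t\<in>{0..T}.
       L2_dist M (Wx t) (Wy t) \<le> C * L2_dist_exp M (\<gamma>\<^sup>2 / (2 - \<gamma>\<^sup>2)) X0 Y0 \<and>
       L2_dist M (X t) (Y t) \<le> C * L2_dist_exp M (\<gamma> / (2 - \<gamma>\<^sup>2)) X0 Y0)"
proof -
  have M: "prob_space M" using assms(1) by (simp add: rich_prob_space_def)
  have growth': "norm (W0 x \<mu>) + norm (F x \<mu> u) + norm (G x \<mu> u)
      \<le> \<bar>C1\<bar> * (1 + norm x + norm u + sqrt (second_moment \<mu>))" if "\<mu> \<in> P2" for x \<mu> u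
  proof -
    have "C1 * (1 + norm x + norm u + sqrt (second_moment \<mu>))
        \<le> \<bar>C1\<bar> * (1 + norm x + norm u + sqrt (second_moment \<mu>))"
      by (intro mult_right_mono) (auto simp: second_moment_def)
    with growth[OF that, of x u] show ?thesis by linarith
  qed
  interpret mean_field_system M T "\<bar>C1\<bar>" W0 F G
  proof (intro mean_field_system.intro mean_field_system_axioms.intro M assms(2-5))
    fix x u :: "real^'d" and \<mu> :: "(real^'d) measure" assume \<mu>: "\<mu> \<in> P2"
    show "norm (W0 x \<mu>) \<le> \<bar>C1\<bar> * (1 + norm x + sqrt (second_moment \<mu>))"
      \<comment> \<open>the bound on \<open>W0\<close> does not involve a control, so the control is set to \<open>0\<close>\<close>
      using growth'[OF \<mu>, of x 0] norm_ge_zero[of "F x \<mu> 0"] norm_ge_zero[of "G x \<mu> 0"]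
      by (simp only: norm_zero add_0_right)
    show "norm (F x \<mu> u) \<le> \<bar>C1\<bar> * (1 + norm x + norm u + sqrt (second_moment \<mu>))"
      using growth'[OF \<mu>, of x u] norm_ge_zero[of "W0 x \<mu>"] norm_ge_zero[of "G x \<mu> u"] by linarith
    show "norm (G x \<mu> u) \<le> \<bar>C1\<bar> * (1 + norm x + norm u + sqrt (second_moment \<mu>))"
      using growth'[OF \<mu>, of x u] norm_ge_zero[of "W0 x \<mu>"] norm_ge_zero[of "F x \<mu> u"] by linarith
  qed
  define C where "C = \<bar>C2\<bar>"
  \<comment> \<open>large enough both for the factor \<open>2 C\<close> of the drift terms and for the square \<open>C\<^sup>2\<close> from the terminal condition\<close>
  define D where "D = 2 * C + 2 * C\<^sup>2"
  have C: "0 \<le> C" "2 * C \<le> D" "2 * C\<^sup>2 \<le> D" "0 \<le> D" by (auto simp: C_def D_def)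
  have exp_le: "(L2_dist_exp M \<gamma> U V)\<^sup>2 \<le> (L2_dist M U V)\<^sup>2 + (L2_dist M U V)\<^sup>2 powr \<gamma>" for U V :: "'a \<Rightarrow> real^'d"
  proof -
    have "(L2_dist M U V powr \<gamma>)\<^sup>2 = (L2_dist M U V)\<^sup>2 powr \<gamma>"
      using L2_dist_nonneg[of M U V] by (simp add: power2_eq_square powr_mult)
    then show ?thesis by (auto simp: L2_dist_exp_def max_def)
  qed
  show ?thesis
  proof (rule energy_estimates_imp_rate[OF \<open>T > 0\<close> \<open>\<alpha> > 0\<close> C(4) \<open>0 < \<gamma>\<close> \<open>\<gamma> \<le> 1\<close>])
    fix K assume K: "\<And>x y a b t. \<lbrakk>\<forall>t\<in>{0..T}. 0 \<le> x t; \<forall>t\<in>{0..T}. 0 \<le> y t;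
      integrable (time T) x; integrable (time T) y; 0 \<le> a; 0 \<le> b; y 0 = b\<^sup>2;
      \<alpha> * (\<integral>s. y s \<partial>time T) \<le> a * b;
      \<forall>t\<in>{0..T}. x t \<le> a\<^sup>2 + D * (\<integral>s. indicat_real {..t} s * (x s + (y s + y s powr \<gamma>)) \<partial>time T);
      \<forall>t\<in>{0..T}. y t \<le> D * (x T + x T powr \<gamma>)
          + D * (\<integral>s. indicat_real {t..} s * ((x s + x s powr \<gamma>) + (y s + y s powr \<gamma>)) \<partial>time T);
      t \<in> {0..T}\<rbrakk> \<Longrightarrow>
      sqrt (y t) \<le> K * max a (a powr (\<gamma>\<^sup>2 / (2 - \<gamma>\<^sup>2))) \<and>
      sqrt (x t) \<le> K * max a (a powr (\<gamma> / (2 - \<gamma>\<^sup>2)))"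
    show ?thesis
    proof (intro exI[of _ K] allI impI, elim conjE)
      fix \<sigma> \<F> B X0 Y0 X Wx Zx Y Wy Zy
      assume "\<sigma> \<ge> 0" and filt: "filtration_upto M T \<F>" and B: "brownian_motion M T \<F> B"
        and X0: "X0 \<in> L2_space M" "X0 \<in> borel_measurable (\<F> 0)"
        and Y0: "Y0 \<in> L2_space M" "Y0 \<in> borel_measurable (\<F> 0)"
        and solX: "strong_solution M T W0 F G \<sigma> \<F> B X0 X Wx Zx"
        and solY: "strong_solution M T W0 F G \<sigma> \<F> B Y0 Y Wy Zy"
      note pair = filt B \<open>\<sigma> \<ge> 0\<close> X0 Y0 solX solY
      note sX = filt B \<open>\<sigma> \<ge> 0\<close> solX
      note sY = filt B \<open>\<sigma> \<ge> 0\<close> solY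
      let ?dX = "\<lambda>t \<omega>. X t \<omega> - Y t \<omega>" and ?dW = "\<lambda>t \<omega>. Wx t \<omega> - Wy t \<omega>"
      let ?dF = "\<lambda>t \<omega>. lift_state_control M F (X t) (Wx t) \<omega> - lift_state_control M F (Y t) (Wy t) \<omega>"
      let ?dG = "\<lambda>t \<omega>. lift_state_control M G (X t) (Wx t) \<omega> - lift_state_control M G (Y t) (Wy t) \<omega>"
      let ?dterm = "\<lambda>\<omega>. lift_state M W0 (X T) \<omega> - lift_state M W0 (Y T) \<omega>"
      let ?dinit = "\<lambda>\<omega>. X0 \<omega> - Y0 \<omega>"
      let ?x = "\<lambda>t. L2_inner M (?dX t) (?dX t)" and ?y = "\<lambda>t. L2_inner M (?dW t) (?dW t)"
      note si = difference_square_integrable[OF pair] and L2 = difference_L2[OF pair]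
      have L: "X t \<in> L2_space M" "Y t \<in> L2_space M" "Wx t \<in> L2_space M" "Wy t \<in> L2_space M" if "t \<in> {0..T}" for t
        using solution_L2[OF sX that] solution_L2[OF sY that] by auto
      have sq: "?x t = (L2_dist M (X t) (Y t))\<^sup>2" "?y t = (L2_dist M (Wx t) (Wy t))\<^sup>2" for t
        by (simp_all add: L2_dist_def L2_norm_squared)
      have T: "T \<in> {0..T}" "0 \<in> {0..T}" using \<open>T > 0\<close> by auto
      have ix: "integrable (time T) ?x" and iy: "integrable (time T) ?y"
        by (rule integrable_L2_inner_process(1)[OF si(1) si(1)], rule integrable_L2_inner_process(1)[OF si(2) si(2)])
      have pow: "integrable (time T) (\<lambda>t. z t powr \<gamma>)"
        if "integrable (time T) z" "\<And>t. 0 \<le> z t" for z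
      proof -
        have "0 \<le> (\<integral>s. z s \<partial>time T)" using that by simp
        then show ?thesis
          using integral_powr_le(1)[of T z \<gamma> 1 "\<integral>s. z s \<partial>time T"] that \<open>0 < \<gamma>\<close> \<open>\<gamma> \<le> 1\<close> \<open>T > 0\<close> by simp
      qed
      have ix': "integrable (time T) (\<lambda>s. ?x s powr \<gamma>)" and iy': "integrable (time T) (\<lambda>s. ?y s powr \<gamma>)"
        using pow[OF ix] pow[OF iy] L2_inner_self_nonneg by auto
      have dual: "\<alpha> * (\<integral>s. ?y s \<partial>time T) \<le> L2_dist M X0 Y0 * L2_dist M (Wx 0) (Wy 0)"
      proof -
        have "\<alpha> * (\<integral>s. ?y s \<partial>time T) = (\<integral>s. \<alpha> * ?y s \<partial>time T)" by simp
        also have "\<dots> \<le> (\<integral>s. L2_inner M (?dG s) (?dX s) + L2_inner M (?dF s) (?dW s) \<partial>time T)"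
        proof (rule integral_mono)
          show "integrable (time T) (\<lambda>s. L2_inner M (?dG s) (?dX s) + L2_inner M (?dF s) (?dW s))"
            by (intro Bochner_Integration.integrable_add integrable_L2_inner_process(1) si)
          fix s assume "s \<in> space (time T)"
          then have "s \<in> {0..T}" by (simp add: space_restrict_space)
          from monotone_GF[OF L[OF this]]
          show "\<alpha> * ?y s \<le> L2_inner M (?dG s) (?dX s) + L2_inner M (?dF s) (?dW s)" by (simp add: sq)
        qed (use iy in simp)
        also have "\<dots> \<le> L2_inner M ?dterm (?dX T) + \<dots>"
          using monotone_W0[OF L(1,2)[OF T(1)]] by simp
        also have "\<dots> = L2_inner M (?dW 0) ?dinit" using difference_duality[OF pair] by simp
        also have "\<dots> \<le> L2_norm M (?dW 0) * L2_norm M ?dinit"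
          using L2_Cauchy_Schwarz[OF L2(2)[OF T(2)] L2(6)] by linarith
        finally show ?thesis by (simp add: L2_dist_def mult.commute)
      qed
      have fwd: "?x t \<le> (L2_dist M X0 Y0)\<^sup>2
          + D * (\<integral>s. indicat_real {..t} s * (?x s + (?y s + ?y s powr \<gamma>)) \<partial>time T)" if t: "t \<in> {0..T}" for t
      proof -
        let ?J = "\<integral>s. indicat_real {..t} s * (?x s + (?y s + ?y s powr \<gamma>)) \<partial>time T"
        have iJ: "integrable (time T) (\<lambda>s. indicat_real {..t} s * (?x s + (?y s + ?y s powr \<gamma>)))"
          using integrable_time_indicator[of T "\<lambda>s. ?x s + (?y s + ?y s powr \<gamma>)" "{..t}"] ix iy iy' by simp
        have "- C * ?J = (\<integral>s. - C * (indicat_real {..t} s * (?x s + (?y s + ?y s powr \<gamma>))) \<partial>time T)" by simp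
        also have "\<dots> \<le> (\<integral>s. indicat_real {..t} s * L2_inner M (?dF s) (?dX s) \<partial>time T)"
        proof (rule integral_mono)
          show "integrable (time T) (\<lambda>s. - C * (indicat_real {..t} s * (?x s + (?y s + ?y s powr \<gamma>))))"
            using iJ by (rule integrable_mult_right)
          show "integrable (time T) (\<lambda>s. indicat_real {..t} s * L2_inner M (?dF s) (?dX s))"
            using integrable_time_indicator[OF integrable_L2_inner_process(1)[OF si(3) si(1)], of "{..t}"] by simp
          fix s assume "s \<in> space (time T)"
          then have s: "s \<in> {0..T}" by (simp add: space_restrict_space)
          have "- C * (?x s + (?y s + ?y s powr \<gamma>))
              \<le> - C * ((L2_dist M (X s) (Y s))\<^sup>2 + (L2_dist_exp M \<gamma> (Wx s) (Wy s))\<^sup>2)"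
            using exp_le[of "Wx s" "Wy s"] C(1) by (intro mult_left_mono_neg) (auto simp: sq)
          also have "\<dots> \<le> - C2 * ((L2_dist M (X s) (Y s))\<^sup>2 + (L2_dist_exp M \<gamma> (Wx s) (Wy s))\<^sup>2)"
            by (intro mult_right_mono) (auto simp: C_def)
          also have "\<dots> \<le> L2_inner M (?dF s) (?dX s)" by (rule holder_F[OF L[OF s]])
          finally show "- C * (indicat_real {..t} s * (?x s + (?y s + ?y s powr \<gamma>)))
              \<le> indicat_real {..t} s * L2_inner M (?dF s) (?dX s)" by (simp add: indicator_def)
        qed
        finally have "?x t \<le> L2_inner M ?dinit ?dinit + 2 * C * ?J"
          using difference_forward_energy[OF pair t] by simp
        moreover have "0 \<le> ?J"
          by (intro integral_nonneg_AE AE_I2) (auto simp: L2_inner_self_nonneg indicator_def)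
        then have "2 * C * ?J \<le> D * ?J" by (rule mult_right_mono[OF C(2)])
        ultimately show ?thesis by (simp add: L2_dist_def L2_norm_squared)
      qed
      have bwd: "?y t \<le> D * (?x T + ?x T powr \<gamma>)
          + D * (\<integral>s. indicat_real {t..} s * ((?x s + ?x s powr \<gamma>) + (?y s + ?y s powr \<gamma>)) \<partial>time T)"
        if t: "t \<in> {0..T}" for t
      proof -
        let ?j = "\<lambda>s. (?x s + ?x s powr \<gamma>) + (?y s + ?y s powr \<gamma>)"
        let ?J = "\<integral>s. indicat_real {t..} s * ?j s \<partial>time T"
        have iJ: "integrable (time T) (\<lambda>s. indicat_real {t..} s * ?j s)"
          using integrable_time_indicator[of T ?j "{t..}"] ix ix' iy iy' by simp
        have "(\<integral>s. indicat_real {t..} s * L2_inner M (?dG s) (?dW s) \<partial>time T)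
            \<le> (\<integral>s. C * (indicat_real {t..} s * ?j s) \<partial>time T)"
        proof (rule integral_mono)
          show "integrable (time T) (\<lambda>s. C * (indicat_real {t..} s * ?j s))"
            using iJ by (rule integrable_mult_right)
          show "integrable (time T) (\<lambda>s. indicat_real {t..} s * L2_inner M (?dG s) (?dW s))"
            using integrable_time_indicator[OF integrable_L2_inner_process(1)[OF si(4) si(2)], of "{t..}"] by simp
          fix s assume "s \<in> space (time T)"
          then have s: "s \<in> {0..T}" by (simp add: space_restrict_space)
          have "L2_inner M (?dG s) (?dW s)
              \<le> C2 * ((L2_dist_exp M \<gamma> (X s) (Y s))\<^sup>2 + (L2_dist_exp M \<gamma> (Wx s) (Wy s))\<^sup>2)"
            by (rule holder_G[OF L[OF s]])
          also have "\<dots> \<le> C * ((L2_dist_exp M \<gamma> (X s) (Y s))\<^sup>2 + (L2_dist_exp M \<gamma> (Wx s) (Wy s))\<^sup>2)"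
            by (intro mult_right_mono) (auto simp: C_def)
          also have "\<dots> \<le> C * ?j s"
            using exp_le[of "Wx s" "Wy s"] exp_le[of "X s" "Y s"] C(1) by (intro mult_left_mono add_mono) (auto simp: sq)
          finally show "indicat_real {t..} s * L2_inner M (?dG s) (?dW s) \<le> C * (indicat_real {t..} s * ?j s)"
            by (simp add: indicator_def)
        qed
        then have "?y t \<le> L2_inner M ?dterm ?dterm + 2 * C * ?J"
          using difference_backward_energy[OF pair t] by simp
        moreover have "0 \<le> ?J"
          by (intro integral_nonneg_AE AE_I2) (auto simp: L2_inner_self_nonneg indicator_def)
        then have "2 * C * ?J \<le> D * ?J" by (rule mult_right_mono[OF C(2)])
        moreover have "L2_inner M ?dterm ?dterm \<le> D * (?x T + ?x T powr \<gamma>)"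
        proof -
          have "L2_dist M (lift_state M W0 (X T)) (lift_state M W0 (Y T)) \<le> C2 * L2_dist_exp M \<gamma> (X T) (Y T)"
            by (rule holder_W0[OF L(1,2)[OF T(1)]])
          also have "\<dots> \<le> C * L2_dist_exp M \<gamma> (X T) (Y T)"
            by (intro mult_right_mono) (auto simp: C_def L2_dist_exp_def max_def L2_dist_nonneg)
          finally have "(L2_dist M (lift_state M W0 (X T)) (lift_state M W0 (Y T)))\<^sup>2
              \<le> (C * L2_dist_exp M \<gamma> (X T) (Y T))\<^sup>2"
            by (rule power_mono) (rule L2_dist_nonneg)
          also have "\<dots> = C\<^sup>2 * (L2_dist_exp M \<gamma> (X T) (Y T))\<^sup>2" by (simp add: power_mult_distrib)
          also have "\<dots> \<le> D * (?x T + ?x T powr \<gamma>)"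
            using exp_le[of "X T" "Y T"] C by (intro mult_mono) (auto simp: sq D_def)
          finally show ?thesis by (simp add: L2_dist_def L2_norm_squared)
        qed
        ultimately show ?thesis by linarith
      qed
      have "sqrt (?y t) \<le> K * max (L2_dist M X0 Y0) (L2_dist M X0 Y0 powr (\<gamma>\<^sup>2 / (2 - \<gamma>\<^sup>2))) \<and>
          sqrt (?x t) \<le> K * max (L2_dist M X0 Y0) (L2_dist M X0 Y0 powr (\<gamma> / (2 - \<gamma>\<^sup>2)))"
        if "t \<in> {0..T}" for t
        by (rule K[OF _ _ ix iy L2_dist_nonneg L2_dist_nonneg sq(2) dual _ _ that])
           (use fwd bwd L2_inner_self_nonneg in blast)+
      then show "\<forall>t\<in>{0..T}.
         L2_dist M (Wx t) (Wy t) \<le> K * L2_dist_exp M (\<gamma>\<^sup>2 / (2 - \<gamma>\<^sup>2)) X0 Y0 \<and>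
         L2_dist M (X t) (Y t) \<le> K * L2_dist_exp M (\<gamma> / (2 - \<gamma>\<^sup>2)) X0 Y0"
        by (simp add: L2_dist_exp_def L2_dist_def L2_norm_def)
    qed
  qed
qed

end
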